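(* Let $\alpha,\beta>-1$, $a>-1$ and $\lambda\in(0,1)$. The following hold as $n\to\infty$ (through the positive integers, with $a,\alpha,\beta,\lambda$ fixed). (1) If $a\in\left(-\frac{2\lambda}{1+\lambda},\frac{2\lambda}{1-\lambda}\right)$ then $$\lambda^{an+\alpha}P_{n}^{(an+\alpha,\beta)}(1-2\lambda^{2})=\sqrt{\frac{2}{n\pi}}\,\frac{((1-\lambda^{2})(a+1))^{-\frac{\beta}{2}}}{\left((1-\lambda^{2})((a+2)\lambda+a)((a+2)\lambda-a)\right)^{\frac14}}\cos\left((n+1)h(\varphi_{+})+(\alpha-a)\varphi_{+}+(\beta-1)\psi+\frac{\pi}{4}\right)+O\left(\frac{1}{n^{3/2}}\right),$$ where $\varphi_+$, $h(\varphi_+)$, $\psi\in(-\pi,\pi]$ are the phases depending on $a,\lambda$ given in the context. (2) If $a=\frac{2\lambda}{1-\lambda}$ then $$\lambda^{an+\alpha}P_{n}^{(an+\alpha,\beta)}(1-2\lambda^{2})=\frac{(1+\lambda)^{-\beta}}{3^{2/3}\Gamma(2/3)\,n^{1/3}\lambda^{1/3}(1+\lambda)^{1/3}}\left(1+O\left(\frac{1}{n^{1/3}}\right)\right).$$ If $a=-\frac{2\lambda}{1+\lambda}$ then $$\lambda^{an+\alpha}P_{n}^{(an+\alpha,\beta)}(1-2\lambda^{2})=\frac{(1-\lambda)^{-\beta}}{3^{2/3}\Gamma(2/3)\,n^{1/3}\lambda^{1/3}(1-\lambda)^{1/3}}\left(\cos((an+\alpha)\pi)-\sqrt{3}\sin((an+\alpha)\pi)\right)+O\left(\frac{1}{n^{2/3}}\right).$$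 (3) If $a\in\left(-1,-\frac{2\lambda}{1+\lambda}\right)\cup\left(\frac{2\lambda}{1-\lambda},\infty\right)$, then $\lambda^{an+\alpha}P_{n}^{(an+\alpha,\beta)}(1-2\lambda^{2})$ decays exponentially in magnitude along those $n$ for which $an+\alpha$ is an integer: there are $C>0$ and $\rho\in(0,1)$ such that $\left|\lambda^{an+\alpha}P_{n}^{(an+\alpha,\beta)}(1-2\lambda^{2})\right|\le C\rho^n$ for all positive integers $n$ with $an+\alpha\in\mathbb{Z}$. (4) If $a\in\left(-1,-\frac{2\lambda}{1+\lambda}\right)$ and the sequence $(an+\alpha)_n$ is separate from the integers, i.e. $\inf_{n\ge1}\operatorname{dist}(an+\alpha,\mathbb{Z})>0$, then $\lambda^{an+\alpha}P_{n}^{(an+\alpha,\beta)}(1-2\lambda^{2})$ increases exponentially in magnitude: there are $c>0$, $\rho>1$ and $N$ such that $\left|\lambda^{an+\alpha}P_{n}^{(an+\alpha,\beta)}(1-2\lambda^{2})\right|\ge c\rho^n$ for all $n\ge N$. If $a\in\left(\frac{2\lambda}{1-\lambda},\infty\right)$, then this quantity decays exponentially in magnitude along those $n$ for which $an+\alpha$ is not an integer: there are $C>0$ and $\rho\in(0,1)$ such that $\left|\lambda^{an+\alpha}P_{n}^{(an+\alpha,\beta)}(1-2\lambda^{2})\right|\le C\rho^n$ for all positive integers $n$ with $an+\alpha\notin\mathbb{Z}$.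
   Context: The Jacobi polynomial of degree $n$ with real parameters $A,B$ is $$P_n^{(A,B)}(x)=\sum_{\mu=0}^n\binom{n+A}{n-\mu}\binom{n+B}{\mu}\left(\frac{x-1}{2}\right)^{\mu}\left(\frac{x+1}{2}\right)^{n-\mu},$$ with generalized binomial coefficients. Constants implied in $O(\cdot)$ may depend on $a,\alpha,\beta,\lambda$. Powers are taken with respect to the principal branch of the complex logarithm; $\mathrm{Arg}$ is the principal argument with values in $(-\pi,\pi]$. For $\varphi\in[0,\pi]$ put $$h(\varphi)=\mathrm{Arg}\left(\frac{z^{a+1}(1-\lambda z)}{z-\lambda}\right)\Big|_{z=e^{i\varphi}}.$$ For $a\in\left(-\frac{2\lambda}{1+\lambda},\frac{2\lambda}{1-\lambda}\right)$ the angle $\varphi_+\in[0,\pi]$ is defined by $$z_+=e^{i\varphi_{+}}=\frac{a+a\lambda^{2}+2\lambda^{2}}{2\lambda(a+1)}+i\sqrt{1-\left(\frac{a+a\lambda^{2}+2\lambda^{2}}{2\lambda(a+1)}\right)^{2}},$$ and $\psi\in(-\pi,\pi]$ is defined by $\sqrt{\frac{1-\lambda^{2}}{a+1}}\,e^{i\psi}=1-\lambda z_{+}$. *)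

theory Defs
  imports "HOL-Analysis.Analysis" "HOL-Library.Landau_Symbols"
begin

definition jacobi :: "nat \<Rightarrow> real \<Rightarrow> real \<Rightarrow> real \<Rightarrow> real" where
  "jacobi n A B x =
     (\<Sum>\<mu>=0..n. ((real n + A) gchoose (n - \<mu>)) * ((real n + B) gchoose \<mu>)
              * ((x - 1) / 2) ^ \<mu> * ((x + 1) / 2) ^ (n - \<mu>))"

definition scaled_jacobi :: "real \<Rightarrow> real \<Rightarrow> real \<Rightarrow> real \<Rightarrow> nat \<Rightarrow> real" where
  "scaled_jacobi a \<alpha> \<beta> l n =
     l powr (a * real n + \<alpha>) * jacobi n (a * real n + \<alpha>) \<beta> (1 - 2 * l\<^sup>2)"

text \<open>Both \<^const>\<open>Arg\<close> and the complex \<^const>\<open>powr\<close> refer to the principal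
  branch, with arguments in the half-open interval from \<open>-\<pi>\<close> (excluded) to \<open>\<pi>\<close> (included).\<close>

definition h_phase :: "real \<Rightarrow> real \<Rightarrow> real \<Rightarrow> real" where
  "h_phase a l \<phi> =
     (let z = exp (\<i> * of_real \<phi>)
      in Arg (z powr of_real (a + 1) * (1 - of_real l * z) / (z - of_real l)))"

definition re_plus :: "real \<Rightarrow> real \<Rightarrow> real" where
  "re_plus a l = (a + a * l\<^sup>2 + 2 * l\<^sup>2) / (2 * l * (a + 1))"

definition z_plus :: "real \<Rightarrow> real \<Rightarrow> complex" where
  "z_plus a l = of_real (re_plus a l) + \<i> * of_real (sqrt (1 - (re_plus a l)\<^sup>2))"

text \<open>The two descriptions below are meaningful for \<open>0 < l < 1\<close> and
  \<open>-2l/(1+l) < a < 2l/(1-l)\<close>; see \<open>phi_plus_ex1\<close> and \<open>psi_plus_ex1\<close>.\<close>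

definition phi_plus :: "real \<Rightarrow> real \<Rightarrow> real" where
  "phi_plus a l = (THE \<phi>. 0 \<le> \<phi> \<and> \<phi> \<le> pi \<and> exp (\<i> * of_real \<phi>) = z_plus a l)"

definition psi_plus :: "real \<Rightarrow> real \<Rightarrow> real" where
  "psi_plus a l = (THE \<psi>. - pi < \<psi> \<and> \<psi> \<le> pi \<and>
     of_real (sqrt ((1 - l\<^sup>2) / (a + 1))) * exp (\<i> * of_real \<psi>) = 1 - of_real l * z_plus a l)"

lemma ex1_polar_angle:
  fixes w :: complex
  assumes "w \<noteq> 0"
  shows "\<exists>!t. - pi < t \<and> t \<le> pi \<and> of_real (norm w) * exp (\<i> * of_real t) = w"
proof (rule ex1I[of _ "Arg w"])
  show "- pi < Arg w \<and> Arg w \<le> pi \<and> of_real (norm w) * exp (\<i> * of_real (Arg w)) = w"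
    using Arg_eq[OF assms] mpi_less_Arg[of w] Arg_le_pi[of w] by simp
next
  fix t assume "- pi < t \<and> t \<le> pi \<and> of_real (norm w) * exp (\<i> * of_real t) = w"
  then show "t = Arg w"
    using Arg_unique[of "norm w" t w] assms by auto
qed

lemma re_plus_bounds:
  assumes "0 < l" "l < 1" "- (2 * l / (1 + l)) < a" "a < 2 * l / (1 - l)"
  shows "- 1 < a" "\<bar>re_plus a l\<bar> < 1"
proof -
  have lo: "- 2 * l < a * (1 + l)" and hi: "a * (1 - l) < 2 * l"
    using assms by (simp_all add: field_simps)
  have "2 * l / (1 + l) < 1"
    using assms by (simp add: field_simps)
  then show a: "- 1 < a"
    using assms(3) by linarith
  have d: "0 < 2 * l * (a + 1)"
    using a assms by simp
  have "0 < (1 - l) * (2 * l - a * (1 - l))"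
    using hi assms by (intro mult_pos_pos) auto
  then have "a + a * l\<^sup>2 + 2 * l\<^sup>2 < 2 * l * (a + 1)"
    by (simp add: algebra_simps power2_eq_square)
  moreover have "0 < (1 + l) * (2 * l + a * (1 + l))"
    using lo assms by (intro mult_pos_pos) auto
  then have "- (2 * l * (a + 1)) < a + a * l\<^sup>2 + 2 * l\<^sup>2"
    by (simp add: algebra_simps power2_eq_square)
  ultimately show "\<bar>re_plus a l\<bar> < 1"
    using d by (simp add: re_plus_def abs_less_iff pos_divide_less_eq minus_divide_left del: minus_add_distrib)
qed

lemma Re_Im_z_plus:
  "Re (z_plus a l) = re_plus a l" "Im (z_plus a l) = sqrt (1 - (re_plus a l)\<^sup>2)"
  by (simp_all add: z_plus_def)

lemma phi_plus_ex1:
  assumes "0 < l" "l < 1" "- (2 * l / (1 + l)) < a" "a < 2 * l / (1 - l)"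
  shows "\<exists>!\<phi>. 0 \<le> \<phi> \<and> \<phi> \<le> pi \<and> exp (\<i> * of_real \<phi>) = z_plus a l"
proof -
  have "(re_plus a l)\<^sup>2 \<le> 1"
    using re_plus_bounds(2)[OF assms] by (simp add: abs_square_le_1)
  then have n: "norm (z_plus a l) = 1" and im: "0 \<le> Im (z_plus a l)"
    by (simp_all add: cmod_def Re_Im_z_plus)
  then have "z_plus a l \<noteq> 0" by auto
  from ex1_polar_angle[OF this] n
  have ex: "\<exists>!t. - pi < t \<and> t \<le> pi \<and> exp (\<i> * of_real t) = z_plus a l"
    by simp
  then obtain t where t: "- pi < t" "t \<le> pi" "exp (\<i> * of_real t) = z_plus a l"
    by blast
  have "0 \<le> sin t"
    using im unfolding t(3)[symmetric] by (simp add: Im_exp)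
  then have "0 \<le> t"
    using t(1) sin_gt_zero[of "- t"] by (cases "0 \<le> t") auto
  then show ?thesis
  proof (intro ex1I[of _ t] conjI)
    fix s assume s: "0 \<le> s \<and> s \<le> pi \<and> exp (\<i> * of_real s) = z_plus a l"
    then have "- pi < s"
      using pi_gt_zero by linarith
    with s t ex show "s = t"
      by blast
  qed (use t in auto)
qed

lemma psi_plus_ex1:
  assumes "0 < l" "l < 1" "- (2 * l / (1 + l)) < a" "a < 2 * l / (1 - l)"
  shows "\<exists>!\<psi>. - pi < \<psi> \<and> \<psi> \<le> pi \<and>
     of_real (sqrt ((1 - l\<^sup>2) / (a + 1))) * exp (\<i> * of_real \<psi>) = 1 - of_real l * z_plus a l"
proof -
  let ?w = "1 - of_real l * z_plus a l"
  note b = re_plus_bounds[OF assms]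
  have "(re_plus a l)\<^sup>2 \<le> 1"
    using b(2) by (simp add: abs_square_le_1)
  then have "(Re ?w)\<^sup>2 + (Im ?w)\<^sup>2 = 1 - 2 * l * re_plus a l + l\<^sup>2"
    by (simp add: Re_Im_z_plus power_mult_distrib) (simp add: algebra_simps power2_eq_square)
  also have "\<dots> = (1 - l\<^sup>2) / (a + 1)"
    using b(1) assms(1) by (simp add: re_plus_def divide_simps) (simp add: algebra_simps)
  finally have n: "norm ?w = sqrt ((1 - l\<^sup>2) / (a + 1))"
    by (simp add: cmod_def)
  have "l\<^sup>2 < 1"
    using assms by (simp add: abs_square_less_1)
  then have "norm ?w > 0"
    unfolding n using b(1) by simp
  then have "?w \<noteq> 0" by auto
  from ex1_polar_angle[OF this] show ?thesis
    by (simp only: n)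
qed

end

theory Submission
  imports Defs "HOL-Complex_Analysis.Complex_Analysis" "HOL-Real_Asymp.Real_Asymp"
begin

text \<open>
  Let \<open>A = a n + \<alpha>\<close> and let \<open>J\<close> denote the scaled polynomial. The number
  \<open>(1 - l^2)^\<beta> J\<close> is the \<open>n\<close>-th Taylor coefficient at \<open>z = l\<close> of
  \<open>z^(n+A) (1 - l z)^(n+\<beta>)\<close> (\<open>jacobi_generating_fps\<close>), hence a Cauchy integral around \<open>l\<close>. For
  non-integral \<open>A\<close> the function has a branch cut along the negative axis. Since it is real on the positive
  axis, the upper half of the circle suffices, and the cut adds
  \<open>sin (pi (a n + \<alpha>))\<close> times an integral of a positive density (\<open>half_disc_coefficient\<close>,
  \<open>jacobi_arc_formula\<close>). In the coordinate \<open>z = exp (\<i> w)\<close> the integrand is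
  \<open>exp (n phase) amplitude\<close>, holomorphic in a strip around the real line, and the contour may be deformed
  within the strip as long as the cut is followed up to the radius at which the contour meets it
  (\<open>jacobi_contour_formula\<close>).

  On the unit circle \<open>exp phase\<close> has modulus one, and its argument turns with
  a speed, \<open>slope\<close>, that increases on \<open>[0, pi]\<close> from \<open>a - 2l/(1-l)\<close> to \<open>a + 2l/(1+l)\<close>. To first
  order, moving a point of the contour by \<open>\<i> \<eta>\<close> multiplies the modulus by
  \<open>exp (- \<eta> slope)\<close>, and there is no quadratic correction (\<open>Re_phase_bound\<close>).

  If the slope has no zero, the contour is shifted as a whole to the side on which the integrand is
  exponentially small, and only the cut integral remains (\<open>shifted_contour_estimate\<close>). For
  \<open>a > 2l/(1-l)\<close> the shift goes inwards and the cut integral is exponentially small as well. For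
  \<open>a < - 2l/(1+l)\<close> it goes outwards; the cut integral then grows exponentially, and its sine
  factor decides between growth and, at integers, decay (\<open>decay_above\<close>, \<open>decay_below\<close>,
  \<open>growth_below\<close>).

  If the slope vanishes at \<open>\<phi>0\<close>, it changes sign at most there, and a straight line through \<open>\<phi>0\<close> with a small
  positive inclination is a descent contour on its whole length (\<open>tilted_line\<close>). Unless \<open>\<phi>0 = pi\<close>, it ends inside the unit
  circle, which makes the cut integral negligible (\<open>jacobi_bigo_transfer\<close>). The contribution of each ray issuing from
  \<open>\<phi>0\<close> follows from Laplace's method with two terms (\<open>laplace_ray\<close>, \<open>saddle_ray\<close>). For \<open>a\<close> strictly
  between the two boundary values, \<open>\<phi>0 = \<phi>\<^sub>+\<close> is a simple saddle in the open interval; the two opposite rays add up in the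
  leading order \<open>n^(-1/2)\<close> and cancel in the order \<open>n^(-1)\<close>, which leaves the error \<open>n^(-3/2)\<close>
  (\<open>oscillatory_asymptotics\<close>). At the two boundary values the saddle is cubic and sits at an end point,
  \<open>z = 1\<close> or \<open>z = - 1\<close>, with contributions of order \<open>n^(-1/3)\<close> and errors of order \<open>n^(-2/3)\<close>
  (\<open>upper_turning_raw\<close>, \<open>lower_turning_raw\<close>). At \<open>z = - 1\<close> the contour has to be continued along the
  cut to a radius below one, and the interplay of the two rays produces the trigonometric factor.
\<close>

section \<open>Laplace integrals along a ray\<close>

text \<open>
  The integral of \<open>exp (- c s^m) s^j\<close> over the half line, the model to which every saddle
  point integral is reduced: a phase that behaves like \<open>- c s^m\<close> near \<open>s = 0\<close>
  produces these numbers as coefficients. Here \<open>m = 2\<close> belongs to a simple saddle and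
  \<open>m = 3\<close> to a coalescence of two saddles; \<open>c\<close> is complex because the ray need not
  be the direction of steepest descent.
\<close>

definition moment :: "nat \<Rightarrow> complex \<Rightarrow> nat \<Rightarrow> complex" where
  "moment m c j = (LINT s:{0..}|lborel. exp (- c * of_real (s ^ m)) * of_real (s ^ j))"

text \<open>
  The factor \<open>exp B\<close> keeps the decay of the integrand when its phase is replaced by an
  approximation. Both are Taylor estimates of \<open>exp\<close> along the segment from \<open>y\<close> to
  \<open>x\<close>, on which the real part stays below \<open>B\<close>.
\<close>

lemma norm_exp_diff_le:
  fixes x y :: complex
  assumes "Re x \<le> B" "Re y \<le> B"
  shows "norm (exp x - exp y) \<le> exp B * norm (x - y)"
    and "norm (exp x - exp y - exp y * (x - y)) \<le> exp B * (norm (x - y))\<^sup>2"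
proof -
  have seg: "norm (exp u) \<le> exp B" if "u \<in> closed_segment x y" for u :: complex
  proof -
    have "Re u \<le> B"
    proof -
      have "closed_segment x y \<subseteq> {u. Re u \<le> B}"
        by (rule closed_segment_subset) (use assms in \<open>auto simp: convex_halfspace_Re_le\<close>)
      with that show ?thesis by blast
    qed
    then show ?thesis by simp
  qed
  have der: "(exp has_field_derivative exp u) (at u within closed_segment x y)" for u :: complex
    by (auto intro!: derivative_eq_intros)
  show "norm (exp x - exp y) \<le> exp B * norm (x - y)"
    using complex_Taylor[of "closed_segment x y" 0 "\<lambda>_. exp" "exp B" y x] seg der
    by (simp add: convex_closed_segment)
  show "norm (exp x - exp y - exp y * (x - y)) \<le> exp B * (norm (x - y))\<^sup>2"
    using complex_Taylor[of "closed_segment x y" 1 "\<lambda>_. exp" "exp B" y x] seg der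
    by (simp add: convex_closed_segment power2_eq_square algebra_simps)
qed

lemma negligible_halfline_diff:
  "negligible {x \<in> {0::real<..} - {0..}. P x}" "negligible {x \<in> {0::real..} - {0<..}. P x}"
  by (rule negligible_subset[of "{0}"]; auto)+

lemma set_integrable_exp_power_real:
  fixes \<delta> :: real
  assumes "\<delta> > 0" "m \<ge> 1"
  shows "set_integrable lborel {0..} (\<lambda>s. exp (- \<delta> * s ^ m) * s ^ j)"
proof -
  have "(\<lambda>t. complex_of_real t powr (of_nat (Suc j) - 1) / of_real (exp (\<delta> * t))) absolutely_integrable_on {0<..}"
    by (rule absolutely_integrable_Gamma_integral) (use assms in auto)
  then have "(\<lambda>t. norm (complex_of_real t powr (of_nat (Suc j) - 1) / of_real (exp (\<delta> * t)))) absolutely_integrable_on {0<..}"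
    by (rule set_integrable_norm)
  then have "(\<lambda>s. s ^ j * exp (- \<delta> * s)) absolutely_integrable_on {0<..}"
    by (rule set_integrable_cong[THEN iffD1, rotated -1])
       (auto simp: norm_mult norm_divide powr_realpow exp_minus field_simps norm_powr_real_powr norm_power)
  then have "(\<lambda>s. s ^ j * exp (- \<delta> * s)) absolutely_integrable_on {0..}"
    by (rule absolutely_integrable_spike_set) (rule negligible_halfline_diff)+
  then have *: "set_integrable lborel {0..} (\<lambda>s. exp \<delta> * (s ^ j * exp (- \<delta> * s)))"
    by (intro set_integrable_mult_right)
       (simp add: set_integrable_def integrable_completion borel_measurable_indicator)
  show ?thesis
  proof (rule set_integrable_bound[OF *])
    show "AE s in lborel. s \<in> {0..} \<longrightarrow>
      norm (exp (- \<delta> * s ^ m) * s ^ j) \<le> norm (exp \<delta> * (s ^ j * exp (- \<delta> * s)))"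
    proof (intro AE_I2 impI)
      fix s :: real assume s: "s \<in> {0..}"
      have "s - 1 \<le> s ^ m"
      proof (cases "s \<le> 1")
        case False
        then have "s ^ 1 \<le> s ^ m" using assms by (intro power_increasing) auto
        then show ?thesis by simp
      qed (use s in \<open>smt (verit) zero_le_power atLeast_iff\<close>)
      then have "- \<delta> * s ^ m \<le> \<delta> + - \<delta> * s"
        using mult_left_mono[of "s - 1" "s ^ m" \<delta>] assms by (simp add: algebra_simps)
      then have "exp (- \<delta> * s ^ m) \<le> exp \<delta> * exp (- \<delta> * s)"
        by (simp flip: exp_add)
      from mult_right_mono[OF this, of "s ^ j"] s
      show "norm (exp (- \<delta> * s ^ m) * s ^ j) \<le> norm (exp \<delta> * (s ^ j * exp (- \<delta> * s)))"
        by (simp add: abs_mult mult_ac)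
    qed
  qed (simp add: set_borel_measurable_def)
qed

lemma set_integrable_exp_power:
  assumes "Re c > 0" "m \<ge> 1"
  shows "set_integrable lborel {0..} (\<lambda>s. exp (- c * of_real (s ^ m)) * of_real (s ^ j))"
proof (rule set_integrable_bound[OF set_integrable_exp_power_real[OF assms, of j]])
  show "AE s in lborel. s \<in> {0..} \<longrightarrow>
      norm (exp (- c * of_real (s ^ m)) * of_real (s ^ j)) \<le> norm (exp (- Re c * s ^ m) * s ^ j)"
    by (intro AE_I2 impI) (simp add: norm_mult del: of_real_power)
qed (simp add: set_borel_measurable_def)

text \<open>
  The powers of \<open>n\<close> in all expansions come from this homogeneity, used with
  \<open>t = n\<close>: substitute \<open>q s\<close> for \<open>s\<close> with
  \<open>q = t^(1/m)\<close>.
\<close>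

lemma moment_scale:
  assumes "Re c > 0" "m \<ge> 1" "t > 0"
  shows "moment m (of_real t * c) j = of_real (t powr (- (real (Suc j) / real m))) * moment m c j"
proof -
  define q where "q = t powr (1 / real m)"
  have q: "q > 0" "q ^ m = t" using assms by (auto simp: q_def powr_power)
  have "moment m c j = (\<integral>s. indicator {0..} s *\<^sub>R (exp (- c * of_real (s ^ m)) * of_real (s ^ j)) \<partial>lborel)"
    by (simp add: moment_def set_lebesgue_integral_def)
  also have "\<dots> = q *\<^sub>R (\<integral>s. indicator {0..} (0 + q * s) *\<^sub>R (exp (- c * of_real ((0 + q * s) ^ m)) * of_real ((0 + q * s) ^ j)) \<partial>lborel)"
    using q by (subst lborel_integral_real_affine[where c = q and t = 0]) auto
  also have "\<dots> = q *\<^sub>R (\<integral>s. of_real (q ^ j) * (indicator {0..} s *\<^sub>R (exp (- (of_real t * c) * of_real (s ^ m)) * of_real (s ^ j))) \<partial>lborel)"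
    using q by (intro arg_cong2[where f = scaleR] Bochner_Integration.integral_cong refl)
      (auto simp: indicator_def zero_le_mult_iff power_mult_distrib mult_ac simp flip: q(2))
  also have "\<dots> = of_real (q ^ Suc j) * moment m (of_real t * c) j"
    by (simp add: moment_def set_lebesgue_integral_def scaleR_conv_of_real)
  finally have "moment m (of_real t * c) j = of_real (inverse (q ^ Suc j)) * moment m c j"
    using q by (simp add: field_simps)
  also have "inverse (q ^ Suc j) = t powr (- (real (Suc j) / real m))"
    using assms by (simp add: q_def powr_minus powr_power del: power_Suc)
  finally show ?thesis .
qed

text \<open>
  Substituting \<open>t = s^m\<close> turns the integral into Euler's integral for
  \<open>Gamma (1/m)\<close>.
\<close>

lemma moment_0_real:
  assumes "m \<ge> 1"
  shows "moment m 1 0 = of_real (Gamma (1 + 1 / real m))"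
proof -
  define f :: "real \<Rightarrow> real" where "f = (\<lambda>t. t powr (1 / real m - 1) / exp t)"
  have m: "real m > 0" using assms by simp
  have "f absolutely_integrable_on {0<..} \<and> integral {0<..} f = Gamma (1 / real m)"
  proof
    have "((\<lambda>t. f t) has_integral Gamma (1 / real m)) {0..}"
      unfolding f_def by (rule Gamma_integral_real) (use m in simp)
    then have *: "(f has_integral Gamma (1 / real m)) {0<..}"
      by (subst has_integral_spike_set_eq[where T = "{0..}"]) (rule negligible_halfline_diff)+
    then show "integral {0<..} f = Gamma (1 / real m)" by blast
    show "f absolutely_integrable_on {0<..}"
      by (rule nonnegative_absolutely_integrable_1) (use * in \<open>auto simp: f_def\<close>)
  qed
  moreover have "(\<lambda>s. s ^ m) ` {0<..} = {0::real<..}"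
  proof safe
    fix t :: real assume "0 < t"
    then show "t \<in> (\<lambda>s. s ^ m) ` {0<..}"
      using m by (intro image_eqI[of _ _ "root m t"]) auto
  qed auto
  moreover have "inj_on (\<lambda>s::real. s ^ m) {0<..}"
    using m by (auto intro!: inj_onI simp: power_eq_iff_eq_base)
  moreover have "((\<lambda>s::real. s ^ m) has_field_derivative real m * s ^ (m - 1)) (at s within {0<..})" for s
    by (auto intro!: derivative_eq_intros)
  ultimately have *: "(\<lambda>s. \<bar>real m * s ^ (m - 1)\<bar> * f (s ^ m)) absolutely_integrable_on {0<..} \<and>
     integral {0<..} (\<lambda>s::real. \<bar>real m * s ^ (m - 1)\<bar> * f (s ^ m)) = Gamma (1 / real m)"
    by (subst has_absolute_integral_change_of_variables_1') auto
  have eq: "\<bar>real m * s ^ (m - 1)\<bar> * f (s ^ m) = real m * exp (- (s ^ m))" if "s \<in> {0<..}" for s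
  proof -
    have s: "s > 0" using that by simp
    have "s ^ (m - 1) * (s ^ m) powr (1 / real m - 1) = s powr (real m - 1) * s powr (real m * (1 / real m - 1))"
      using s m by (simp add: powr_powr flip: powr_realpow)
    also have "\<dots> = s powr 0"
      using m by (simp add: algebra_simps flip: powr_add)
    finally have "s ^ (m - 1) * (s ^ m) powr (1 / real m - 1) = 1" using s by simp
    then show ?thesis
      using s by (simp add: f_def exp_minus field_simps abs_mult)
  qed
  have "integral {0<..} (\<lambda>s::real. \<bar>real m * s ^ (m - 1)\<bar> * f (s ^ m)) = integral {0<..} (\<lambda>s::real. real m * exp (- (s ^ m)))"
    by (rule Henstock_Kurzweil_Integration.integral_cong) (rule eq)
  then have "integral {0<..} (\<lambda>s::real. real m * exp (- (s ^ m))) = Gamma (1 / real m)"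
    using * by (simp only:)
  then have "integral {0<..} (\<lambda>s::real. exp (- (s ^ m))) = Gamma (1 / real m) / real m"
    using m by (simp add: field_simps)
  moreover have "integral {0<..} (\<lambda>s::real. exp (- (s ^ m))) = integral {0..} (\<lambda>s::real. exp (- (s ^ m)))"
    by (rule integral_spike_set) (rule negligible_halfline_diff)+
  moreover have "(LINT s:{0::real..}|lborel. exp (- (s ^ m))) = integral {0..} (\<lambda>s::real. exp (- (s ^ m)))"
    using set_borel_integral_eq_integral(2)[OF set_integrable_exp_power_real[of 1 m 0]] assms by simp
  moreover have "moment m 1 0 = of_real (LINT s:{0::real..}|lborel. exp (- (s ^ m)))"
    unfolding moment_def set_integral_complex_of_real[symmetric]
    by (simp flip: exp_of_real of_real_minus of_real_power)
  moreover have "Gamma (1 + 1 / real m) = Gamma (1 / real m) / real m"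
  proof -
    have "1 / real m \<notin> \<int>\<^sub>\<le>\<^sub>0"
      using m nonpos_Ints_nonpos[of "1 / real m"] by (auto simp: divide_le_0_iff)
    from Gamma_plus1[OF this] show ?thesis using m by (simp add: add.commute)
  qed
  ultimately show ?thesis by simp
qed

lemma moment_0_tendsto:
  assumes "Re c > 0" "m \<ge> 1"
  shows "((\<lambda>R. integral {0..R} (\<lambda>s. exp (- c * of_real (s ^ m)))) \<longlongrightarrow> moment m c 0) at_top"
proof -
  define f where "f = (\<lambda>s. exp (- c * of_real (s ^ m)))"
  have f: "integrable lborel (\<lambda>s. indicator {0..} s *\<^sub>R f s)"
    using set_integrable_exp_power[OF assms, of 0] by (simp add: f_def set_integrable_def)
  have "((\<lambda>R. \<integral>s. indicator {..R} s *\<^sub>R (indicator {0..} s *\<^sub>R f s) \<partial>lborel) \<longlongrightarrow> moment m c 0) at_top"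
    using tendsto_integral_at_top[OF _ f] by (simp add: moment_def f_def set_lebesgue_integral_def)
  moreover have "(\<integral>s. indicator {..R} s *\<^sub>R (indicator {0..} s *\<^sub>R f s) \<partial>lborel) = integral {0..R} f" for R
  proof -
    have "set_integrable lborel {0..R} f"
      by (rule borel_integrable_atLeastAtMost') (auto simp: f_def intro!: continuous_intros)
    then have "(LINT s:{0..R}|lborel. f s) = integral {0..R} f"
      by (rule set_borel_integral_eq_integral)
    moreover have "(LINT s:{0..R}|lborel. f s) = (\<integral>s. indicator {..R} s *\<^sub>R (indicator {0..} s *\<^sub>R f s) \<partial>lborel)"
      unfolding set_lebesgue_integral_def
      by (intro Bochner_Integration.integral_cong refl) (auto simp: indicator_def)
    ultimately show ?thesis by simp
  qed
  ultimately show ?thesis by (simp add: f_def)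
qed

text \<open>
  The ray of integration may be rotated. The entire function \<open>exp (- z^m)\<close> has a primitive
  \<open>E\<close>, and between the angles \<open>0\<close> and \<open>\<theta>\<close> the real part of
  \<open>z^m\<close> is at least \<open>cos (m \<theta>) \<bar>z\<bar>^m\<close>. Hence \<open>E\<close>
  has the same limit along both rays.
\<close>

lemma moment_0_cis:
  assumes "m \<ge> 1" "\<bar>real m * \<theta>\<bar> < pi / 2"
  shows "cis \<theta> * moment m (cis \<theta> ^ m) 0 = of_real (Gamma (1 + 1 / real m))"
proof -
  have hol: "(\<lambda>z::complex. exp (- (z ^ m))) holomorphic_on UNIV"
    by (intro holomorphic_intros)
  have "\<exists>E. \<forall>z::complex. (E has_field_derivative exp (- (z ^ m))) (at z)"
  proof (rule holomorphic_convex_primitive'[OF convex_UNIV open_UNIV hol])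
    fix g assume "\<And>z::complex. z \<in> UNIV \<Longrightarrow> (g has_field_derivative exp (- (z ^ m))) (at z within UNIV)"
    then show "\<exists>E. \<forall>z::complex. (E has_field_derivative exp (- (z ^ m))) (at z)" by (intro exI[of _ g]) simp
  qed
  then obtain E where E: "\<And>z::complex. (E has_field_derivative exp (- (z ^ m))) (at z)" by metis
  define \<delta> where "\<delta> = cos (real m * \<theta>)"
  have \<delta>: "\<delta> > 0" unfolding \<delta>_def by (rule cos_gt_zero_pi) (use assms in auto)
  have ray: "integral {0..R} (\<lambda>s. exp (- (cis t ^ m) * of_real (s ^ m))) * cis t = E (of_real R * cis t) - E 0"
    if "R \<ge> 0" for R t
  proof -
    have "((\<lambda>s. exp (- ((of_real s * cis t) ^ m)) * cis t) has_integral
            E (of_real R * cis t) - E (of_real 0 * cis t)) {0..R}"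
    proof (rule fundamental_theorem_of_calculus[OF that])
      fix s assume "s \<in> {0..R}"
      show "((\<lambda>s. E (of_real s * cis t)) has_vector_derivative exp (- ((of_real s * cis t) ^ m)) * cis t) (at s within {0..R})"
        by (rule field_vector_diff_chain_within[OF _ has_field_derivative_at_within[OF E], unfolded o_def, THEN has_vector_derivative_eq_rhs])
          (auto intro!: derivative_eq_intros)
    qed
    then have "((\<lambda>s. exp (- (cis t ^ m) * of_real (s ^ m)) * cis t) has_integral
            E (of_real R * cis t) - E 0) {0..R}"
      by (simp add: power_mult_distrib mult.commute)
    then show ?thesis
      by (metis integral_mult_left integral_unique)
  qed
  have cis': "(cis has_vector_derivative \<i> * cis t) (at t within S)" for t S
    unfolding has_vector_derivative_def
    by (auto intro!: derivative_eq_intros simp: scaleR_conv_of_real mult_ac)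
  \<comment> \<open>the contribution of the arc of radius \<open>R\<close> between the two rays\<close>
  have bound: "norm (E (of_real R * cis \<theta>) - E (of_real R * cis 0)) \<le> R * exp (- \<delta> * R ^ m) * \<bar>\<theta>\<bar>" if "R \<ge> 0" for R
  proof -
    have "norm (E (of_real R * cis \<theta>) - E (of_real R * cis 0)) \<le> R * exp (- \<delta> * R ^ m) * norm (\<theta> - 0)"
    proof (rule differentiable_bound)
      show "convex (closed_segment 0 \<theta>)" by simp
      fix t assume t: "t \<in> closed_segment 0 \<theta>"
      let ?D = "exp (- ((of_real R * cis t) ^ m)) * (of_real R * (\<i> * cis t))"
      have "((\<lambda>t. E (of_real R * cis t)) has_vector_derivative ?D) (at t within closed_segment 0 \<theta>)"
        by (rule field_vector_diff_chain_within[OF _ has_field_derivative_at_within[OF E], unfolded o_def, THEN has_vector_derivative_eq_rhs])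
          (auto intro!: derivative_eq_intros cis')
      then show "((\<lambda>t. E (of_real R * cis t)) has_derivative (\<lambda>h. h *\<^sub>R ?D)) (at t within closed_segment 0 \<theta>)"
        by (simp add: has_vector_derivative_def)
      have "\<bar>t\<bar> \<le> \<bar>\<theta>\<bar>"
        using t by (auto simp: closed_segment_eq_real_ivl split: if_splits)
      then have mt: "\<bar>real m * t\<bar> \<le> \<bar>real m * \<theta>\<bar>" by (simp add: abs_mult mult_left_mono)
      have "cos \<bar>real m * \<theta>\<bar> \<le> cos \<bar>real m * t\<bar>"
        by (rule cos_monotone_0_pi_le) (use mt assms pi_gt_zero in linarith)+
      then have "\<delta> * R ^ m \<le> Re ((of_real R * cis t) ^ m)"
        using that by (simp add: \<delta>_def power_mult_distrib Complex.DeMoivre mult.commute mult_left_mono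
            flip: of_real_power)
      then have "norm ?D \<le> R * exp (- \<delta> * R ^ m)"
        using that by (simp add: norm_mult mult_left_mono mult.commute[of _ R])
      then show "onorm (\<lambda>h. h *\<^sub>R ?D) \<le> R * exp (- \<delta> * R ^ m)"
        by (subst onorm_scaleR_left) (auto simp: onorm_id)
    qed auto
    then show ?thesis by simp
  qed
  have "((\<lambda>R. R * exp (- \<delta> * R ^ m) * \<bar>\<theta>\<bar>) \<longlongrightarrow> 0) at_top"
  proof (rule tendsto_sandwich[where f = "\<lambda>_. 0" and h = "\<lambda>R. R * exp (- \<delta> * R) * \<bar>\<theta>\<bar>"])
    show "((\<lambda>R. R * exp (- \<delta> * R) * \<bar>\<theta>\<bar>) \<longlongrightarrow> 0) at_top"
      using \<delta> by real_asymp
    show "\<forall>\<^sub>F R in at_top. 0 \<le> R * exp (- \<delta> * R ^ m) * \<bar>\<theta>\<bar>"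
      using eventually_ge_at_top[of 0] by eventually_elim auto
    show "\<forall>\<^sub>F R in at_top. R * exp (- \<delta> * R ^ m) * \<bar>\<theta>\<bar> \<le> R * exp (- \<delta> * R) * \<bar>\<theta>\<bar>"
      using eventually_ge_at_top[of 1]
    proof eventually_elim
      case (elim R)
      then have "R ^ 1 \<le> R ^ m" using assms by (intro power_increasing) auto
      then show ?case using elim \<delta> by (intro mult_right_mono mult_left_mono) auto
    qed
  qed auto
  moreover have "\<forall>\<^sub>F R in at_top. norm (E (of_real R * cis \<theta>) - E (of_real R * cis 0)) \<le> R * exp (- \<delta> * R ^ m) * \<bar>\<theta>\<bar>"
    using eventually_ge_at_top[of 0] by eventually_elim (use bound in auto)
  ultimately have 1: "((\<lambda>R. E (of_real R * cis \<theta>) - E (of_real R * cis 0)) \<longlongrightarrow> 0) at_top"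
    by (rule Lim_null_comparison[rotated])
  have lim: "((\<lambda>R. E (of_real R * cis t) - E 0) \<longlongrightarrow> moment m (cis t ^ m) 0 * cis t) at_top"
    if "cos (real m * t) > 0" for t
  proof (rule Lim_transform_eventually)
    show "((\<lambda>R. integral {0..R} (\<lambda>s. exp (- (cis t ^ m) * of_real (s ^ m))) * cis t) \<longlongrightarrow> moment m (cis t ^ m) 0 * cis t) at_top"
      by (intro tendsto_intros moment_0_tendsto) (use that assms in \<open>auto simp: Complex.DeMoivre\<close>)
    show "\<forall>\<^sub>F R in at_top. integral {0..R} (\<lambda>s. exp (- (cis t ^ m) * of_real (s ^ m))) * cis t = E (of_real R * cis t) - E 0"
      using eventually_ge_at_top[of 0] by eventually_elim (rule ray)
  qed
  have "((\<lambda>R. (E (of_real R * cis \<theta>) - E 0) - (E (of_real R * cis 0) - E 0)) \<longlongrightarrow>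
       moment m (cis \<theta> ^ m) 0 * cis \<theta> - moment m (cis 0 ^ m) 0 * cis 0) at_top"
    by (intro tendsto_diff lim) (use \<delta> in \<open>auto simp: \<delta>_def\<close>)
  then have "((\<lambda>R. E (of_real R * cis \<theta>) - E (of_real R * cis 0)) \<longlongrightarrow>
       moment m (cis \<theta> ^ m) 0 * cis \<theta> - moment m (cis 0 ^ m) 0 * cis 0) at_top"
    by simp
  from tendsto_unique[OF _ this 1] show ?thesis
    using moment_0_real[OF assms(1)] by (simp add: mult.commute)
qed

text \<open>
  The only moment whose value enters the leading terms. Up to the Gamma factor it is the reciprocal of the
  \<open>m\<close>-th root of \<open>c\<close> that lies closest to the positive axis.
\<close>

lemma moment_0_eq:
  assumes "m \<ge> 1" "\<bar>real m * \<theta>\<bar> < pi / 2" "r > 0"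
  shows "moment m ((of_real r * cis \<theta>) ^ m) 0 = of_real (Gamma (1 + 1 / real m)) / (of_real r * cis \<theta>)"
proof -
  have "Re (cis \<theta> ^ m) > 0"
    unfolding Complex.DeMoivre using assms by (auto intro!: cos_gt_zero_pi)
  then have "moment m (of_real (r ^ m) * cis \<theta> ^ m) 0
      = of_real ((r ^ m) powr (- (real (Suc 0) / real m))) * moment m (cis \<theta> ^ m) 0"
    by (intro moment_scale) (use assms in auto)
  also have "(r ^ m) powr (- (real (Suc 0) / real m)) = inverse r"
    using assms by (simp add: powr_powr powr_minus flip: powr_realpow)
  also have "moment m (cis \<theta> ^ m) 0 = of_real (Gamma (1 + 1 / real m)) / cis \<theta>"
    using moment_0_cis[OF assms(1,2)] by (simp add: field_simps)
  finally show ?thesis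
    by (simp add: power_mult_distrib field_simps)
qed

text \<open>
  Laplace's method to second order along one ray. Replacing the phase by its leading term and expanding the
  remaining factor to first order gives the model integrand \<open>R\<close>, which is integrated over the
  whole half line. The difference between the true integrand (extended by \<open>0\<close>) and
  \<open>R\<close> is bounded pointwise by \<open>exp (- n \<delta> s^m)\<close> times
  \<open>A s^2 + n B s^(m+2) + n^2 D s^(2m+2)\<close>; by homogeneity each of the three terms
  integrates to a multiple of \<open>n^(-3/m)\<close>. Beyond \<open>s = b\<close>, where only
  \<open>R\<close> is left, \<open>1\<close> and \<open>s\<close> are dominated by multiples of
  \<open>s^2\<close>, so that the cutoff costs nothing extra.
\<close>

lemma laplace_ray:
  fixes P G :: "real \<Rightarrow> complex"
  assumes m: "m \<ge> 1" and b: "b > 0" and \<delta>: "\<delta> > 0" "\<delta> \<le> Re c"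
    and contP: "continuous_on {0..b} P" and contG: "continuous_on {0..b} G"
    and P: "\<And>s. s \<in> {0..b} \<Longrightarrow> norm (P s + c * of_real (s ^ m) - d * of_real (s ^ (m + 1))) \<le> M * s ^ (m + 2)"
    and G: "\<And>s. s \<in> {0..b} \<Longrightarrow> norm (G s - g0 - g1 * of_real s) \<le> M * s ^ 2"
    and Re_P: "\<And>s. s \<in> {0..b} \<Longrightarrow> Re (P s) \<le> - \<delta> * s ^ m"
  shows "\<exists>C. \<forall>n\<ge>(1::nat). norm (integral {0..b} (\<lambda>s. exp (of_nat n * P s) * G s)
           - (g0 * moment m c 0 * of_real (real n powr (- (1 / real m)))
              + (g1 * moment m c 1 + g0 * d * moment m c (m + 1)) * of_real (real n powr (- (2 / real m)))))
         \<le> C * real n powr (- (3 / real m))"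
proof -
  have M: "M \<ge> 0"
    using G[of b] b norm_ge_zero[of "G b - g0 - g1 * of_real b"]
    by (smt (verit) atLeastAtMost_iff mult_less_0_iff zero_less_power)
  \<comment> \<open>\<open>M1\<close> bounds the phase error \<open>P s + c s^m\<close> relative to \<open>s^(m+1)\<close>. The summands of \<open>A\<close> and \<open>B\<close>
    with a denominator \<open>b\<close> are those needed for \<open>s > b\<close>.\<close>
  define M1 where "M1 = norm d + M * b"
  have M1: "M1 \<ge> 0" using M b by (simp add: M1_def)
  define A where "A = M + norm g0 / b ^ 2 + norm g1 / b"
  define B where "B = norm g1 * M1 + norm g0 * M + norm g0 * norm d / b"
  define D where "D = norm g0 * M1\<^sup>2"
  have ABD: "A \<ge> 0" "B \<ge> 0" "D \<ge> 0" using M M1 b by (auto simp: A_def B_def D_def)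
  define Q where "Q = (\<lambda>n s. exp (of_nat n * P s) * G s)"
  define R where "R = (\<lambda>n s. exp (- (of_nat n * c) * of_real (s ^ m)) * (g0 + g1 * of_real s + of_nat n * g0 * d * of_real (s ^ (m + 1))))"
  have pointwise: "norm ((if s \<in> {0..b} then Q n s else 0) - R n s)
      \<le> exp (- (real n * \<delta>) * s ^ m) * (A * s ^ 2 + real n * B * s ^ (m + 2) + (real n)\<^sup>2 * D * s ^ (2 * m + 2))"
    if s: "s \<ge> 0" and n: "n \<ge> 1" for s n
  proof (cases "s \<le> b")
    case True
    then have sb: "s \<in> {0..b}" using s by simp
    define x where "x = of_nat n * P s"
    define y where "y = - (of_nat n * c) * of_real (s ^ m)"
    define W where "W = exp (- (real n * \<delta>) * s ^ m)"
    have W: "W > 0" by (simp add: W_def)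
    have Rex: "Re x \<le> - (real n * \<delta>) * s ^ m"
      using mult_left_mono[OF Re_P[OF sb], of "real n"] by (simp add: x_def)
    have Rey: "Re y \<le> - (real n * \<delta>) * s ^ m"
    proof -
      have "\<delta> * (real n * s ^ m) \<le> Re c * (real n * s ^ m)"
        by (rule mult_right_mono) (use s \<delta> in auto)
      then show ?thesis by (simp add: y_def mult_ac flip: of_real_power)
    qed
    have xy: "norm (x - y - of_nat n * d * of_real (s ^ (m + 1))) \<le> real n * M * s ^ (m + 2)"
    proof -
      have "x - y - of_nat n * d * of_real (s ^ (m + 1)) = of_nat n * (P s + c * of_real (s ^ m) - d * of_real (s ^ (m + 1)))"
        by (simp add: x_def y_def algebra_simps)
      then show ?thesis using mult_left_mono[OF P[OF sb], of "real n"] by (simp add: norm_mult mult.assoc)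
    qed
    have nxy: "norm (x - y) \<le> real n * M1 * s ^ (m + 1)"
    proof -
      have "norm (x - y) \<le> norm (of_nat n * d * of_real (s ^ (m + 1))) + real n * M * s ^ (m + 2)"
        using xy norm_triangle_sub[of "x - y" "of_nat n * d * of_real (s ^ (m + 1))"] by simp
      also have "norm (of_nat n * d * of_real (s ^ (m + 1))) = real n * norm d * s ^ (m + 1)"
        using s by (simp add: norm_mult norm_power)
      also have "real n * M * s ^ (m + 2) \<le> real n * M * b * s ^ (m + 1)"
        using True s M by (simp add: mult_left_mono mult_right_mono mult_ac)
      finally show ?thesis by (simp add: M1_def algebra_simps)
    qed
    note e = norm_exp_diff_le[OF Rex Rey, folded W_def]
    \<comment> \<open>four errors: expansion of \<open>G\<close>, variation of \<open>exp\<close> against the linear term of \<open>G\<close>,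
      quadratic remainder of \<open>exp\<close>, and remainder of the phase\<close>
    have "exp x * G s - exp y * (g0 + g1 * of_real s + of_nat n * g0 * d * of_real (s ^ (m + 1)))
        = exp x * (G s - g0 - g1 * of_real s) + g1 * of_real s * (exp x - exp y)
          + g0 * (exp x - exp y - exp y * (x - y)) + g0 * exp y * (x - y - of_nat n * d * of_real (s ^ (m + 1)))"
      by (simp add: algebra_simps)
    also have "norm \<dots> \<le> W * (M * s ^ 2) + norm g1 * s * (W * (real n * M1 * s ^ (m + 1)))
          + norm g0 * (W * (real n * M1 * s ^ (m + 1))\<^sup>2) + norm g0 * W * (real n * M * s ^ (m + 2))"
    proof (intro norm_triangle_mono)
      show "norm (exp x * (G s - g0 - g1 * of_real s)) \<le> W * (M * s ^ 2)"
        unfolding norm_mult using G[OF sb] Rex W by (intro mult_mono) (auto simp: W_def)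
      show "norm (g1 * of_real s * (exp x - exp y)) \<le> norm g1 * s * (W * (real n * M1 * s ^ (m + 1)))"
      proof -
        have "norm (exp x - exp y) \<le> W * (real n * M1 * s ^ (m + 1))"
          using e(1) mult_left_mono[OF nxy, of W] W by linarith
        then show ?thesis
          unfolding norm_mult using s by (intro mult_mono) auto
      qed
      show "norm (g0 * (exp x - exp y - exp y * (x - y))) \<le> norm g0 * (W * (real n * M1 * s ^ (m + 1))\<^sup>2)"
      proof -
        have "W * (norm (x - y))\<^sup>2 \<le> W * (real n * M1 * s ^ (m + 1))\<^sup>2"
          using W nxy by (simp add: power_mono)
        then have "norm (exp x - exp y - exp y * (x - y)) \<le> W * (real n * M1 * s ^ (m + 1))\<^sup>2"
          using e(2) by linarith
        then show ?thesis
          unfolding norm_mult by (intro mult_left_mono) auto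
      qed
      show "norm (g0 * exp y * (x - y - of_nat n * d * of_real (s ^ (m + 1)))) \<le> norm g0 * W * (real n * M * s ^ (m + 2))"
        unfolding norm_mult using Rey W xy by (intro mult_mono) (auto simp: W_def)
    qed
    also have "\<dots> = W * (M * s ^ 2 + real n * (norm g1 * M1 + norm g0 * M) * s ^ (m + 2) + (real n)\<^sup>2 * D * s ^ (2 * m + 2))"
      by (simp add: D_def power_mult_distrib algebra_simps power2_eq_square power_add mult_2_right)
    also have "\<dots> \<le> W * (A * s ^ 2 + real n * B * s ^ (m + 2) + (real n)\<^sup>2 * D * s ^ (2 * m + 2))"
      using W s b by (intro mult_left_mono add_mono mult_right_mono) (auto simp: A_def B_def)
    finally show ?thesis using sb by (simp add: Q_def R_def x_def y_def W_def)
  next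
    case False
    then have sb: "s > b" by simp
    have "norm (R n s) \<le> exp (- (real n * \<delta>) * s ^ m) * (norm g0 + norm g1 * s + real n * norm g0 * norm d * s ^ (m + 1))"
      unfolding R_def norm_mult
    proof (rule mult_mono)
      have "\<delta> * (real n * s ^ m) \<le> Re c * (real n * s ^ m)"
        by (rule mult_right_mono) (use s \<delta> in auto)
      then show "norm (exp (- (of_nat n * c) * of_real (s ^ m))) \<le> exp (- (real n * \<delta>) * s ^ m)"
        by (simp add: mult_ac flip: of_real_power)
      show "norm (g0 + g1 * of_real s + of_nat n * g0 * d * of_real (s ^ (m + 1))) \<le> norm g0 + norm g1 * s + real n * norm g0 * norm d * s ^ (m + 1)"
        by (intro norm_triangle_mono) (use s in \<open>auto simp: norm_mult norm_power\<close>)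
    qed auto
    also have "\<dots> \<le> exp (- (real n * \<delta>) * s ^ m) * (A * s ^ 2 + real n * B * s ^ (m + 2) + (real n)\<^sup>2 * D * s ^ (2 * m + 2))"
    proof (intro mult_left_mono)
      have 1: "norm g0 \<le> norm g0 / b ^ 2 * s ^ 2"
      proof -
        have "norm g0 * b ^ 2 \<le> norm g0 * s ^ 2"
          by (intro mult_left_mono power_mono) (use sb b in auto)
        then show ?thesis using b by (simp add: pos_le_divide_eq)
      qed
      have 2: "norm g1 * s \<le> norm g1 / b * s ^ 2"
      proof -
        have "norm g1 * s * b \<le> norm g1 * s * s"
          by (intro mult_left_mono) (use sb b in auto)
        then show ?thesis using b by (simp add: pos_le_divide_eq power2_eq_square mult_ac)
      qed
      have "b * s ^ (m + 1) \<le> s * s ^ (m + 1)"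
        by (rule mult_right_mono) (use sb b in auto)
      then have "s ^ (m + 1) \<le> s ^ (m + 2) / b"
        using b by (simp add: field_simps)
      from mult_left_mono[OF this, of "real n * norm g0 * norm d"]
      have 3: "real n * norm g0 * norm d * s ^ (m + 1) \<le> real n * (norm g0 * norm d / b) * s ^ (m + 2)"
        by simp
      have 4: "(norm g0 / b ^ 2 + norm g1 / b) * s ^ 2 \<le> A * s ^ 2"
        using M by (intro mult_right_mono) (auto simp: A_def)
      have 5: "real n * (norm g0 * norm d / b) * s ^ (m + 2) \<le> real n * B * s ^ (m + 2)"
        using M M1 s by (intro mult_right_mono mult_left_mono) (auto simp: B_def)
      have 6: "0 \<le> (real n)\<^sup>2 * D * s ^ (2 * m + 2)" using s ABD by simp
      show "norm g0 + norm g1 * s + real n * norm g0 * norm d * s ^ (m + 1) \<le> A * s ^ 2 + real n * B * s ^ (m + 2) + (real n)\<^sup>2 * D * s ^ (2 * m + 2)"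
        using 1 2 3 4 5 6 by (simp add: algebra_simps)
    qed auto
    finally show ?thesis using sb by simp
  qed
  define I where "I = (\<lambda>j. (LINT s:{0..}|lborel. exp (- \<delta> * s ^ m) * s ^ j))"
  have Rec: "Re c > 0" using \<delta> by simp
  have real_scale: "(LINT s:{0..}|lborel. exp (- (real n * \<delta>) * s ^ m) * s ^ j) = real n powr (- (real (Suc j) / real m)) * I j"
    if "n \<ge> 1" for n j
  proof -
    have *: "moment m (of_real e) j = of_real (LINT s:{0..}|lborel. exp (- e * s ^ m) * s ^ j)" for e
      unfolding moment_def set_integral_complex_of_real[symmetric]
      by (simp flip: exp_of_real)
    have "moment m (of_real (real n) * of_real \<delta>) j = of_real (real n powr (- (real (Suc j) / real m))) * moment m (of_real \<delta>) j"
      by (rule moment_scale) (use \<delta> m that in auto)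
    then show ?thesis
      unfolding of_real_mult[symmetric] * of_real_eq_iff I_def .
  qed
  have main: "norm (integral {0..b} (Q n) - (g0 * moment m c 0 * of_real (real n powr (- (1 / real m)))
              + (g1 * moment m c 1 + g0 * d * moment m c (m + 1)) * of_real (real n powr (- (2 / real m)))))
         \<le> (A * I 2 + B * I (m + 2) + D * I (2 * m + 2)) * real n powr (- (3 / real m))" if n: "n \<ge> 1" for n
  proof -
    let ?q = "\<lambda>s. if s \<in> {0..b} then Q n s else 0"
    have nc: "Re (of_nat n * c) > 0" using Rec n by simp
    have Qint: "set_integrable lborel {0..b} (Q n)"
      unfolding Q_def
      by (intro borel_integrable_atLeastAtMost' continuous_intros contP contG)
    have qeq: "indicator {0..} s *\<^sub>R ?q s = indicator {0..b} s *\<^sub>R Q n s" for s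
      by (auto simp: indicator_def)
    have qint: "set_integrable lborel {0..} ?q"
      using Qint unfolding set_integrable_def qeq .
    have qval: "(LINT s:{0..}|lborel. ?q s) = integral {0..b} (Q n)"
      using set_borel_integral_eq_integral(2)[OF Qint]
      unfolding set_lebesgue_integral_def qeq by simp
    note mi = set_integrable_exp_power[OF nc m]
    have Req: "R n = (\<lambda>s. g0 * (exp (- (of_nat n * c) * of_real (s ^ m)) * of_real (s ^ 0)) +
        g1 * (exp (- (of_nat n * c) * of_real (s ^ m)) * of_real (s ^ 1)) +
        (of_nat n * g0 * d) * (exp (- (of_nat n * c) * of_real (s ^ m)) * of_real (s ^ (m + 1))))"
      by (simp add: R_def fun_eq_iff algebra_simps)
    have Rint: "set_integrable lborel {0..} (R n)"
      unfolding Req by (intro set_integral_add(1) set_integrable_mult_right mi)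
    have "(LINT s:{0..}|lborel. R n s) = g0 * moment m (of_nat n * c) 0 + g1 * moment m (of_nat n * c) 1
        + of_nat n * g0 * d * moment m (of_nat n * c) (m + 1)"
      unfolding Req moment_def
      by (simp only: set_integral_add(2) set_integral_add(1) set_integrable_mult_right set_integral_mult_right mi)
    also have "\<dots> = g0 * moment m c 0 * of_real (real n powr (- (1 / real m)))
              + (g1 * moment m c 1 + g0 * d * moment m c (m + 1)) * of_real (real n powr (- (2 / real m)))"
    proof -
      \<comment> \<open>the factor \<open>n\<close> in front of the phase term of degree \<open>m + 1\<close> raises this moment
        from order \<open>n^(-(m+2)/m)\<close> to order \<open>n^(-2/m)\<close>\<close>
      have "of_nat n * moment m (of_nat n * c) (m + 1) = of_real (real n powr (- (2 / real m))) * moment m c (m + 1)"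
      proof -
        have "real n * real n powr (- (real (Suc (m + 1)) / real m)) = real n powr 1 * real n powr (- (real (Suc (m + 1)) / real m))"
          using n by simp
        also have "\<dots> = real n powr (- (2 / real m))"
          unfolding powr_add[symmetric] using m by (simp add: field_simps)
        finally have e: "real n * real n powr (- (real (Suc (m + 1)) / real m)) = real n powr (- (2 / real m))" .
        have "of_real (real n) * moment m (of_real (real n) * c) (m + 1) = of_real (real n powr (- (2 / real m))) * moment m c (m + 1)"
          unfolding e[symmetric] of_real_mult using n by (subst moment_scale[OF Rec m]) auto
        then show ?thesis by simp
      qed
      moreover have "moment m (of_nat n * c) 0 = of_real (real n powr (- (1 / real m))) * moment m c 0"
        "moment m (of_nat n * c) 1 = of_real (real n powr (- (2 / real m))) * moment m c 1"
        using moment_scale[OF Rec m, of "real n" 0] moment_scale[OF Rec m, of "real n" 1] n by simp_all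
      ultimately show ?thesis by (simp add: algebra_simps)
    qed
    finally have Rval: "(LINT s:{0..}|lborel. R n s) = \<dots>" .
    note ri = set_integrable_exp_power_real[of "real n * \<delta>" m]
    let ?r = "\<lambda>j s. exp (- (real n * \<delta>) * s ^ m) * s ^ j"
    have "norm ((LINT s:{0..}|lborel. ?q s) - (LINT s:{0..}|lborel. R n s)) = norm (LINT s:{0..}|lborel. ?q s - R n s)"
      by (simp only: set_integral_diff(2)[OF qint Rint])
    also have "\<dots> \<le> (LINT s:{0..}|lborel. norm (?q s - R n s))"
      by (rule set_integral_norm_bound) (intro set_integral_diff(1) qint Rint)
    also have "\<dots> \<le> (LINT s:{0..}|lborel. A * ?r 2 s + real n * B * ?r (m + 2) s + (real n)\<^sup>2 * D * ?r (2 * m + 2) s)"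
    proof (rule set_integral_mono)
      show "set_integrable lborel {0..} (\<lambda>s. norm (?q s - R n s))"
        by (intro set_integrable_norm set_integral_diff(1) qint Rint)
      show "set_integrable lborel {0..} (\<lambda>s. A * ?r 2 s + real n * B * ?r (m + 2) s + (real n)\<^sup>2 * D * ?r (2 * m + 2) s)"
        by (intro set_integral_add(1) set_integrable_mult_right ri) (use n \<delta> m in auto)
      fix s :: real assume "s \<in> {0..}"
      then show "norm (?q s - R n s) \<le> A * ?r 2 s + real n * B * ?r (m + 2) s + (real n)\<^sup>2 * D * ?r (2 * m + 2) s"
        using pointwise[of s n] n by (simp add: algebra_simps)
    qed
    also have "\<dots> = A * (LINT s:{0..}|lborel. ?r 2 s) + real n * B * (LINT s:{0..}|lborel. ?r (m + 2) s)
        + (real n)\<^sup>2 * D * (LINT s:{0..}|lborel. ?r (2 * m + 2) s)"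
      using n \<delta> m by (simp only: set_integral_add(2) set_integral_add(1) set_integrable_mult_right set_integral_mult_right ri
          mult_pos_pos of_nat_0_less_iff zero_less_one[THEN less_le_trans])
    also have "\<dots> = (A * I 2 + B * I (m + 2) + D * I (2 * m + 2)) * real n powr (- (3 / real m))"
    proof -
      have "real n * real n powr (- (real (Suc (m + 2)) / real m)) = real n powr 1 * real n powr (- (real (Suc (m + 2)) / real m))"
        using n by simp
      also have "\<dots> = real n powr (- (3 / real m))"
        unfolding powr_add[symmetric] using m by (simp add: field_simps)
      finally have 1: "real n * real n powr (- (real (Suc (m + 2)) / real m)) = real n powr (- (3 / real m))" .
      have "(real n)\<^sup>2 * real n powr (- (real (Suc (2 * m + 2)) / real m)) = real n powr 2 * real n powr (- (real (Suc (2 * m + 2)) / real m))"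
        using n by simp
      also have "\<dots> = real n powr (- (3 / real m))"
        unfolding powr_add[symmetric] using m by (simp add: field_simps)
      finally have 2: "(real n)\<^sup>2 * real n powr (- (real (Suc (2 * m + 2)) / real m)) = real n powr (- (3 / real m))" .
      have "A * (LINT s:{0..}|lborel. ?r 2 s) + real n * B * (LINT s:{0..}|lborel. ?r (m + 2) s)
          + (real n)\<^sup>2 * D * (LINT s:{0..}|lborel. ?r (2 * m + 2) s)
        = A * I 2 * real n powr (- (3 / real m)) + B * I (m + 2) * (real n * real n powr (- (real (Suc (m + 2)) / real m)))
          + D * I (2 * m + 2) * ((real n)\<^sup>2 * real n powr (- (real (Suc (2 * m + 2)) / real m)))"
        unfolding real_scale[OF n] by (simp add: numeral_3_eq_3)
      then show ?thesis unfolding 1 2 by (simp only: distrib_right)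
    qed
    finally show ?thesis unfolding qval Rval .
  qed
  show ?thesis by (rule exI, intro allI impI, rule main[unfolded Q_def])
qed

section \<open>Taylor coefficients by half a circle\<close>

definition half_disc :: "complex set" where
  "half_disc = cball 0 1 \<inter> {z. 0 \<le> Im z}"

lemma convex_half_disc: "convex half_disc"
  unfolding half_disc_def by (intro convex_Int convex_cball) (simp add: convex_halfspace_Im_ge)

lemma interior_half_disc: "interior half_disc \<subseteq> {z. norm z < 1 \<and> 0 < Im z}"
proof -
  have "{z. 0 \<le> Im z} = {z. \<i> \<bullet> z \<ge> 0}" by (simp add: inner_complex_def)
  moreover have "interior {z. \<i> \<bullet> z \<ge> 0} = {z. \<i> \<bullet> z > 0}" by (rule interior_halfspace_ge) simp
  ultimately show ?thesis by (auto simp: half_disc_def inner_complex_def)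
qed

text \<open>
  Cauchy's coefficient formula for a function with a branch cut along the negative axis. The usual circle
  would cross the cut, but \<open>g\<close> is real on \<open>[0,1]\<close>, so by reflection only the upper
  half is needed: the imaginary parts of integrals over the boundary of the half disc carry all the
  information, and the cut contributes the jump \<open>Im g\<close> on \<open>[-1,0]\<close>. The pole at
  \<open>l\<close> lies on the boundary of the half disc; subtracting the Taylor polynomial \<open>T\<close>
  of degree \<open>n\<close> removes it. The quotient \<open>q\<close> obeys Cauchy's theorem on the half
  disc, and \<open>T / (z - l)^(n+1)\<close> has an explicit primitive \<open>V\<close> whose logarithm
  yields \<open>pi\<close> times the coefficient.
\<close>

lemma half_disc_coefficient:
  fixes g :: "complex \<Rightarrow> complex" and l :: real and n :: nat
  assumes l: "0 < l" "l < 1"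
    and cont: "continuous_on half_disc g"
    and diff: "\<And>z. z \<in> interior half_disc \<Longrightarrow> g field_differentiable at z"
    and fps: "(\<lambda>x. g (of_real l + x)) has_fps_expansion C"
    and C_real: "\<And>k. fps_nth C k \<in> \<real>"
    and g_real: "\<And>x. x \<in> {0..1} \<Longrightarrow> g (of_real x) \<in> \<real>"
  shows "(\<lambda>t. g (cis t) / (cis t - of_real l) ^ (n + 1) * cis t) integrable_on {0..pi}" (is ?int)
    and "Re (integral {0..pi} (\<lambda>t. g (cis t) / (cis t - of_real l) ^ (n + 1) * cis t))
          + integral {-1..0} (\<lambda>x. Im (g (of_real x)) / (x - l) ^ (n + 1)) = pi * Re (fps_nth C n)" (is ?eq)
proof -
  define T :: "complex \<Rightarrow> complex" where "T = (\<lambda>z::complex. \<Sum>k\<le>n. fps_nth C k * (z - of_real l) ^ k)"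
  \<comment> \<open>the value at \<open>l\<close> is the one that makes \<open>q\<close> continuous\<close>
  define q :: "complex \<Rightarrow> complex" where "q = (\<lambda>z::complex. if z = of_real l then fps_nth C (n + 1) else (g z - T z) / (z - of_real l) ^ (n + 1))"
  have T_real: "T (of_real x) \<in> \<real>" for x
    unfolding T_def using C_real by (intro sum_in_Reals Reals_mult Reals_power) auto
  have T_diff: "T field_differentiable at z" for z
    unfolding T_def by (intro derivative_intros)
  have q_diff: "q field_differentiable at z" if "g field_differentiable at z" "z \<noteq> of_real l" for z
  proof -
    have "(\<lambda>z. (g z - T z) / (z - of_real l) ^ (n + 1)) field_differentiable at z"
      using that by (intro derivative_intros T_diff) auto
    then obtain D where "((\<lambda>z. (g z - T z) / (z - of_real l) ^ (n + 1)) has_field_derivative D) (at z)"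
      by (auto simp: field_differentiable_def)
    then have "(q has_field_derivative D) (at z)"
      by (rule has_field_derivative_transform_within_open[where S = "- {complex_of_real l}"])
         (use that in \<open>auto simp: q_def\<close>)
    then show ?thesis by (auto simp: field_differentiable_def)
  qed
  have q_l: "isCont q (of_real l)"
  proof -
    define D where "D = C - (\<Sum>k\<le>n. fps_const (fps_nth C k) * fps_X ^ k)"
    have D: "(\<lambda>x. g (of_real l + x) - T (of_real l + x)) has_fps_expansion D"
    proof -
      have "(\<lambda>x. g (of_real l + x) - (\<Sum>k\<le>n. fps_nth C k * x ^ k)) has_fps_expansion D"
        unfolding D_def by (intro fps_expansion_intros fps)
      then show ?thesis by (simp add: T_def)
    qed
    have D_nth: "fps_nth D k = (if k \<le> n then 0 else fps_nth C k)" for k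
      by (simp add: D_def fps_sum_nth fps_X_power_nth if_distrib[of "\<lambda>x. _ * x"] sum.delta' cong: if_cong)
    have "(\<lambda>h. q (of_real l + h)) \<midarrow>0\<rightarrow> q (of_real l)"
    proof (cases "D = 0")
      case True
      then have "fps_nth C (n + 1) = 0" using D_nth[of "n + 1"] by simp
      moreover have "\<forall>\<^sub>F x in nhds 0. g (of_real l + x) - T (of_real l + x) = 0"
        using D True by (simp add: has_fps_expansion_0_iff)
      ultimately have "\<forall>\<^sub>F x in at 0. q (of_real l + x) = 0"
        by (auto simp: q_def eventually_at_filter elim!: eventually_mono)
      then show ?thesis
        using \<open>fps_nth C (n + 1) = 0\<close> by (simp add: q_def tendsto_eventually)
    next
      case False
      have "(\<lambda>x. if x = 0 then fps_nth C (n + 1) else (g (of_real l + x) - T (of_real l + x)) / x ^ (n + 1)) has_fps_expansion fps_shift (n + 1) D"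
        by (intro has_fps_expansion_shift D) (use False D_nth in \<open>auto intro!: subdegree_geI\<close>)
      then have "isCont (\<lambda>x. if x = 0 then fps_nth C (n + 1) else (g (of_real l + x) - T (of_real l + x)) / x ^ (n + 1)) 0"
        by (rule has_fps_expansion_imp_continuous)
      then show ?thesis
        by (simp add: isCont_def q_def cong: if_cong)
    qed
    then show ?thesis by (simp add: isCont_iff)
  qed
  have q_cont: "continuous_on half_disc q"
  proof -
    have "continuous (at z within half_disc) q" if z: "z \<in> half_disc" for z
    proof (cases "z = of_real l")
      case True
      then show ?thesis using q_l continuous_at_imp_continuous_within by blast
    next
      case False
      have "continuous (at z within half_disc) (\<lambda>z::complex. (g z - T z) / (z - of_real l) ^ (n + 1))"
      proof -
        have "continuous (at z within half_disc) g"
          using cont z by (simp add: continuous_on_eq_continuous_within)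
        moreover have "continuous (at z within half_disc) T"
          unfolding T_def by (intro continuous_intros)
        ultimately show ?thesis
          using False by (intro continuous_intros) auto
      qed
      then have "((\<lambda>w. (g w - T w) / (w - of_real l) ^ (n + 1)) \<longlongrightarrow> q z) (at z within half_disc)"
        using False by (simp add: continuous_within q_def)
      moreover have "\<forall>\<^sub>F w in at z within half_disc. (g w - T w) / (w - of_real l) ^ (n + 1) = q w"
      proof -
        have "\<forall>\<^sub>F w in nhds z. w \<in> - {complex_of_real l}"
          by (rule eventually_nhds_in_open) (use False in auto)
        then have "\<forall>\<^sub>F w in at z within half_disc. w \<in> - {complex_of_real l}"
          by (auto simp: eventually_at_filter elim: eventually_mono)
        then show ?thesis by eventually_elim (simp add: q_def)
      qed
      ultimately show ?thesis
        unfolding continuous_within by (rule Lim_transform_eventually)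
    qed
    then show ?thesis by (simp add: continuous_on_eq_continuous_within)
  qed
  let ?arc = "part_circlepath 0 1 0 pi" and ?seg = "linepath (-1) (1::complex)"
  have arc_image: "path_image ?arc \<subseteq> half_disc - {of_real l}"
  proof
    fix z assume "z \<in> path_image ?arc"
    then obtain t where t: "0 \<le> t" "t \<le> pi" "z = cis t"
      by (auto simp: path_image_part_circlepath' closed_segment_eq_real_ivl)
    have "norm z \<noteq> norm (complex_of_real l)" using l by (simp add: t(3))
    then have "z \<noteq> of_real l" by metis
    moreover have "z \<in> half_disc"
      using t sin_ge_zero[of t] by (simp add: half_disc_def)
    ultimately show "z \<in> half_disc - {of_real l}" by simp
  qed
  have seg_image: "path_image ?seg \<subseteq> half_disc"
    by (simp add: closed_segment_subset convex_half_disc half_disc_def)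
       (rule closed_segment_subset, auto simp: convex_half_disc half_disc_def convex_halfspace_Im_ge intro!: convex_Int)
  have "(q has_contour_integral 0) (?arc +++ ?seg)"
  proof (rule Cauchy_theorem_convex[OF q_cont convex_half_disc])
    show "finite {}" by simp
    show "q field_differentiable at z" if "z \<in> interior half_disc - {}" for z
      using that interior_half_disc by (intro q_diff diff) auto
    show "path_image (?arc +++ ?seg) \<subseteq> half_disc"
      using arc_image seg_image by (subst path_image_join) auto
  qed auto
  then obtain I1 I2 where I: "(q has_contour_integral I1) ?arc" "(q has_contour_integral I2) ?seg" "I1 + I2 = 0"
    by (metis contour_integrable_join contour_integrable_on_def contour_integral_join
        contour_integral_unique has_contour_integral_integrable valid_path_linepath valid_path_part_circlepath)
  \<comment> \<open>on the diameter everything is real except \<open>g\<close> on \<open>[-1,0]\<close>\<close>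
  have Im_I2: "Im I2 = integral {-1..0} (\<lambda>x. Im (g (of_real x)) / (x - l) ^ (n + 1))"
  proof -
    have "((\<lambda>x. q (of_real x)) has_integral I2) {-1..1}"
      using I(2) by (simp add: has_contour_integral_linepath_Reals_iff)
    then have "((\<lambda>x. Im (q (of_real x))) has_integral Im I2) {-1..1}"
      by (rule has_integral_Im)
    moreover have "Im (q (of_real x)) = (if x \<in> {-1..0} then Im (g (of_real x)) / (x - l) ^ (n + 1) else 0)"
      if "x \<in> {-1..1}" for x
    proof (cases "x \<in> {-1..0}")
      case True
      then have "complex_of_real x \<noteq> of_real l" using l by auto
      then have "Im (q (of_real x)) = Im ((g (of_real x) - T (of_real x)) / of_real ((x - l) ^ (n + 1)))"
        by (simp add: q_def)
      then show ?thesis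
        using True T_real[of x] by (simp add: complex_is_Real_iff del: of_real_power)
    next
      case False
      then have "q (of_real x) \<in> \<real>"
        unfolding q_def using that C_real[of "n + 1"] g_real[of x] T_real[of x]
        by (auto intro!: Reals_divide Reals_diff Reals_power)
      then show ?thesis using False by (auto simp: complex_is_Real_iff)
    qed
    ultimately have "((\<lambda>x. if x \<in> {-1..0} then Im (g (of_real x)) / (x - l) ^ (n + 1) else 0) has_integral Im I2) {-1..1}"
      by (subst has_integral_cong[symmetric]) auto
    then have "((\<lambda>x. Im (g (of_real x)) / (x - l) ^ (n + 1)) has_integral Im I2) {-1..0}"
      by (subst (asm) has_integral_restrict) auto
    then show ?thesis by (simp add: integral_unique)
  qed
  \<comment> \<open>the factor \<open>- \<i>\<close> moves the branch cut of the logarithm to the vertical half line below \<open>l\<close>,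
    so that \<open>V\<close> is holomorphic near every point of the half disc other than \<open>l\<close>\<close>
  define V :: "complex \<Rightarrow> complex" where "V = (\<lambda>z::complex. fps_nth C n * Ln (- \<i> * (z - of_real l)) - (\<Sum>k<n. fps_nth C k / of_nat (n - k) * inverse (z - of_real l) ^ (n - k)))"
  have V: "((\<lambda>z::complex. T z / (z - of_real l) ^ (n + 1)) has_contour_integral (V (- 1) - V 1)) ?arc"
  proof -
    have "((\<lambda>z::complex. T z / (z - of_real l) ^ (n + 1)) has_contour_integral (V (pathfinish ?arc) - V (pathstart ?arc))) ?arc"
    proof (rule contour_integral_primitive[where S = "half_disc - {of_real l}"])
      fix z assume z: "z \<in> half_disc - {of_real l}"
      then have nz: "z - of_real l \<noteq> 0" by simp
      have ln: "- \<i> * (z - of_real l) \<notin> \<real>\<^sub>\<le>\<^sub>0"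
      proof
        assume "- \<i> * (z - of_real l) \<in> \<real>\<^sub>\<le>\<^sub>0"
        then have "Im z \<le> 0 \<and> Re z = l" by (auto simp: complex_nonpos_Reals_iff)
        then show False using z by (auto simp: half_disc_def complex_eq_iff)
      qed
      have pw: "((\<lambda>z. fps_nth C k / of_nat (n - k) * inverse (z - of_real l) ^ (n - k)) has_field_derivative
          - (fps_nth C k * inverse (z - of_real l) ^ (n + 1 - k))) (at z)" if "k < n" for k
      proof -
        define j where "j = n - k - 1"
        have j: "n - k = Suc j" "n + 1 - k = Suc (Suc j)" using that by (auto simp: j_def)
        have "((\<lambda>z. inverse (z - of_real l) ^ Suc j) has_field_derivative
            of_nat (Suc j) * (- (inverse (z - of_real l) ^ Suc (Suc j)))) (at z)"
        proof -
          have "((\<lambda>z. inverse (z - of_real l)) has_field_derivative - (inverse (z - of_real l) * inverse (z - of_real l))) (at z)"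
            using nz by (auto intro!: derivative_eq_intros)
          from DERIV_power[OF this, of "Suc j"] show ?thesis
            by (simp add: mult_ac del: of_nat_Suc)
        qed
        from DERIV_cmult[OF this, of "fps_nth C k / of_nat (Suc j)"] show ?thesis
          unfolding j by (simp del: of_nat_Suc power_Suc)
      qed
      have ln': "((\<lambda>z. fps_nth C n * Ln (- \<i> * (z - of_real l))) has_field_derivative fps_nth C n * inverse (z - of_real l)) (at z)"
        using ln nz by (auto intro!: derivative_eq_intros simp: field_simps)
      have "(V has_field_derivative fps_nth C n * inverse (z - of_real l) - (\<Sum>k<n. - (fps_nth C k * inverse (z - of_real l) ^ (n + 1 - k)))) (at z)"
        unfolding V_def by (intro DERIV_diff DERIV_sum ln' pw) simp
      moreover have "fps_nth C n * inverse (z - of_real l) - (\<Sum>k<n. - (fps_nth C k * inverse (z - of_real l) ^ (n + 1 - k)))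
          = T z / (z - of_real l) ^ (n + 1)"
      proof -
        have "T z / (z - of_real l) ^ (n + 1) = (\<Sum>k\<le>n. fps_nth C k * inverse (z - of_real l) ^ (n + 1 - k))"
          unfolding T_def sum_divide_distrib
        proof (rule sum.cong)
          fix k assume "k \<in> {..n}"
          then have "(z - of_real l) ^ (n + 1) = (z - of_real l) ^ k * (z - of_real l) ^ (n + 1 - k)"
            by (simp flip: power_add)
          then show "fps_nth C k * (z - of_real l) ^ k / (z - of_real l) ^ (n + 1) = fps_nth C k * inverse (z - of_real l) ^ (n + 1 - k)"
            using nz by (simp add: divide_inverse power_inverse)
        qed simp
        then show ?thesis
          by (simp add: lessThan_Suc_atMost[symmetric] sum_negf)
      qed
      ultimately show "(V has_field_derivative T z / (z - of_real l) ^ (n + 1)) (at z within half_disc - {of_real l})"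
        using has_field_derivative_at_within by metis
    qed (use arc_image in auto)
    then show ?thesis by simp
  qed
  have Im_V: "Im (V (-1) - V 1) = pi * Re (fps_nth C n)"
  proof -
    have sum_real: "(\<Sum>k<n. fps_nth C k / of_nat (n - k) * inverse (of_real x - of_real l) ^ (n - k)) \<in> \<real>" for x
      using C_real by (intro sum_in_Reals Reals_mult Reals_divide Reals_power Reals_inverse Reals_diff) auto
    have "Ln (- \<i> * (-1 - of_real l)) = of_real (ln (1 + l)) + \<i> * pi / 2"
    proof -
      have "Ln (- \<i> * (-1 - of_real l)) = Ln (\<i> * of_real (1 + l))" by (simp add: algebra_simps)
      also have "\<dots> = Ln (of_real (1 + l)) + \<i> * of_real pi / 2"
        using l by (subst Ln_times_ii) (auto simp del: of_real_add)
      finally show ?thesis using l by (simp add: Ln_of_real del: of_real_add)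
    qed
    moreover have "Ln (- \<i> * (1 - of_real l)) = of_real (ln (1 - l)) - \<i> * pi / 2"
    proof -
      have "Ln (- \<i> * (1 - of_real l)) = Ln (of_real (1 - l) * (- \<i>))" by (simp add: algebra_simps)
      also have "\<dots> = of_real (ln (1 - l)) + Ln (- \<i>)"
        using l by (subst Ln_times_of_real) (auto simp: Ln_of_real simp del: of_real_diff)
      finally show ?thesis using l by (simp add: Ln_of_real)
    qed
    moreover have "Im (fps_nth C n) = 0" using C_real[of n] by (simp add: complex_is_Real_iff)
    ultimately show ?thesis
      using sum_real[of "-1"] sum_real[of 1]
      by (simp add: V_def complex_is_Real_iff)
  qed
  have arc: "((\<lambda>z::complex. g z / (z - of_real l) ^ (n + 1)) has_contour_integral (I1 + (V (- 1) - V 1))) ?arc"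
  proof (rule has_contour_integral_eq[OF has_contour_integral_add[OF I(1) V]])
    fix z assume "z \<in> path_image ?arc"
    then have "z \<noteq> of_real l" using arc_image by auto
    then show "q z + T z / (z - of_real l) ^ (n + 1) = g z / (z - of_real l) ^ (n + 1)"
      by (simp add: q_def diff_divide_distrib)
  qed
  then have "((\<lambda>t. g (cis t) / (cis t - of_real l) ^ (n + 1) * \<i> * cis t) has_integral (I1 + (V (- 1) - V 1))) {0..pi}"
    by (subst (asm) has_contour_integral_part_circlepath_iff) (auto simp: pi_gt_zero)
  then have "((\<lambda>t. - \<i> * (g (cis t) / (cis t - of_real l) ^ (n + 1) * \<i> * cis t)) has_integral (- \<i> * (I1 + (V (- 1) - V 1)))) {0..pi}"
    by (rule has_integral_mult_right)
  then have H: "((\<lambda>t. g (cis t) / (cis t - of_real l) ^ (n + 1) * cis t) has_integral (- \<i> * (I1 + (V (- 1) - V 1)))) {0..pi}"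
    by (simp add: mult_ac)
  then show ?int by blast
  have "Re (- \<i> * (I1 + (V (- 1) - V 1))) = Im I1 + Im (V (- 1) - V 1)" by simp
  also have "Im I1 = - Im I2" using I(3) by (simp add: add_eq_0_iff)
  finally show ?eq
    unfolding integral_unique[OF H] Im_I2 Im_V by simp
qed

section \<open>Jacobi polynomials as Taylor coefficients\<close>

lemma gbinomial_complex_of_real: "complex_of_real x gchoose k = of_real (x gchoose k)"
  unfolding gbinomial_prod_rev by simp

text \<open>
  Writing \<open>z = l + x\<close>, both factors of \<open>z^(n+A) (1 - l z)^(n+\<beta>)\<close>
  become a constant times a binomial \<open>1 + const * x\<close>, and the Cauchy product of the two
  binomial series is, at index \<open>n\<close>, exactly the sum that defines the Jacobi polynomial at
  \<open>1 - 2 l^2\<close>: there \<open>(x-1)/2 = - l^2\<close> and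
  \<open>(x+1)/2 = 1 - l^2\<close>.
\<close>

lemma jacobi_generating_fps:
  fixes l A \<beta> :: real and n :: nat
  assumes l: "0 < l" "l < 1"
  defines "p \<equiv> real n + A" and "s \<equiv> real n + \<beta>"
  shows "\<exists>C. (\<lambda>x::complex. (of_real l + x) powr of_real p * (1 - of_real l * (of_real l + x)) powr of_real s) has_fps_expansion C
    \<and> (\<forall>k. fps_nth C k \<in> \<real>)
    \<and> fps_nth C n = of_real ((1 - l\<^sup>2) powr \<beta> * (l powr A * jacobi n A \<beta> (1 - 2 * l\<^sup>2)))"
proof -
  define u where "u = 1 / l"
  define v where "v = - l / (1 - l\<^sup>2)"
  define w where "w = l powr p * (1 - l\<^sup>2) powr s"
  have l2: "1 - l\<^sup>2 > 0" using l by (simp add: abs_square_less_1)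
  define C :: "complex fps" where "C = fps_const (of_real w) * ((fps_binomial (of_real p) oo (fps_const (of_real u) * fps_X)) *
     (fps_binomial (of_real s) oo (fps_const (of_real v) * fps_X)))"
  have lin: "(\<lambda>x. of_real c * x) has_fps_expansion (fps_const (of_real c :: complex) * fps_X)" for c
    by (intro fps_expansion_intros)
  have pw: "(\<lambda>x. (1 + of_real c * x) powr of_real e) has_fps_expansion
      (fps_binomial (of_real e :: complex) oo (fps_const (of_real c) * fps_X))" for c e
    using has_fps_expansion_compose[OF has_fps_expansion_binomial_complex lin] by (simp add: o_def)
  have "(\<lambda>x. of_real w * ((1 + of_real u * x) powr of_real p * (1 + of_real v * x) powr of_real s)) has_fps_expansion C"
    unfolding C_def by (intro has_fps_expansion_cmult_left has_fps_expansion_mult pw)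
  moreover have "of_real w * ((1 + of_real u * x) powr of_real p * (1 + of_real v * x) powr of_real s)
      = (of_real l + x) powr of_real p * (1 - of_real l * (of_real l + x)) powr of_real s" for x :: complex
  proof -
    have "of_real l + x = of_real l * (1 + of_real u * x)"
      using l by (simp add: u_def field_simps)
    then have 1: "(of_real l + x) powr of_real p = of_real (l powr p) * (1 + of_real u * x) powr of_real p"
      using l by (simp add: powr_times_real_left powr_of_real)
    have eq: "1 - of_real l * (of_real l + x) = of_real (1 - l\<^sup>2) * (1 + of_real v * x)"
    proof -
      have "(1 - l\<^sup>2) * v = - l" using l2 by (simp add: v_def)
      then have "of_real (1 - l\<^sup>2) * of_real v = (- of_real l :: complex)" by (metis of_real_mult of_real_minus)
      then have "of_real (1 - l\<^sup>2) * (1 + of_real v * x) = of_real (1 - l\<^sup>2) - of_real l * x"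
        by (simp only: distrib_left mult_1_right mult.assoc[symmetric]) simp
      then show ?thesis by (simp add: algebra_simps power2_eq_square)
    qed
    have 2: "(1 - of_real l * (of_real l + x)) powr of_real s = of_real ((1 - l\<^sup>2) powr s) * (1 + of_real v * x) powr of_real s"
    proof -
      have "(of_real (1 - l\<^sup>2) :: complex) powr of_real s = of_real ((1 - l\<^sup>2) powr s)"
        by (rule powr_of_real) (use l2 in simp)
      moreover have "(of_real (1 - l\<^sup>2) * (1 + of_real v * x)) powr of_real s = of_real (1 - l\<^sup>2) powr of_real s * (1 + of_real v * x) powr of_real s"
        by (rule powr_times_real_left) (use l2 in \<open>simp_all only: Reals_of_real Re_complex_of_real less_imp_le\<close>)
      ultimately show ?thesis unfolding eq by (simp only:)
    qed
    show ?thesis by (simp add: 1 2 w_def)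
  qed
  ultimately have exp: "(\<lambda>x. (of_real l + x) powr of_real p * (1 - of_real l * (of_real l + x)) powr of_real s) has_fps_expansion C"
    by simp
  have nth: "fps_nth C k = of_real (w * (\<Sum>i=0..k. u ^ i * (p gchoose i) * (v ^ (k - i) * (s gchoose (k - i)))))" for k
    unfolding C_def fps_mult_left_const_nth by (simp add: fps_mult_nth gbinomial_complex_of_real)
  have real: "fps_nth C k \<in> \<real>" for k
    unfolding nth by simp
  have val: "w * (\<Sum>i=0..n. u ^ i * (p gchoose i) * (v ^ (n - i) * (s gchoose (n - i))))
      = (1 - l\<^sup>2) powr \<beta> * (l powr A * jacobi n A \<beta> (1 - 2 * l\<^sup>2))"
  proof -
    have "w * (\<Sum>i=0..n. u ^ i * (p gchoose i) * (v ^ (n - i) * (s gchoose (n - i))))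
        = w * (\<Sum>\<mu>=0..n. u ^ (n - \<mu>) * (p gchoose (n - \<mu>)) * (v ^ \<mu> * (s gchoose \<mu>)))"
      by (rule arg_cong2[where f = "(*)", OF refl], rule sum.reindex_bij_witness[where i = "\<lambda>i. n - i" and j = "\<lambda>i. n - i"]) auto
    also have "\<dots> = (\<Sum>\<mu>=0..n. (1 - l\<^sup>2) powr \<beta> * l powr A * ((p gchoose (n - \<mu>)) * (s gchoose \<mu>) * (- l\<^sup>2) ^ \<mu> * (1 - l\<^sup>2) ^ (n - \<mu>)))"
      unfolding sum_distrib_left
    proof (rule sum.cong)
      fix \<mu> assume "\<mu> \<in> {0..n}"
      then obtain j where j: "n = \<mu> + j" by (metis atLeastAtMost_iff le_Suc_ex)
      have 1: "l powr p * u ^ (n - \<mu>) = l powr A * l ^ \<mu>"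
      proof -
        have "l powr p = l powr A * (l ^ \<mu> * l ^ j)"
          using l by (simp add: p_def powr_add powr_realpow j power_add)
        moreover have "l ^ j * u ^ j = 1"
          using l by (simp add: u_def flip: power_mult_distrib)
        ultimately show ?thesis by (simp add: j)
      qed
      have 2: "(1 - l\<^sup>2) powr s * v ^ \<mu> = (1 - l\<^sup>2) powr \<beta> * ((- l) ^ \<mu> * (1 - l\<^sup>2) ^ (n - \<mu>))"
      proof -
        have "(1 - l\<^sup>2) powr s = (1 - l\<^sup>2) powr \<beta> * ((1 - l\<^sup>2) ^ \<mu> * (1 - l\<^sup>2) ^ j)"
          using l2 by (simp add: s_def powr_add powr_realpow j power_add)
        moreover have "(1 - l\<^sup>2) ^ \<mu> * v ^ \<mu> = (- l) ^ \<mu>"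
          using l2 by (simp add: v_def flip: power_mult_distrib)
        ultimately show ?thesis by (simp add: j)
      qed
      have "w * (u ^ (n - \<mu>) * (p gchoose (n - \<mu>)) * (v ^ \<mu> * (s gchoose \<mu>)))
          = (l powr p * u ^ (n - \<mu>)) * ((1 - l\<^sup>2) powr s * v ^ \<mu>) * ((p gchoose (n - \<mu>)) * (s gchoose \<mu>))"
        by (simp add: w_def)
      also have "\<dots> = (1 - l\<^sup>2) powr \<beta> * l powr A * ((p gchoose (n - \<mu>)) * (s gchoose \<mu>) * (l ^ \<mu> * (- l) ^ \<mu>) * (1 - l\<^sup>2) ^ (n - \<mu>))"
        unfolding 1 2 by simp
      also have "l ^ \<mu> * (- l) ^ \<mu> = (- l\<^sup>2) ^ \<mu>"
        by (simp add: power2_eq_square flip: power_mult_distrib)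
      finally show "w * (u ^ (n - \<mu>) * (p gchoose (n - \<mu>)) * (v ^ \<mu> * (s gchoose \<mu>)))
          = (1 - l\<^sup>2) powr \<beta> * l powr A * ((p gchoose (n - \<mu>)) * (s gchoose \<mu>) * (- l\<^sup>2) ^ \<mu> * (1 - l\<^sup>2) ^ (n - \<mu>))" .
    qed simp
    also have "\<dots> = (1 - l\<^sup>2) powr \<beta> * (l powr A * jacobi n A \<beta> (1 - 2 * l\<^sup>2))"
    proof -
      have "((1 - 2 * l\<^sup>2) - 1) / 2 = - l\<^sup>2" "((1 - 2 * l\<^sup>2) + 1) / 2 = 1 - l\<^sup>2" by (simp_all add: field_simps)
      then show ?thesis
        unfolding jacobi_def p_def s_def sum_distrib_left by (simp only: mult.assoc)
    qed
    finally show ?thesis .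
  qed
  show ?thesis by (intro exI[of _ C] conjI allI exp real) (simp only: nth val)
qed

section \<open>Phase and amplitude of the integrand\<close>

text \<open>
  With \<open>z = exp (\<i> w)\<close> one has
  \<open>exp phase = z^(a+1) (1 - l z) / (z - l)\<close>, the function whose \<open>n\<close>-th
  power makes up the large factor of Cauchy's integral. In the coordinate \<open>w\<close> the unit circle is
  the real line and the power of \<open>z\<close> becomes an exponential. Both logarithms are principal,
  because \<open>1 - l z\<close> and \<open>1 - l / z\<close> stay in the right half plane; this makes
  the phase single valued.
\<close>

definition phase :: "real \<Rightarrow> real \<Rightarrow> complex \<Rightarrow> complex" where
  "phase a l w = \<i> * of_real a * w + Ln (1 - of_real l * exp (\<i> * w)) - Ln (1 - of_real l * exp (- (\<i> * w)))"

text \<open>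
  The part of Cauchy's integrand that does not depend on \<open>n\<close>. It includes the derivative
  \<open>\<i> z\<close> of \<open>z = exp (\<i> w)\<close>, except for the factor \<open>\<i>\<close>.
\<close>

definition amplitude :: "real \<Rightarrow> real \<Rightarrow> real \<Rightarrow> complex \<Rightarrow> complex" where
  "amplitude \<alpha> \<beta> l w =
     exp (\<i> * of_real \<alpha> * w) * (1 - of_real l * exp (\<i> * w)) powr of_real \<beta> / (1 - of_real l * exp (- (\<i> * w)))"

definition integrand :: "real \<Rightarrow> real \<Rightarrow> real \<Rightarrow> real \<Rightarrow> nat \<Rightarrow> complex \<Rightarrow> complex" where
  "integrand a \<alpha> \<beta> l n w = exp (of_nat n * phase a l w) * amplitude \<alpha> \<beta> l w"

text \<open>
  The modulus of Cauchy's integrand at the point \<open>z = - t\<close> of the branch cut. The two sides of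
  the cut differ only by phase factors, which is where \<open>sin (pi (a n + \<alpha>))\<close> comes
  from.
\<close>

definition cut_density :: "real \<Rightarrow> real \<Rightarrow> real \<Rightarrow> real \<Rightarrow> nat \<Rightarrow> real \<Rightarrow> real" where
  "cut_density a \<alpha> \<beta> l n t = t powr ((a + 1) * n + \<alpha>) * (1 + l * t) powr (n + \<beta>) / (t + l) ^ (n + 1)"

text \<open>
  The image of the annulus \<open>l < \<bar>z\<bar> < 1/l\<close> under
  \<open>z = exp (\<i> w)\<close>.
\<close>

definition strip :: "real \<Rightarrow> complex set" where
  "strip l = {w. \<bar>Im w\<bar> < - ln l}"

lemma strip_iff_mult_exp:
  assumes "0 < l"
  shows "w \<in> strip l \<longleftrightarrow> l * exp (- Im w) < 1 \<and> l * exp (Im w) < 1"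
proof -
  have *: "l * exp y < 1 \<longleftrightarrow> y < - ln l" for y
  proof -
    have "l * exp y < 1 \<longleftrightarrow> exp (ln l + y) < exp 0"
      using assms by (simp only: exp_add exp_ln exp_zero)
    then have "l * exp y < 1 \<longleftrightarrow> ln l + y < 0" by (simp only: exp_less_cancel_iff)
    then show ?thesis by linarith
  qed
  show ?thesis unfolding strip_def mem_Collect_eq * by linarith
qed

lemma open_strip: "open (strip l)" and convex_strip: "convex (strip l)"
proof -
  have eq: "strip l = {w. Im w < - ln l} \<inter> {w. Im w > ln l}" by (auto simp: strip_def)
  show "open (strip l)" unfolding eq by (intro open_Int open_halfspace_Im_lt open_halfspace_Im_gt)
  show "convex (strip l)" unfolding eq by (intro convex_Int convex_halfspace_Im_lt convex_halfspace_Im_gt)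
qed

lemma Re_one_minus_pos:
  assumes "0 < l" "w \<in> strip l"
  shows "0 < Re (1 - of_real l * exp (\<i> * w))" "0 < Re (1 - of_real l * exp (- (\<i> * w)))"
proof -
  have *: "0 < Re (1 - z)" if "norm z < 1" for z :: complex
    using that complex_Re_le_cmod[of z] by simp
  show "0 < Re (1 - of_real l * exp (\<i> * w))" "0 < Re (1 - of_real l * exp (- (\<i> * w)))"
    using assms strip_iff_mult_exp[OF assms(1), of w] by (auto intro!: * simp: norm_mult simp del: minus_complex.simps)
qed

lemma one_minus_not_nonpos:
  assumes "0 < l" "w \<in> strip l"
  shows "1 - of_real l * exp (\<i> * w) \<notin> \<real>\<^sub>\<le>\<^sub>0" "1 - of_real l * exp (- (\<i> * w)) \<notin> \<real>\<^sub>\<le>\<^sub>0"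
    "1 - of_real l * exp (\<i> * w) \<noteq> 0" "1 - of_real l * exp (- (\<i> * w)) \<noteq> 0"
proof -
  have "z \<notin> \<real>\<^sub>\<le>\<^sub>0 \<and> z \<noteq> 0" if "0 < Re z" for z
    using that by (auto simp: complex_nonpos_Reals_iff)
  from this[OF Re_one_minus_pos(1)[OF assms]] this[OF Re_one_minus_pos(2)[OF assms]]
  show "1 - of_real l * exp (\<i> * w) \<notin> \<real>\<^sub>\<le>\<^sub>0" "1 - of_real l * exp (- (\<i> * w)) \<notin> \<real>\<^sub>\<le>\<^sub>0"
    "1 - of_real l * exp (\<i> * w) \<noteq> 0" "1 - of_real l * exp (- (\<i> * w)) \<noteq> 0"
    by blast+
qed

lemma holomorphic_phase:
  assumes l: "0 < l"
  shows "phase a l holomorphic_on strip l"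
  unfolding phase_def[abs_def]
  by (intro holomorphic_intros one_minus_not_nonpos[OF l])

lemma holomorphic_amplitude:
  assumes l: "0 < l"
  shows "amplitude \<alpha> \<beta> l holomorphic_on strip l"
  unfolding amplitude_def[abs_def]
  by (intro holomorphic_intros one_minus_not_nonpos[OF l])

lemma holomorphic_integrand:
  assumes l: "0 < l"
  shows "integrand a \<alpha> \<beta> l n holomorphic_on strip l"
  unfolding integrand_def[abs_def]
  by (intro holomorphic_intros holomorphic_phase[OF l] holomorphic_amplitude[OF l])

text \<open>
  The principal power is discontinuous across the negative axis, but on the half disc the axis is approached
  from above only. There \<open>Ln z = Ln (- \<i> z) + \<i> pi / 2\<close>, whose right hand side
  is continuous.
\<close>

lemma continuous_on_powr_half_disc:
  assumes "p > 0"
  shows "continuous_on half_disc (\<lambda>z::complex. z powr of_real p)"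
proof -
  have "continuous (at z within half_disc) (\<lambda>z::complex. z powr of_real p)" if z: "z \<in> half_disc" for z
  proof (cases "z = 0")
    case True
    have "((\<lambda>w::complex. norm w powr p) \<longlongrightarrow> 0) (at 0 within half_disc)"
      using assms by (intro tendsto_zero_powrI[where b = p] tendsto_norm_zero tendsto_ident_at tendsto_const always_eventually) auto
    then have "((\<lambda>w::complex. norm (w powr of_real p)) \<longlongrightarrow> 0) (at 0 within half_disc)"
      by (simp add: norm_powr_real_powr')
    then have "((\<lambda>w::complex. w powr of_real p) \<longlongrightarrow> 0) (at 0 within half_disc)"
      by (rule tendsto_norm_zero_cancel)
    then show ?thesis using True by (simp add: continuous_within)
  next
    case False
    have im: "w \<in> half_disc \<Longrightarrow> 0 \<le> Im w" for w by (simp add: half_disc_def)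
    have eq: "w powr of_real p = exp (of_real p * (Ln (- \<i> * w) + \<i> * of_real pi / 2))" if "w \<in> half_disc" "w \<noteq> 0" for w
    proof -
      have "Ln (\<i> * (- \<i> * w)) = Ln (- \<i> * w) + \<i> * of_real pi / 2"
        using that im[OF that(1)] by (subst Ln_times_ii) auto
      then show ?thesis using that by (simp add: powr_def)
    qed
    have nonpos: "- \<i> * z \<notin> \<real>\<^sub>\<le>\<^sub>0"
      using False im[OF z] by (auto simp: complex_nonpos_Reals_iff complex_eq_iff)
    have "isCont (\<lambda>w. exp (of_real p * (Ln (- \<i> * w) + \<i> * of_real pi / 2))) z"
      by (intro continuous_intros nonpos)
    then have "((\<lambda>w. exp (of_real p * (Ln (- \<i> * w) + \<i> * of_real pi / 2))) \<longlongrightarrow> z powr of_real p) (at z within half_disc)"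
      unfolding eq[OF z False] unfolding isCont_def by (rule Lim_at_imp_Lim_at_within)
    moreover have "\<forall>\<^sub>F w in at z within half_disc. exp (of_real p * (Ln (- \<i> * w) + \<i> * of_real pi / 2)) = w powr of_real p"
    proof -
      have "\<forall>\<^sub>F w in nhds z. w \<in> - {0}"
        by (rule eventually_nhds_in_open) (use False in auto)
      then have "\<forall>\<^sub>F w in at z within half_disc. w \<in> half_disc \<and> w \<noteq> 0"
        by (auto simp: eventually_at_filter elim: eventually_mono)
      then show ?thesis by (rule eventually_mono) (simp add: eq)
    qed
    ultimately show ?thesis unfolding continuous_within by (rule Lim_transform_eventually)
  qed
  then show ?thesis by (simp add: continuous_on_eq_continuous_within)
qed

section \<open>The contour representation\<close>

lemma integrand_on_arc:
  assumes l: "0 < l" "l < 1" and t: "0 \<le> t" "t \<le> pi"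
  shows "cis t powr of_real (real n + (a * real n + \<alpha>)) * (1 - of_real l * cis t) powr of_real (real n + \<beta>)
           / (cis t - of_real l) ^ (n + 1) * cis t = integrand a \<alpha> \<beta> l n (of_real t)"
proof -
  define E where "E = exp (\<i> * of_real t)"
  define X where "X = 1 - of_real l * E"
  define Y where "Y = 1 - of_real l * exp (- (\<i> * of_real t))"
  have strip: "complex_of_real t \<in> strip l" using l by (simp add: strip_def)
  note nz = one_minus_not_nonpos[OF l(1) strip]
  have X: "X \<noteq> 0" and Y: "Y \<noteq> 0" using nz(3,4) by (simp_all only: X_def Y_def E_def not_False_eq_True)
  have E: "E \<noteq> 0" "cis t = E" by (simp_all add: E_def cis_conv_exp)
  have "Ln E = \<i> * of_real t"
    unfolding E_def by (rule Ln_exp) (use t pi_gt_zero in \<open>auto simp del: pi_gt_zero\<close>)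
  then have "E powr of_real (real n + (a * real n + \<alpha>)) = exp (of_real (real n + (a * real n + \<alpha>)) * (\<i> * of_real t))"
    using E by (simp only: powr_def if_False)
  also have "\<dots> = exp (of_nat n * (\<i> * of_real t) + (of_nat n * (\<i> * of_real a * of_real t) + \<i> * of_real \<alpha> * of_real t))"
    by (rule arg_cong[where f = exp]) (simp add: algebra_simps)
  also have "\<dots> = E ^ n * (exp (of_nat n * (\<i> * of_real a * of_real t)) * exp (\<i> * of_real \<alpha> * of_real t))"
    by (simp only: exp_add exp_of_nat_mult E_def)
  finally have 1: "E powr of_real (real n + (a * real n + \<alpha>)) = \<dots>" .
  have 2: "X powr of_real (real n + \<beta>) = exp (of_nat n * Ln X) * X powr of_real \<beta>"
    using X by (simp add: powr_def exp_add distrib_right)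
  have "exp (of_nat n * Ln Y) = Y ^ n"
    using Y by (simp add: exp_of_nat_mult)
  moreover have "E - of_real l = E * Y"
    by (simp add: E_def Y_def algebra_simps flip: exp_add)
  ultimately have 3: "(E - of_real l) ^ (n + 1) = E ^ (n + 1) * (exp (of_nat n * Ln Y) * Y)"
    by (simp add: power_mult_distrib)
  have 4: "integrand a \<alpha> \<beta> l n (of_real t) = exp (of_nat n * (\<i> * of_real a * of_real t)) * exp (of_nat n * Ln X) / exp (of_nat n * Ln Y)
      * (exp (\<i> * of_real \<alpha> * of_real t) * X powr of_real \<beta> / Y)"
    unfolding integrand_def phase_def amplitude_def E_def[symmetric] X_def[symmetric] Y_def[symmetric]
    by (simp only: exp_add exp_diff distrib_left right_diff_distrib)
  show ?thesis
    unfolding E(2) X_def[symmetric] 1 2 3 4 using E(1) Y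
    by (simp add: field_simps)
qed

text \<open>
  The imaginary \<open>w\<close>-axis is the positive \<open>z\<close>-axis, where Cauchy's integrand is real.
  Hence the real part of a primitive is constant along it, and the contour may start anywhere on it.
\<close>

lemma integrand_on_imaginary_axis:
  assumes l: "0 < l" and y: "\<bar>y\<bar> < - ln l"
  shows "integrand a \<alpha> \<beta> l n (\<i> * of_real y) \<in> \<real>"
proof -
  have s: "\<i> * of_real y \<in> strip l" using y by (simp add: strip_def)
  have e: "exp (\<i> * (\<i> * of_real y)) = of_real (exp (- y))" "exp (- (\<i> * (\<i> * of_real y))) = of_real (exp y)"
    by (simp_all add: exp_of_real flip: of_real_minus)
  define u v where "u = 1 - l * exp (- y)" and "v = 1 - l * exp y"
  have uv: "u > 0" "v > 0" "1 - of_real l * exp (\<i> * (\<i> * of_real y)) = complex_of_real u"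
     "1 - of_real l * exp (- (\<i> * (\<i> * of_real y))) = complex_of_real v"
    using Re_one_minus_pos[OF l s] unfolding e by (simp_all add: u_def v_def)
  have I: "\<i> * of_real x * (\<i> * of_real y) = complex_of_real (- (x * y))" for x
    by (simp add: algebra_simps)
  show ?thesis
    unfolding integrand_def phase_def amplitude_def uv(3,4)
    unfolding I Ln_of_real[OF uv(1)] Ln_of_real[OF uv(2)] powr_of_real[OF less_imp_le[OF uv(1)]]
    by (intro Reals_mult Reals_divide Reals_add Reals_diff exp_in_Reals Reals_of_real Reals_of_nat)
qed

text \<open>
  On the line \<open>Re w = pi\<close> the variable \<open>z = - exp (- y)\<close> runs along the
  upper side of the branch cut. The argument of the integrand is constant there.
\<close>

lemma integrand_on_cut:
  assumes l: "0 < l" and y: "\<bar>y\<bar> < - ln l"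
  shows "integrand a \<alpha> \<beta> l n (of_real pi + \<i> * of_real y) =
     cis (pi * (a * real n + \<alpha>)) * of_real (exp (- y) * cut_density a \<alpha> \<beta> l n (exp (- y)))"
proof -
  define t where "t = exp (- y)"
  have t: "t > 0" "exp y = 1 / t" "y = - ln t"
    by (simp add: t_def, simp add: t_def exp_minus field_simps, simp add: t_def)
  define u v where "u = 1 + l * t" and "v = 1 + l / t"
  have uv: "u > 0" "v > 0" using l t by (simp_all add: u_def v_def add_pos_pos)
  have arg: "\<i> * (of_real pi + \<i> * of_real y) = \<i> * of_real pi + of_real (- y)"
    by (simp add: algebra_simps)
  have e: "exp (\<i> * (of_real pi + \<i> * of_real y)) = - of_real t"
    unfolding arg exp_add by (simp add: t_def exp_of_real flip: of_real_minus)
  have X: "1 - of_real l * exp (\<i> * (of_real pi + \<i> * of_real y)) = complex_of_real u"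
    unfolding e by (simp add: u_def)
  have Y: "1 - of_real l * exp (- (\<i> * (of_real pi + \<i> * of_real y))) = complex_of_real v"
    unfolding exp_minus e using t by (simp add: v_def field_simps)
  have c: "exp (of_nat n * (\<i> * of_real a * (of_real pi + \<i> * of_real y))) * exp (\<i> * of_real \<alpha> * (of_real pi + \<i> * of_real y))
      = cis (pi * (a * real n + \<alpha>)) * of_real (t powr (a * real n + \<alpha>))"
  proof -
    have eq: "of_nat n * (\<i> * of_real a * (of_real pi + \<i> * of_real y)) + \<i> * of_real \<alpha> * (of_real pi + \<i> * of_real y)
        = \<i> * of_real (pi * (a * real n + \<alpha>)) + of_real ((a * real n + \<alpha>) * ln t)"
      unfolding t(3) by (simp add: algebra_simps)
    have pw: "t powr (a * real n + \<alpha>) = exp ((a * real n + \<alpha>) * ln t)"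
      using t(1) by (simp add: powr_def)
    show ?thesis
      unfolding exp_add[symmetric] eq unfolding exp_add pw cis_conv_exp exp_of_real ..
  qed
  have "integrand a \<alpha> \<beta> l n (of_real pi + \<i> * of_real y)
     = exp (of_nat n * (\<i> * of_real a * (of_real pi + \<i> * of_real y))) * exp (of_nat n * Ln (of_real u)) / exp (of_nat n * Ln (of_real v))
        * (exp (\<i> * of_real \<alpha> * (of_real pi + \<i> * of_real y)) * of_real u powr of_real \<beta> / of_real v)"
    unfolding integrand_def phase_def amplitude_def X Y
    by (simp only: exp_add exp_diff distrib_left right_diff_distrib)
  also have "\<dots> = (exp (of_nat n * (\<i> * of_real a * (of_real pi + \<i> * of_real y))) * exp (\<i> * of_real \<alpha> * (of_real pi + \<i> * of_real y)))
       * (exp (of_nat n * Ln (of_real u)) * of_real u powr of_real \<beta> / (exp (of_nat n * Ln (of_real v)) * of_real v))"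
    by simp
  also have "exp (of_nat n * Ln (of_real u)) = (complex_of_real u) ^ n"
    using uv by (simp add: exp_of_nat_mult)
  also have "exp (of_nat n * Ln (of_real v)) = (complex_of_real v) ^ n"
    using uv by (simp add: exp_of_nat_mult)
  also have "(complex_of_real u) ^ n * of_real u powr of_real \<beta> / ((complex_of_real v) ^ n * of_real v) = of_real (u powr (n + \<beta>) / v ^ (n + 1))"
    using uv by (simp add: powr_of_real powr_add powr_realpow)
  finally have "integrand a \<alpha> \<beta> l n (of_real pi + \<i> * of_real y)
      = cis (pi * (a * real n + \<alpha>)) * of_real (t powr (a * real n + \<alpha>) * (u powr (n + \<beta>) / v ^ (n + 1)))"
    unfolding c by simp
  moreover have "t powr (a * real n + \<alpha>) * (u powr (n + \<beta>) / v ^ (n + 1)) = t * cut_density a \<alpha> \<beta> l n t"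
  proof -
    have v: "v = (t + l) / t" using t by (simp add: v_def field_simps)
    have "t powr ((a + 1) * real n + \<alpha>) = t powr (real n + (a * real n + \<alpha>))" by (simp add: algebra_simps)
    also have "\<dots> = t ^ n * t powr (a * real n + \<alpha>)" using t by (simp add: powr_add powr_realpow)
    finally show ?thesis
      using t by (simp add: cut_density_def u_def v power_divide)
  qed
  ultimately show ?thesis unfolding t_def[symmetric] by (simp only:)
qed

lemma cut_density_continuous_on:
  assumes "0 < l" "(a + 1) * real n + \<alpha> > 0"
  shows "continuous_on {0..b} (cut_density a \<alpha> \<beta> l n)"
proof -
  have pos: "0 < 1 + l * t" "0 < t + l" if "t \<in> {0..b}" for t
    using that assms(1) by (simp_all add: add_pos_nonneg add_nonneg_pos)
  have "continuous_on {0..b} (\<lambda>t. t powr ((a + 1) * real n + \<alpha>))"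
    by (rule continuous_on_powr') (use assms(2) in \<open>auto intro: continuous_intros\<close>)
  moreover have "continuous_on {0..b} (\<lambda>t. (1 + l * t) powr (real n + \<beta>))"
    by (rule continuous_on_powr') (use pos(1) in \<open>force intro!: continuous_intros\<close>)+
  moreover have "continuous_on {0..b} (\<lambda>t. (t + l) ^ (n + 1))"
    by (intro continuous_intros)
  ultimately show ?thesis
    unfolding cut_density_def[abs_def]
    by (intro continuous_on_divide continuous_on_mult) (use pos(2) in \<open>force simp: power_eq_0_iff\<close>)+
qed

text \<open>
  The half disc formula for \<open>g z = z^(n+A) (1 - l z)^(n+\<beta>)\<close> with
  \<open>A = a n + \<alpha>\<close>. The positivity assumption says that the exponent
  \<open>n + A\<close> is positive, so that \<open>g\<close> is continuous at the branch point
  \<open>0\<close>.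
\<close>

lemma jacobi_arc_formula:
  assumes l: "0 < l" "l < 1" and pos: "(a + 1) * real n + \<alpha> > 0"
  shows "(\<lambda>t. integrand a \<alpha> \<beta> l n (of_real t)) integrable_on {0..pi}"
    and "Re (integral {0..pi} (\<lambda>t. integrand a \<alpha> \<beta> l n (of_real t)))
        - sin (pi * (a * real n + \<alpha>)) * integral {0..1} (cut_density a \<alpha> \<beta> l n)
        = pi * ((1 - l\<^sup>2) powr \<beta> * scaled_jacobi a \<alpha> \<beta> l n)"
proof -
  define p where "p = real n + (a * real n + \<alpha>)"
  define s where "s = real n + \<beta>"
  have p: "p > 0" using pos by (simp add: p_def algebra_simps)
  define g :: "complex \<Rightarrow> complex" where "g = (\<lambda>z. z powr of_real p * (1 - of_real l * z) powr of_real s)"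
  have Re1: "0 < Re (1 - of_real l * z)" if "norm z \<le> 1" for z :: complex
  proof -
    have "Re z \<le> 1" using complex_Re_le_cmod[of z] that by linarith
    then have "l * Re z \<le> l * 1" using l by (intro mult_left_mono) auto
    then have "l * Re z < 1" using l by linarith
    then show ?thesis by simp
  qed
  have slit: "1 - of_real l * z \<notin> \<real>\<^sub>\<le>\<^sub>0" if "norm z \<le> 1" for z :: complex
    using Re1[OF that] by (auto simp: complex_nonpos_Reals_iff)
  have nrm: "norm z \<le> 1" if "z \<in> half_disc" for z
    using that by (simp add: half_disc_def)
  have cont: "continuous_on half_disc g"
    unfolding g_def
  proof (intro continuous_on_mult continuous_on_powr_half_disc p)
    show "continuous_on half_disc (\<lambda>z. (1 - of_real l * z) powr of_real s)"
    proof (rule continuous_on_powr_complex)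
      show "half_disc \<subseteq> {z. 0 \<le> Re (1 - of_real l * z) \<or> Im (1 - of_real l * z) \<noteq> 0}"
        using Re1[OF nrm] by force
      show "0 < Re (complex_of_real s)" if "z \<in> half_disc" "1 - of_real l * z = 0" for z
        using Re1[OF nrm[OF that(1)]] unfolding that(2) by simp
    qed (intro continuous_intros)+
  qed
  have "g holomorphic_on interior half_disc"
    unfolding g_def
  proof (intro holomorphic_intros)
    fix z assume "z \<in> interior half_disc"
    then have z: "norm z < 1" "0 < Im z" using interior_half_disc by auto
    show "z \<notin> \<real>\<^sub>\<le>\<^sub>0" using z by (auto simp: complex_nonpos_Reals_iff)
    show "1 - of_real l * z \<notin> \<real>\<^sub>\<le>\<^sub>0" using z slit by simp
  qed
  then have diff: "g field_differentiable at z" if "z \<in> interior half_disc" for z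
    using that by (rule holomorphic_on_imp_differentiable_at[OF _ open_interior])
  obtain C where C0: "(\<lambda>x. (of_real l + x) powr complex_of_real (real n + (a * real n + \<alpha>))
      * (1 - of_real l * (of_real l + x)) powr of_real (real n + \<beta>)) has_fps_expansion C"
    and C_real: "\<And>k. fps_nth C k \<in> \<real>"
    and C_n: "fps_nth C n = of_real ((1 - l\<^sup>2) powr \<beta> * (l powr (a * real n + \<alpha>) * jacobi n (a * real n + \<alpha>) \<beta> (1 - 2 * l\<^sup>2)))"
    using jacobi_generating_fps[OF l, of n "a * real n + \<alpha>" \<beta>] by blast
  have C: "(\<lambda>x. g (of_real l + x)) has_fps_expansion C"
    using C0 by (simp only: g_def p_def s_def)
  have real: "1 - of_real l * of_real x = complex_of_real (1 - l * x)" for x by simp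
  have g_real: "g (of_real x) \<in> \<real>" if "x \<in> {0..1}" for x
  proof -
    have "0 \<le> 1 - l * x" using that l mult_mono[of l 1 x 1] by auto
    then show ?thesis using that unfolding g_def real by (simp add: powr_of_real del: of_real_diff)
  qed
  note H = half_disc_coefficient[OF l cont diff C C_real g_real, of n]
  have arc: "g (cis t) / (cis t - of_real l) ^ (n + 1) * cis t = integrand a \<alpha> \<beta> l n (of_real t)" if "t \<in> {0..pi}" for t
    unfolding g_def p_def s_def by (rule integrand_on_arc[OF l]) (use that in auto)
  show "(\<lambda>t. integrand a \<alpha> \<beta> l n (of_real t)) integrable_on {0..pi}"
    by (rule integrable_eq[OF H(1) arc])
  have "integral {-1..0} (\<lambda>x. Im (g (of_real x)) / (x - l) ^ (n + 1))
      = integral {-1..-0} (\<lambda>x. - sin (pi * (a * real n + \<alpha>)) * cut_density a \<alpha> \<beta> l n (- x))"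
    unfolding minus_zero
  proof (rule Henstock_Kurzweil_Integration.integral_cong)
    fix x :: real assume x: "x \<in> {-1..0}"
    have u: "0 \<le> 1 - l * x" using mult_nonneg_nonpos[of l x] x l by auto
    \<comment> \<open>\<open>sin (pi p)\<close> and the power of the negative number \<open>x - l\<close> both change sign with the parity of \<open>n\<close>\<close>
    have sgn: "(x - l) ^ (n + 1) = - ((-1) ^ n * (- x + l) ^ (n + 1))"
    proof -
      have "x - l = (-1) * (- x + l)" by simp
      then show ?thesis by (simp only: power_mult_distrib) simp
    qed
    have sn: "sin (pi * p) = (-1) ^ n * sin (pi * (a * real n + \<alpha>))"
      by (simp add: p_def distrib_left sin_add mult.commute[of pi "real n"])
    have m1: "(-1) ^ n * (-1) ^ n = (1::real)" by (simp flip: power_add mult_2)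
    have "Im (g (of_real x)) = (- x) powr p * sin (pi * p) * (1 - l * x) powr s"
    proof (cases "x = 0")
      case True then show ?thesis by (simp add: g_def)
    next
      case False
      then have "complex_of_real x powr of_real p = of_real ((- x) powr p) * exp (\<i> * of_real pi * of_real p)"
        using x by (simp add: powr_of_real_if)
      moreover have "exp (\<i> * of_real pi * of_real p) = cis (pi * p)" by (simp add: cis_conv_exp mult.assoc)
      ultimately have "g (of_real x) = of_real ((- x) powr p) * cis (pi * p) * of_real ((1 - l * x) powr s)"
        unfolding g_def real using u by (simp add: powr_of_real del: of_real_diff)
      then show ?thesis by simp
    qed
    also have "\<dots> / (x - l) ^ (n + 1) = - sin (pi * (a * real n + \<alpha>)) * ((- x) powr p * (1 - l * x) powr s / (- x + l) ^ (n + 1))"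
      unfolding sgn sn using m1 by (simp add: divide_simps)
    also have "(- x) powr p * (1 - l * x) powr s / (- x + l) ^ (n + 1) = cut_density a \<alpha> \<beta> l n (- x)"
      by (simp add: cut_density_def p_def s_def algebra_simps)
    finally show "Im (g (of_real x)) / (x - l) ^ (n + 1) = - sin (pi * (a * real n + \<alpha>)) * cut_density a \<alpha> \<beta> l n (- x)" .
  qed
  also have "\<dots> = integral {0..1} (\<lambda>x. - sin (pi * (a * real n + \<alpha>)) * cut_density a \<alpha> \<beta> l n x)"
    by (rule Henstock_Kurzweil_Integration.integral_reflect_real)
  also have "\<dots> = - sin (pi * (a * real n + \<alpha>)) * integral {0..1} (cut_density a \<alpha> \<beta> l n)"
    by (rule integral_mult_right)
  finally have I: "integral {-1..0} (\<lambda>x. Im (g (of_real x)) / (x - l) ^ (n + 1)) = \<dots>" .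
  have "integral {0..pi} (\<lambda>t. g (cis t) / (cis t - of_real l) ^ (n + 1) * cis t) = integral {0..pi} (\<lambda>t. integrand a \<alpha> \<beta> l n (of_real t))"
    by (rule Henstock_Kurzweil_Integration.integral_cong[OF arc])
  then show "Re (integral {0..pi} (\<lambda>t. integrand a \<alpha> \<beta> l n (of_real t)))
        - sin (pi * (a * real n + \<alpha>)) * integral {0..1} (cut_density a \<alpha> \<beta> l n)
        = pi * ((1 - l\<^sup>2) powr \<beta> * scaled_jacobi a \<alpha> \<beta> l n)"
    using H(2) unfolding I C_n by (simp add: scaled_jacobi_def)
qed

lemma has_integral_primitive_on_ray:
  fixes w u :: complex
  assumes "0 \<le> b" and "\<And>s. s \<in> {0..b} \<Longrightarrow> w + of_real s * u \<in> S"
    and "\<And>z. z \<in> S \<Longrightarrow> (\<Psi> has_field_derivative f z) (at z)"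
  shows "((\<lambda>s. f (w + of_real s * u) * u) has_integral (\<Psi> (w + of_real b * u) - \<Psi> w)) {0..b}"
proof -
  have "((\<lambda>s. f (w + of_real s * u) * u) has_integral (\<Psi> (w + of_real b * u) - \<Psi> (w + of_real 0 * u))) {0..b}"
  proof (rule fundamental_theorem_of_calculus[OF assms(1)])
    fix s assume "s \<in> {0..b}"
    then have d: "(\<Psi> has_field_derivative f (w + of_real s * u)) (at (w + of_real s * u))"
      using assms by blast
    have v: "((\<lambda>s. w + of_real s * u) has_vector_derivative u) (at s within {0..b})"
      by (auto intro!: derivative_eq_intros)
    show "((\<lambda>s. \<Psi> (w + of_real s * u)) has_vector_derivative f (w + of_real s * u) * u) (at s within {0..b})"
      by (rule field_vector_diff_chain_within[OF v has_field_derivative_at_within[OF d], unfolded o_def, THEN has_vector_derivative_eq_rhs]) simp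
  qed
  then show ?thesis by simp
qed

text \<open>
  The integral may be taken along any path in the strip from the imaginary axis to the line
  \<open>Re w = pi\<close>, provided that the cut is followed up to the radius \<open>exp (- y)\<close>
  at which the path ends. A primitive \<open>\<Psi>\<close> of the integrand replaces the path. Moving the
  starting point does not change \<open>Re \<Psi>\<close>, as the integrand is real on the imaginary axis;
  moving the end point changes \<open>Re \<Psi>\<close> by precisely the additional piece of the cut
  integral.
\<close>

lemma jacobi_contour_formula:
  assumes l: "0 < l" "l < 1" and pos: "(a + 1) * real n + \<alpha> > 0"
  shows "\<exists>\<Psi>. (\<forall>w\<in>strip l. (\<Psi> has_field_derivative integrand a \<alpha> \<beta> l n w) (at w)) \<and>
     (\<forall>y y'. \<bar>y\<bar> < - ln l \<longrightarrow> \<bar>y'\<bar> < - ln l \<longrightarrow>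
       Re (\<Psi> (of_real pi + \<i> * of_real y) - \<Psi> (\<i> * of_real y'))
        - sin (pi * (a * real n + \<alpha>)) * integral {0..exp (- y)} (cut_density a \<alpha> \<beta> l n)
       = pi * ((1 - l\<^sup>2) powr \<beta> * scaled_jacobi a \<alpha> \<beta> l n))"
proof -
  let ?F = "integrand a \<alpha> \<beta> l n" and ?A = "pi * (a * real n + \<alpha>)" and ?k = "cut_density a \<alpha> \<beta> l n"
  have L: "0 < - ln l" using l by simp
  have "\<exists>\<Psi>. \<forall>w\<in>strip l. (\<Psi> has_field_derivative ?F w) (at w)"
  proof (rule holomorphic_convex_primitive'[OF convex_strip open_strip holomorphic_integrand[OF l(1)]])
    fix \<Psi> assume "\<And>w. w \<in> strip l \<Longrightarrow> (\<Psi> has_field_derivative ?F w) (at w within strip l)"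
    then show "\<exists>\<Psi>. \<forall>w\<in>strip l. (\<Psi> has_field_derivative ?F w) (at w)"
      by (intro exI[of _ \<Psi>] ballI) (simp add: at_within_open[OF _ open_strip])
  qed
  then obtain \<Psi> where \<Psi>: "\<And>w. w \<in> strip l \<Longrightarrow> (\<Psi> has_field_derivative ?F w) (at w)"
    by blast
  have vert: "((\<lambda>y. \<Psi> (of_real x + \<i> * of_real y)) has_vector_derivative \<i> * ?F (of_real x + \<i> * of_real y)) (at y)"
    if "\<bar>y\<bar> < - ln l" for x y
  proof -
    have "(\<Psi> has_field_derivative ?F (of_real x + \<i> * of_real y)) (at (of_real x + \<i> * of_real y) within (\<lambda>y. of_real x + \<i> * of_real y) ` UNIV)"
      by (rule has_field_derivative_at_within, rule \<Psi>) (use that in \<open>simp add: strip_def\<close>)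
    moreover have "((\<lambda>y. of_real x + \<i> * complex_of_real y) has_vector_derivative \<i>) (at y)"
      by (auto intro!: derivative_eq_intros)
    ultimately show ?thesis
      using field_vector_diff_chain_within[of "\<lambda>y. of_real x + \<i> * complex_of_real y" \<i> y UNIV \<Psi>] by (simp add: o_def)
  qed
  have deriv_Re: "((\<lambda>y. Re (\<Psi> (of_real x + \<i> * of_real y))) has_field_derivative Re (\<i> * ?F (of_real x + \<i> * of_real y))) (at y)"
    if "\<bar>y\<bar> < - ln l" for x y
    using bounded_linear.has_vector_derivative[OF bounded_linear_Re vert[OF that, of x]]
    by (simp add: has_real_derivative_iff_has_vector_derivative)
  have left: "Re (\<Psi> (\<i> * of_real y)) = Re (\<Psi> 0)" if y: "\<bar>y\<bar> < - ln l" for y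
  proof -
    have "Re (\<Psi> (of_real 0 + \<i> * of_real y)) = Re (\<Psi> (of_real 0 + \<i> * of_real 0))"
    proof (rule DERIV_isconst3[of "ln l" "- ln l" _ _ "\<lambda>y. Re (\<Psi> (of_real 0 + \<i> * of_real y))"])
      show "ln l < - ln l" using L by linarith
      fix y assume "y \<in> {ln l<..<- ln l}"
      then have y: "\<bar>y\<bar> < - ln l" by auto
      have "?F (of_real 0 + \<i> * of_real y) \<in> \<real>"
        using integrand_on_imaginary_axis[OF l(1) y] by simp
      then have "Re (\<i> * ?F (of_real 0 + \<i> * of_real y)) = 0" by (simp add: complex_is_Real_iff)
      then show "((\<lambda>y. Re (\<Psi> (of_real 0 + \<i> * of_real y))) has_field_derivative 0) (at y)"
        using deriv_Re[OF y, of 0] by (simp only:)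
    qed (use y L in auto)
    then show ?thesis by simp
  qed
  have cut: "((\<lambda>y. integral {0..exp (- y)} ?k) has_field_derivative - (exp (- y) * ?k (exp (- y)))) (at y)" for y
  proof -
    define b where "b = exp (- y) + 1"
    have b: "exp (- y) \<in> {0<..<b}" by (simp add: b_def)
    have "((\<lambda>t. integral {0..t} ?k) has_field_derivative ?k (exp (- y))) (at (exp (- y)) within {0..b})"
      by (rule integral_has_real_derivative[OF cut_density_continuous_on[OF l(1) pos]]) (use b in auto)
    then have "((\<lambda>t. integral {0..t} ?k) has_field_derivative ?k (exp (- y))) (at (exp (- y)) within {0<..<b})"
      by (rule has_field_derivative_subset) auto
    then have "((\<lambda>t. integral {0..t} ?k) has_field_derivative ?k (exp (- y))) (at (exp (- y)))"
      using at_within_open[OF b] by simp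
    moreover have "((\<lambda>y. exp (- y)) has_field_derivative - exp (- y)) (at y)"
      by (auto intro!: derivative_eq_intros)
    ultimately have "((\<lambda>y. integral {0..exp (- y)} ?k) has_field_derivative ?k (exp (- y)) * - exp (- y)) (at y)"
      by (rule DERIV_chain2)
    then show ?thesis by (simp add: mult.commute)
  qed
  have right: "Re (\<Psi> (of_real pi + \<i> * of_real y)) - sin ?A * integral {0..exp (- y)} ?k
      = Re (\<Psi> (of_real pi)) - sin ?A * integral {0..1} ?k" if y: "\<bar>y\<bar> < - ln l" for y
  proof -
    have "Re (\<Psi> (of_real pi + \<i> * of_real y)) - sin ?A * integral {0..exp (- y)} ?k
        = Re (\<Psi> (of_real pi + \<i> * of_real 0)) - sin ?A * integral {0..exp (- 0)} ?k"
    proof (rule DERIV_isconst3[of "ln l" "- ln l" _ _ "\<lambda>y. Re (\<Psi> (of_real pi + \<i> * of_real y)) - sin ?A * integral {0..exp (- y)} ?k"])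
      show "ln l < - ln l" using L by linarith
      fix y assume "y \<in> {ln l<..<- ln l}"
      then have y: "\<bar>y\<bar> < - ln l" by auto
      have R: "Re (\<i> * ?F (of_real pi + \<i> * of_real y)) = - sin ?A * (exp (- y) * ?k (exp (- y)))"
        unfolding integrand_on_cut[OF l(1) y] by simp
      have "((\<lambda>y. Re (\<Psi> (of_real pi + \<i> * of_real y)) - sin ?A * integral {0..exp (- y)} ?k) has_field_derivative
          Re (\<i> * ?F (of_real pi + \<i> * of_real y)) - sin ?A * - (exp (- y) * ?k (exp (- y)))) (at y)"
        by (intro DERIV_diff DERIV_cmult deriv_Re y cut)
      then show "((\<lambda>y. Re (\<Psi> (of_real pi + \<i> * of_real y)) - sin ?A * integral {0..exp (- y)} ?k) has_field_derivative 0) (at y)"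
        unfolding R by simp
    qed (use y L in auto)
    then show ?thesis by simp
  qed
  have mid: "Re (integral {0..pi} (\<lambda>t. ?F (of_real t))) = Re (\<Psi> (of_real pi)) - Re (\<Psi> 0)"
  proof -
    have "((\<lambda>s. ?F (0 + of_real s * 1) * 1) has_integral (\<Psi> (0 + of_real pi * 1) - \<Psi> 0)) {0..pi}"
      by (rule has_integral_primitive_on_ray[OF _ _ \<Psi>, where S = "strip l"]) (use L in \<open>auto simp: strip_def\<close>)
    then show ?thesis by (simp add: integral_unique)
  qed
  show ?thesis
  proof (intro exI[of _ \<Psi>] conjI ballI allI impI \<Psi>)
    fix y y' assume y: "\<bar>y\<bar> < - ln l" "\<bar>y'\<bar> < - ln l"
    show "Re (\<Psi> (of_real pi + \<i> * of_real y) - \<Psi> (\<i> * of_real y'))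
        - sin ?A * integral {0..exp (- y)} ?k = pi * ((1 - l\<^sup>2) powr \<beta> * scaled_jacobi a \<alpha> \<beta> l n)"
      using jacobi_arc_formula(2)[OF l pos, of \<beta>] right[OF y(1)] left[OF y(2)] mid by simp
  qed
qed

section \<open>Derivatives of the phase\<close>

text \<open>
  One constant serves for all centres \<open>w\<close> in the compact set. This uniformity allows tilting the
  contour by an amount that is the same at all its points.
\<close>

lemma Taylor_bound_compact:
  assumes f: "f holomorphic_on S" and S: "open S" and K: "compact K" "convex K" "K \<subseteq> S"
  shows "\<exists>M\<ge>0. \<forall>w\<in>K. \<forall>z\<in>K.
    norm (f z - (\<Sum>i\<le>n. (deriv ^^ i) f w * (z - w) ^ i / fact i)) \<le> M * norm (z - w) ^ Suc n"
proof -
  have hol: "(deriv ^^ i) f holomorphic_on S" for i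
    by (rule holomorphic_higher_deriv[OF f S])
  have "compact ((deriv ^^ Suc n) f ` K)"
    by (rule compact_continuous_image[OF _ K(1)])
       (rule continuous_on_subset[OF holomorphic_on_imp_continuous_on[OF hol] K(3)])
  then obtain B where B: "\<And>z. z \<in> K \<Longrightarrow> norm ((deriv ^^ Suc n) f z) \<le> B" "B \<ge> 0"
    by (metis bounded_pos compact_imp_bounded image_eqI less_imp_le)
  show ?thesis
  proof (intro exI conjI ballI)
    show "B / fact n \<ge> 0" using B by simp
    fix w z assume wz: "w \<in> K" "z \<in> K"
    have "norm ((deriv ^^ 0) f z - (\<Sum>i\<le>n. (deriv ^^ i) f w * (z - w) ^ i / fact i)) \<le> B * norm (z - w) ^ Suc n / fact n"
    proof (rule complex_Taylor[where f = "\<lambda>i. (deriv ^^ i) f", OF K(2) _ B(1) wz])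
      fix i x assume "x \<in> K"
      then have "((deriv ^^ i) f has_field_derivative deriv ((deriv ^^ i) f) x) (at x)"
        using K(3) by (intro holomorphic_derivI[OF hol S]) auto
      then show "((deriv ^^ i) f has_field_derivative (deriv ^^ Suc i) f x) (at x within K)"
        by (simp add: has_field_derivative_at_within)
    qed
    then show "norm (f z - (\<Sum>i\<le>n. (deriv ^^ i) f w * (z - w) ^ i / fact i)) \<le> B / fact n * norm (z - w) ^ Suc n"
      by (simp add: mult_ac)
  qed
qed

text \<open>
  The denominator of the Poisson kernel; on the real line it is
  \<open>\<bar>1 - l exp (\<i> w)\<bar>^2\<close>.
\<close>

definition kernel :: "real \<Rightarrow> complex \<Rightarrow> complex" where
  "kernel l w = 1 + of_real l ^ 2 - 2 * of_real l * cos w"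

lemma kernel_factor: "kernel l w = (1 - of_real l * exp (\<i> * w)) * (1 - of_real l * exp (- (\<i> * w)))"
proof -
  have "cos w = (exp (\<i> * w) + exp (- (\<i> * w))) / 2"
    by (simp add: cos_exp_eq)
  moreover have "exp (\<i> * w) * exp (- (\<i> * w)) = 1" by (simp flip: exp_add)
  ultimately show ?thesis
    unfolding kernel_def by (simp add: algebra_simps power2_eq_square)
qed

lemma kernel_nonzero: "0 < l \<Longrightarrow> w \<in> strip l \<Longrightarrow> kernel l w \<noteq> 0"
  unfolding kernel_factor using one_minus_not_nonpos(3,4) by simp

lemma has_field_derivative_phase:
  assumes l: "0 < l" and w: "w \<in> strip l"
  shows "(phase a l has_field_derivative \<i> * (of_real a + 1 - (1 - of_real l ^ 2) / kernel l w)) (at w)"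
proof -
  note nz = one_minus_not_nonpos[OF l w]
  define E where "E = exp (\<i> * w)"
  define E' where "E' = exp (- (\<i> * w))"
  have EE: "E * E' = 1" by (simp add: E_def E'_def flip: exp_add)
  define X where "X = 1 - of_real l * E"
  define Y where "Y = 1 - of_real l * E'"
  have XY: "X \<noteq> 0" "Y \<noteq> 0" using nz(3,4) by (simp_all only: X_def Y_def E_def E'_def not_False_eq_True)
  have 1: "((\<lambda>w. Ln (1 - of_real l * exp (\<i> * w))) has_field_derivative - (of_real l * \<i> * E) / X) (at w)"
    using nz(1) XY(1) unfolding X_def E_def
    by (auto intro!: derivative_eq_intros simp: field_simps)
  have 2: "((\<lambda>w. Ln (1 - of_real l * exp (- (\<i> * w)))) has_field_derivative (of_real l * \<i> * E') / Y) (at w)"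
    using nz(2) XY(2) unfolding Y_def E'_def
    by (auto intro!: derivative_eq_intros simp: field_simps)
  have 3: "((\<lambda>w. \<i> * of_real a * w) has_field_derivative \<i> * of_real a) (at w)"
    by (auto intro!: derivative_eq_intros)
  have "(phase a l has_field_derivative \<i> * of_real a + - (of_real l * \<i> * E) / X - (of_real l * \<i> * E') / Y) (at w)"
    unfolding phase_def[abs_def] by (intro DERIV_add DERIV_diff 1 2 3)
  moreover have "\<i> * of_real a + - (of_real l * \<i> * E) / X - (of_real l * \<i> * E') / Y
      = \<i> * (of_real a + 1 - (1 - of_real l ^ 2) / kernel l w)"
  proof -
    have k: "kernel l w = X * Y" by (simp add: kernel_factor X_def Y_def E_def E'_def)
    have "X * Y - (1 - of_real l ^ 2) + of_real l * E * Y + of_real l * E' * X = 0"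
    proof -
      have "X * Y - (1 - of_real l ^ 2) + of_real l * E * Y + of_real l * E' * X = of_real l ^ 2 * (1 - E * E')"
        by (simp add: X_def Y_def algebra_simps power2_eq_square)
      then show ?thesis using EE by simp
    qed
    then have "1 - of_real l ^ 2 = X * Y + of_real l * E * Y + of_real l * E' * X" by algebra
    then have "(1 - of_real l ^ 2) / (X * Y) = 1 + of_real l * E / X + of_real l * E' / Y"
      using XY by (simp add: add_divide_distrib)
    then show ?thesis unfolding k by (simp add: algebra_simps)
  qed
  ultimately show ?thesis by simp
qed

lemma deriv_phase:
  assumes "0 < l" "w \<in> strip l"
  shows "deriv (phase a l) w = \<i> * (of_real a + 1 - (1 - of_real l ^ 2) / kernel l w)"
  by (rule DERIV_imp_deriv[OF has_field_derivative_phase[OF assms]])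

lemma deriv2_phase:
  assumes l: "0 < l" and w: "w \<in> strip l"
  shows "(deriv ^^ 2) (phase a l) w = \<i> * (1 - of_real l ^ 2) * (2 * of_real l * sin w) / kernel l w ^ 2"
proof -
  have "deriv (deriv (phase a l)) w = deriv (\<lambda>w. \<i> * (of_real a + 1 - (1 - of_real l ^ 2) / kernel l w)) w"
    by (rule deriv_cong_ev[OF eventually_mono[OF eventually_nhds_in_open[OF open_strip w]]])
       (use deriv_phase[OF l] in auto)
  also have "\<dots> = \<i> * (1 - of_real l ^ 2) * (2 * of_real l * sin w) / kernel l w ^ 2"
  proof (rule DERIV_imp_deriv)
    have "(kernel l has_field_derivative 2 * of_real l * sin w) (at w)"
      unfolding kernel_def[abs_def] by (auto intro!: derivative_eq_intros)
    then show "((\<lambda>w. \<i> * (of_real a + 1 - (1 - of_real l ^ 2) / kernel l w)) has_field_derivative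
        \<i> * (1 - of_real l ^ 2) * (2 * of_real l * sin w) / kernel l w ^ 2) (at w)"
      using kernel_nonzero[OF l w] by (auto intro!: derivative_eq_intros simp: power2_eq_square)
  qed
  finally show ?thesis by (simp add: numeral_2_eq_2)
qed

text \<open>
  A saddle is cubic where the second derivative vanishes, that is at \<open>sin w = 0\<close>; there the
  derivative of the denominator drops out.
\<close>

lemma deriv3_phase:
  assumes l: "0 < l" and w: "w \<in> strip l" and s: "sin w = 0"
  shows "(deriv ^^ 3) (phase a l) w = \<i> * (1 - of_real l ^ 2) * (2 * of_real l * cos w) / kernel l w ^ 2"
proof -
  have "deriv ((deriv ^^ 2) (phase a l)) w = deriv (\<lambda>w. \<i> * (1 - of_real l ^ 2) * (2 * of_real l * sin w) / kernel l w ^ 2) w"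
    by (rule deriv_cong_ev[OF eventually_mono[OF eventually_nhds_in_open[OF open_strip w]]])
       (use deriv2_phase[OF l] in auto)
  also have "\<dots> = \<i> * (1 - of_real l ^ 2) * (2 * of_real l * cos w) / kernel l w ^ 2"
  proof (rule DERIV_imp_deriv)
    have k: "kernel l w \<noteq> 0" by (rule kernel_nonzero[OF l w])
    have 1: "((\<lambda>w. \<i> * (1 - of_real l ^ 2) * (2 * of_real l * sin w)) has_field_derivative \<i> * (1 - of_real l ^ 2) * (2 * of_real l * cos w)) (at w)"
      by (auto intro!: derivative_eq_intros)
    have 2: "((\<lambda>w. kernel l w ^ 2) has_field_derivative 2 * (2 * of_real l * sin w) * kernel l w) (at w)"
      unfolding kernel_def by (auto intro!: derivative_eq_intros)
    show "((\<lambda>w. \<i> * (1 - of_real l ^ 2) * (2 * of_real l * sin w) / kernel l w ^ 2) has_field_derivative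
       \<i> * (1 - of_real l ^ 2) * (2 * of_real l * cos w) / kernel l w ^ 2) (at w)"
      using DERIV_divide[OF 1 2] k unfolding s by (simp add: power2_eq_square)
  qed
  finally show ?thesis by (simp add: numeral_3_eq_3 numeral_2_eq_2)
qed

text \<open>
  The speed at which the argument of \<open>exp phase\<close> turns as \<open>z\<close> runs through the unit
  circle. Its zeros are the saddle points; it increases on \<open>[0, pi]\<close> from
  \<open>a - 2l/(1-l)\<close> to \<open>a + 2l/(1+l)\<close>, and the sign of these two numbers separates
  the regimes of the theorem.
\<close>

definition slope :: "real \<Rightarrow> real \<Rightarrow> real \<Rightarrow> real" where
  "slope a l \<phi> = a + 1 - (1 - l\<^sup>2) / (1 + l\<^sup>2 - 2 * l * cos \<phi>)"

lemma kernel_of_real: "kernel l (of_real \<phi>) = of_real (1 + l\<^sup>2 - 2 * l * cos \<phi>)"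
  by (simp add: kernel_def cos_of_real)

lemma real_in_strip: "0 < l \<Longrightarrow> l < 1 \<Longrightarrow> of_real \<phi> \<in> strip l"
  by (simp add: strip_def)

lemma deriv_phase_real:
  assumes "0 < l" "l < 1"
  shows "deriv (phase a l) (of_real \<phi>) = \<i> * of_real (slope a l \<phi>)"
  using deriv_phase[OF assms(1) real_in_strip[OF assms], of a \<phi>]
  by (simp add: kernel_of_real slope_def)

lemma deriv2_phase_real:
  assumes "0 < l" "l < 1"
  shows "(deriv ^^ 2) (phase a l) (of_real \<phi>)
     = \<i> * of_real ((1 - l\<^sup>2) * (2 * l * sin \<phi>) / (1 + l\<^sup>2 - 2 * l * cos \<phi>)\<^sup>2)"
  using deriv2_phase[OF assms(1) real_in_strip[OF assms], of a \<phi>]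
  by (simp add: kernel_of_real sin_of_real)

lemma deriv3_phase_real:
  assumes "0 < l" "l < 1" "sin \<phi> = 0"
  shows "(deriv ^^ 3) (phase a l) (of_real \<phi>)
     = \<i> * of_real ((1 - l\<^sup>2) * (2 * l * cos \<phi>) / (1 + l\<^sup>2 - 2 * l * cos \<phi>)\<^sup>2)"
  using deriv3_phase[OF assms(1) real_in_strip[OF assms(1,2)], of \<phi> a] assms(3)
  by (simp add: kernel_of_real sin_of_real cos_of_real)

text \<open>
  On the unit circle \<open>1 - l / z\<close> is conjugate to \<open>1 - l z\<close>, so
  \<open>exp phase\<close> has modulus one.
\<close>

lemma Re_phase_real:
  assumes "0 < l" "l < 1"
  shows "Re (phase a l (of_real \<phi>)) = 0"
proof -
  note nz = one_minus_not_nonpos(3,4)[OF assms(1) real_in_strip[OF assms], of \<phi>]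
  have "1 - of_real l * exp (- (\<i> * of_real \<phi>)) = cnj (1 - of_real l * exp (\<i> * of_real \<phi>))"
    by (simp add: exp_cnj)
  then have "norm (1 - of_real l * exp (- (\<i> * of_real \<phi>))) = norm (1 - of_real l * exp (\<i> * complex_of_real \<phi>))"
    by (metis complex_mod_cnj)
  then show ?thesis
    using nz by (simp add: phase_def Re_Ln)
qed

text \<open>
  Leaving the unit circle changes the modulus at first order by the slope. There is no quadratic term, since
  the second derivative of the phase is purely imaginary on the real line and \<open>(\<i> \<eta>)^2\<close>
  is real; the error is therefore cubic in \<open>\<eta>\<close>. That is what makes a cubic saddle
  accessible.
\<close>

lemma Re_phase_bound:
  assumes l: "0 < l" "l < 1" and \<eta>1: "0 < \<eta>1" "\<eta>1 < - ln l"
  obtains M where "M \<ge> 0" "\<And>\<phi> \<eta>. \<lbrakk>0 \<le> \<phi>; \<phi> \<le> pi; \<bar>\<eta>\<bar> \<le> \<eta>1\<rbrakk> \<Longrightarrow>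
     \<bar>Re (phase a l (of_real \<phi> + \<i> * of_real \<eta>)) + \<eta> * slope a l \<phi>\<bar> \<le> M * \<bar>\<eta>\<bar> ^ 3"
proof -
  define K where "K = cbox (Complex 0 (- \<eta>1)) (Complex pi \<eta>1)"
  have K: "z \<in> K \<longleftrightarrow> 0 \<le> Re z \<and> Re z \<le> pi \<and> - \<eta>1 \<le> Im z \<and> Im z \<le> \<eta>1" for z
    by (auto simp: K_def in_cbox_complex_iff)
  have "K \<subseteq> strip l" using \<eta>1 K by (auto simp: strip_def)
  then obtain M where M: "M \<ge> 0" "\<And>w z. w \<in> K \<Longrightarrow> z \<in> K \<Longrightarrow>
    norm (phase a l z - (\<Sum>i\<le>2. (deriv ^^ i) (phase a l) w * (z - w) ^ i / fact i)) \<le> M * norm (z - w) ^ Suc 2"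
    using Taylor_bound_compact[OF holomorphic_phase[OF l(1), of a] open_strip, of K 2]
      compact_cbox convex_box(1) unfolding K_def by blast
  show ?thesis
  proof (rule that[OF M(1)])
    fix \<phi> \<eta> :: real assume A: "0 \<le> \<phi>" "\<phi> \<le> pi" "\<bar>\<eta>\<bar> \<le> \<eta>1"
    let ?w = "complex_of_real \<phi>" and ?z = "complex_of_real \<phi> + \<i> * of_real \<eta>"
    have "?w \<in> K" "?z \<in> K" using A \<eta>1 by (auto simp: K)
    from M(2)[OF this]
    have "\<bar>Re (phase a l ?z - (\<Sum>i\<le>2. (deriv ^^ i) (phase a l) ?w * (?z - ?w) ^ i / fact i))\<bar> \<le> M * norm (?z - ?w) ^ Suc 2"
      using abs_Re_le_cmod order_trans by blast
    moreover have s1: "(\<Sum>i\<le>2. (deriv ^^ i) (phase a l) ?w * (?z - ?w) ^ i / fact i)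
       = phase a l ?w + deriv (phase a l) ?w * (?z - ?w) + (deriv ^^ 2) (phase a l) ?w * (?z - ?w) ^ 2 / 2"
      by (simp add: numeral_2_eq_2)
    moreover have s2: "Re (phase a l ?w + deriv (phase a l) ?w * (?z - ?w) + (deriv ^^ 2) (phase a l) ?w * (?z - ?w) ^ 2 / 2)
       = - \<eta> * slope a l \<phi>"
      unfolding deriv_phase_real[OF l] deriv2_phase_real[OF l] using Re_phase_real[OF l]
      by (simp add: power_mult_distrib)
    moreover have "norm (?z - ?w) = \<bar>\<eta>\<bar>" by (simp add: norm_mult)
    ultimately show "\<bar>Re (phase a l ?z) + \<eta> * slope a l \<phi>\<bar> \<le> M * \<bar>\<eta>\<bar> ^ 3"
      unfolding s1 minus_complex.sel s2 by (simp only: numeral_3_eq_3 numeral_2_eq_2 minus_mult_left[symmetric] diff_minus_eq_add)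
  qed
qed

section \<open>Contribution of a ray issuing from a saddle\<close>

text \<open>
  The coefficient of the second term in the expansion along a ray with direction \<open>u\<close>: one part
  from the linear term of the amplitude and one from the derivative of order \<open>m + 1\<close> of the
  phase.
\<close>

definition ray_correction :: "real \<Rightarrow> real \<Rightarrow> real \<Rightarrow> real \<Rightarrow> nat \<Rightarrow> complex \<Rightarrow> complex \<Rightarrow> complex \<Rightarrow> complex" where
  "ray_correction a \<alpha> \<beta> l m c w u = deriv (amplitude \<alpha> \<beta> l) w * u * moment m c 1
     + amplitude \<alpha> \<beta> l w * ((deriv ^^ (m + 1)) (phase a l) w * u ^ (m + 1) / fact (m + 1)) * moment m c (m + 1)"

text \<open>
  At a simple saddle the two rays in the directions \<open>u\<close> and \<open>- u\<close> have opposite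
  corrections. Their cancellation lowers the error from \<open>n^(-1)\<close> to \<open>n^(-3/2)\<close>.
\<close>

lemma ray_correction_odd:
  "even m \<Longrightarrow> ray_correction a \<alpha> \<beta> l m c w (- u) = - ray_correction a \<alpha> \<beta> l m c w u"
  by (simp add: ray_correction_def)

text \<open>
  The contribution of one ray that leaves a saddle of order \<open>m\<close> and descends along its whole
  length. The direction need not be steepest, only admissible: \<open>r cis \<theta>\<close> is the
  \<open>m\<close>-th root of the leading coefficient along the ray that lies within the sector where the
  rotated model integral converges.
\<close>

lemma saddle_ray:
  assumes l: "0 < l" "l < 1" and m: "m \<ge> 1" and b: "b > 0"
    and ray: "\<And>s. s \<in> {0..b} \<Longrightarrow> w + of_real s * u \<in> strip l"
    and flat: "\<And>j. 0 < j \<Longrightarrow> j < m \<Longrightarrow> (deriv ^^ j) (phase a l) w = 0"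
    and lead: "(deriv ^^ m) (phase a l) w * u ^ m / fact m = - ((of_real r * cis \<theta>) ^ m)"
    and r: "r > 0" and \<theta>: "\<bar>real m * \<theta>\<bar> < pi / 2"
    and \<delta>: "\<delta> > 0" and decay: "\<And>s. s \<in> {0..b} \<Longrightarrow> Re (phase a l (w + of_real s * u) - phase a l w) \<le> - \<delta> * s ^ m"
  defines "c \<equiv> (of_real r * cis \<theta>) ^ m"
  shows "\<exists>C. \<forall>n\<ge>(1::nat). norm (integral {0..b} (\<lambda>s. integrand a \<alpha> \<beta> l n (w + of_real s * u))
     - exp (of_nat n * phase a l w) * (amplitude \<alpha> \<beta> l w * (of_real (Gamma (1 + 1 / real m)) / (of_real r * cis \<theta>)) * of_real (real n powr (- (1 / real m)))
         + ray_correction a \<alpha> \<beta> l m c w u * of_real (real n powr (- (2 / real m))))) \<le> C * real n powr (- (3 / real m)) * norm (exp (of_nat n * phase a l w))"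
proof -
  define \<kappa> where "\<kappa> = ray_correction a \<alpha> \<beta> l m c w u"
  define P where "P = (\<lambda>s. phase a l (w + of_real s * u) - phase a l w)"
  define G where "G = (\<lambda>s. amplitude \<alpha> \<beta> l (w + of_real s * u))"
  define d where "d = (deriv ^^ (m + 1)) (phase a l) w * u ^ (m + 1) / fact (m + 1)"
  define g1 where "g1 = deriv (amplitude \<alpha> \<beta> l) w * u"
  define K where "K = closed_segment w (w + of_real b * u)"
  have K: "w + of_real s * u \<in> K" if "s \<in> {0..b}" for s
    unfolding K_def closed_segment_def
    using that b by (intro CollectI exI[of _ "s / b"]) (auto simp: scaleR_conv_of_real field_simps)
  have w: "w \<in> K" using K[of 0] b by simp
  have K_strip: "K \<subseteq> strip l"
    unfolding K_def using ray[of 0] ray[of b] b by (intro closed_segment_subset convex_strip) auto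
  have comp: "compact K" "convex K" by (simp_all add: K_def)
  obtain M1 where M1: "M1 \<ge> 0" "\<And>z. z \<in> K \<Longrightarrow>
    norm (phase a l z - (\<Sum>i\<le>m + 1. (deriv ^^ i) (phase a l) w * (z - w) ^ i / fact i)) \<le> M1 * norm (z - w) ^ Suc (m + 1)"
    using Taylor_bound_compact[OF holomorphic_phase[OF l(1), of a] open_strip comp K_strip, of "m + 1"] w by blast
  obtain M2 where M2: "M2 \<ge> 0" "\<And>z. z \<in> K \<Longrightarrow>
    norm (amplitude \<alpha> \<beta> l z - (\<Sum>i\<le>1. (deriv ^^ i) (amplitude \<alpha> \<beta> l) w * (z - w) ^ i / fact i)) \<le> M2 * norm (z - w) ^ Suc 1"
    using Taylor_bound_compact[OF holomorphic_amplitude[OF l(1), of \<alpha> \<beta>] open_strip comp K_strip, of 1] w by blast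
  \<comment> \<open>the Taylor errors are in powers of \<open>z - w = s u\<close>; \<open>M\<close> absorbs the powers of \<open>u\<close>\<close>
  define M where "M = max (M1 * norm u ^ (m + 2)) (M2 * norm u ^ 2)"
  have Rec: "Re c > 0"
  proof -
    have "c = of_real (r ^ m) * cis (real m * \<theta>)"
      by (simp add: c_def power_mult_distrib Complex.DeMoivre)
    moreover have "cos (real m * \<theta>) > 0" by (rule cos_gt_zero_pi) (use \<theta> in auto)
    ultimately show ?thesis using r by simp
  qed
  have sumP: "(\<Sum>i\<le>m + 1. (deriv ^^ i) (phase a l) w * (of_real s * u) ^ i / fact i) = phase a l w - c * of_real (s ^ m) + d * of_real (s ^ (m + 1))" for s
  proof -
    obtain m' where m': "m = Suc m'" using m by (cases m) auto
    have "(\<Sum>i\<le>m'. (deriv ^^ i) (phase a l) w * (of_real s * u) ^ i / fact i) = (\<Sum>i\<in>{0}. (deriv ^^ i) (phase a l) w * (of_real s * u) ^ i / fact i)"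
      by (rule sum.mono_neutral_right) (use flat m' in auto)
    then have "(\<Sum>i\<le>m + 1. (deriv ^^ i) (phase a l) w * (of_real s * u) ^ i / fact i)
       = phase a l w + (deriv ^^ m) (phase a l) w * (of_real s * u) ^ m / fact m + (deriv ^^ (m + 1)) (phase a l) w * (of_real s * u) ^ (m + 1) / fact (m + 1)"
      unfolding m' by simp
    also have "(deriv ^^ m) (phase a l) w * (of_real s * u) ^ m / fact m = ((deriv ^^ m) (phase a l) w * u ^ m / fact m) * of_real (s ^ m)"
      by (simp add: power_mult_distrib)
    also have "\<dots> = - c * of_real (s ^ m)" unfolding lead c_def ..
    also have "(deriv ^^ (m + 1)) (phase a l) w * (of_real s * u) ^ (m + 1) / fact (m + 1) = d * of_real (s ^ (m + 1))"
      unfolding d_def power_mult_distrib by (simp del: power_Suc fact_Suc)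
    finally show ?thesis by simp
  qed
  have cont: "continuous_on {0..b} (\<lambda>s. f (w + of_real s * u))" if "f holomorphic_on strip l" for f
    by (rule continuous_on_compose2[OF holomorphic_on_imp_continuous_on[OF that]]) (use ray in \<open>auto intro!: continuous_intros\<close>)
  have "\<exists>C. \<forall>n\<ge>(1::nat). norm (integral {0..b} (\<lambda>s. exp (of_nat n * P s) * G s)
           - (amplitude \<alpha> \<beta> l w * moment m c 0 * of_real (real n powr (- (1 / real m)))
              + (g1 * moment m c 1 + amplitude \<alpha> \<beta> l w * d * moment m c (m + 1)) * of_real (real n powr (- (2 / real m)))))
         \<le> C * real n powr (- (3 / real m))"
  proof (rule laplace_ray[OF m b])
    show "min \<delta> (Re c) > 0" "min \<delta> (Re c) \<le> Re c" using \<delta> Rec by auto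
    show "continuous_on {0..b} P" "continuous_on {0..b} G"
      unfolding P_def G_def by (intro continuous_intros cont holomorphic_phase holomorphic_amplitude l)+
    fix s assume s: "s \<in> {0..b}"
    have ns: "norm (of_real s * u) = s * norm u" using s by (simp add: norm_mult)
    have "norm (P s + c * of_real (s ^ m) - d * of_real (s ^ (m + 1))) \<le> M1 * (s * norm u) ^ Suc (m + 1)"
      using M1(2)[OF K[OF s]] unfolding add_diff_cancel_left' sumP ns P_def by (simp add: algebra_simps)
    also have "\<dots> = (M1 * norm u ^ (m + 2)) * s ^ (m + 2)" by (simp add: power_mult_distrib)
    also have "\<dots> \<le> M * s ^ (m + 2)" using s by (intro mult_right_mono) (auto simp: M_def)
    finally show "norm (P s + c * of_real (s ^ m) - d * of_real (s ^ (m + 1))) \<le> M * s ^ (m + 2)" .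
    have "norm (G s - amplitude \<alpha> \<beta> l w - g1 * of_real s) \<le> M2 * (s * norm u) ^ Suc 1"
      using M2(2)[OF K[OF s]] unfolding add_diff_cancel_left' ns G_def g1_def by (simp add: algebra_simps)
    also have "\<dots> = (M2 * norm u ^ 2) * s ^ 2" by (simp add: power2_eq_square)
    also have "\<dots> \<le> M * s ^ 2" using s by (intro mult_right_mono) (auto simp: M_def)
    finally show "norm (G s - amplitude \<alpha> \<beta> l w - g1 * of_real s) \<le> M * s ^ 2" .
    have "min \<delta> (Re c) * s ^ m \<le> \<delta> * s ^ m" using s by (intro mult_right_mono) auto
    then show "Re (P s) \<le> - min \<delta> (Re c) * s ^ m" using decay[OF s] by (simp add: P_def)
  qed
  then obtain C where C: "\<And>n. n \<ge> (1::nat) \<Longrightarrow> norm (integral {0..b} (\<lambda>s. exp (of_nat n * P s) * G s)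
           - (amplitude \<alpha> \<beta> l w * moment m c 0 * of_real (real n powr (- (1 / real m))) + \<kappa> * of_real (real n powr (- (2 / real m)))))
         \<le> C * real n powr (- (3 / real m))"
    unfolding \<kappa>_def ray_correction_def d_def g1_def by blast
  have m0: "moment m c 0 = of_real (Gamma (1 + 1 / real m)) / (of_real r * cis \<theta>)"
    unfolding c_def by (rule moment_0_eq[OF m \<theta> r])
  show ?thesis
    unfolding \<kappa>_def[symmetric]
  proof (intro exI allI impI)
    fix n :: nat assume n: "n \<ge> 1"
    have "integral {0..b} (\<lambda>s. integrand a \<alpha> \<beta> l n (w + of_real s * u)) = integral {0..b} (\<lambda>s. exp (of_nat n * phase a l w) * (exp (of_nat n * P s) * G s))"
      by (simp add: integrand_def P_def G_def algebra_simps exp_diff)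
    also have "\<dots> = exp (of_nat n * phase a l w) * integral {0..b} (\<lambda>s. exp (of_nat n * P s) * G s)"
      by simp
    finally have eq: "integral {0..b} (\<lambda>s. integrand a \<alpha> \<beta> l n (w + of_real s * u)) = \<dots>" .
    show "norm (integral {0..b} (\<lambda>s. integrand a \<alpha> \<beta> l n (w + of_real s * u))
     - exp (of_nat n * phase a l w) * (amplitude \<alpha> \<beta> l w * (of_real (Gamma (1 + 1 / real m)) / (of_real r * cis \<theta>)) * of_real (real n powr (- (1 / real m)))
         + \<kappa> * of_real (real n powr (- (2 / real m))))) \<le> C * real n powr (- (3 / real m)) * norm (exp (of_nat n * phase a l w))"
      unfolding eq right_diff_distrib[symmetric] norm_mult m0[symmetric]
      using mult_left_mono[OF C[OF n] norm_ge_zero[of "exp (of_nat n * phase a l w)"]]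
      by (simp only: mult.commute)
  qed
qed

text \<open>
  At a saddle with leading coefficient \<open>\<i> K\<close> the direction
  \<open>1 + \<i> \<epsilon>\<close> of a slightly tilted horizontal line is admissible. It lies between
  the direction \<open>1\<close>, where the phase oscillates, and the next ray at angle
  \<open>pi / m\<close> with the same property, with steepest descent half way between.
\<close>

lemma admissible_direction:
  fixes K \<epsilon> :: real
  assumes m: "m = 2 \<or> m = (3::nat)" and K: "K > 0" and \<epsilon>: "0 < \<epsilon>" "\<epsilon> \<le> 1"
  defines "u \<equiv> 1 + \<i> * of_real \<epsilon>"
  obtains r \<theta> where "r > 0" "\<bar>real m * \<theta>\<bar> < pi / 2"
    "of_real r * cis \<theta> = of_real (root m K) * cis (- (pi / (2 * real m))) * u"
    "(of_real r * cis \<theta>) ^ m = - \<i> * of_real K * u ^ m"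
proof -
  define \<tau> where "\<tau> = arctan \<epsilon>"
  define q where "q = sqrt (1 + \<epsilon>\<^sup>2)"
  have q: "q > 0" by (simp add: q_def add_pos_nonneg)
  have u: "u = of_real q * cis \<tau>"
  proof (rule complex_eqI)
    show "Re u = Re (of_real q * cis \<tau>)" using q by (simp add: u_def \<tau>_def cos_arctan q_def)
    show "Im u = Im (of_real q * cis \<tau>)" using q by (simp add: u_def \<tau>_def sin_arctan q_def)
  qed
  have \<tau>: "0 < \<tau>" "\<tau> \<le> pi / 4"
    using \<epsilon> arctan_le_iff[of \<epsilon> 1] by (simp_all add: \<tau>_def arctan_one)
  have m0: "0 < m" using m by auto
  have rK: "root m K > 0" using K m0 by simp
  define r where "r = root m K * q"
  define \<theta> where "\<theta> = - (pi / (2 * real m)) + \<tau>"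
  have eq: "of_real r * cis \<theta> = of_real (root m K) * cis (- (pi / (2 * real m))) * u"
    unfolding r_def \<theta>_def u by (simp add: cis_mult)
  show ?thesis
  proof (rule that[OF _ _ eq])
    show "r > 0" using rK q by (simp add: r_def)
    show "\<bar>real m * \<theta>\<bar> < pi / 2" 
    proof -
      have "real m * \<theta> = - (pi / 2) + real m * \<tau>" using m0 by (simp add: \<theta>_def field_simps)
      moreover have "0 < real m * \<tau>" "real m * \<tau> < pi" using m \<tau> pi_gt_zero by auto
      ultimately show ?thesis by linarith
    qed
    have "(of_real (root m K)) ^ m = complex_of_real K"
      using K m0 by (simp flip: of_real_power)
    moreover have "cis (- (pi / (2 * real m))) ^ m = - \<i>"
      using m0 by (simp add: Complex.DeMoivre)
    ultimately show "(of_real r * cis \<theta>) ^ m = - \<i> * of_real K * u ^ m"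
      unfolding eq by (simp add: power_mult_distrib)
  qed
qed

section \<open>Contours of descent\<close>

lemma half_le_sin:
  assumes "0 \<le> x" "x \<le> pi / 2"
  shows "x / 2 \<le> sin x"
proof -
  define y where "y = x / 2"
  have y: "0 \<le> y" "y \<le> pi / 4" using assms by (auto simp: y_def)
  have c: "cos y > 0" by (rule cos_gt_zero_pi) (use y pi_gt_zero in linarith)+
  have "\<bar>y\<bar> \<le> \<bar>tan y\<bar>" by (rule abs_tan_ge) (use y pi_gt_zero in linarith)
  moreover have "0 \<le> tan y" using y pi_gt_zero c sin_ge_zero[of y] by (simp add: tan_def)
  ultimately have "y \<le> tan y" using y by simp
  then have s: "y * cos y \<le> sin y" using c by (simp add: tan_def pos_le_divide_eq)
  have "cos (pi / 4) \<le> cos y" by (rule cos_monotone_0_pi_le) (use y pi_gt_zero in linarith)+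
  then have "(sqrt 2 / 2)\<^sup>2 \<le> (cos y)\<^sup>2" by (intro power_mono) (auto simp: cos_45)
  then have "1 / 2 \<le> (cos y)\<^sup>2" by (simp add: power_divide)
  then have "y * (1 / 2) \<le> y * (cos y)\<^sup>2" using y by (intro mult_left_mono) auto
  also have "\<dots> \<le> sin y * cos y"
    using mult_right_mono[OF s, of "cos y"] c by (simp add: power2_eq_square)
  finally have "y \<le> 2 * (sin y * cos y)" by simp
  also have "\<dots> = sin (2 * y)" by (simp add: sin_double)
  finally show ?thesis by (simp add: y_def)
qed

lemma mult_sin_half_ge:
  assumes "\<bar>d\<bar> \<le> pi"
  shows "d\<^sup>2 / 4 \<le> d * sin (d / 2)"
proof (cases "d \<ge> 0")
  case True
  then have "d * (d / 4) \<le> d * sin (d / 2)"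
    using half_le_sin[of "d / 2"] assms by (intro mult_left_mono) auto
  then show ?thesis by (simp add: power2_eq_square)
next
  case False
  then have "(- d) * (- d / 4) \<le> (- d) * sin (- d / 2)"
    using half_le_sin[of "- d / 2"] assms by (intro mult_left_mono) auto
  then show ?thesis by (simp add: power2_eq_square)
qed

text \<open>
  By \<open>cos x - cos y = 2 sin ((x+y)/2) sin ((y-x)/2)\<close> the gap is a product; the first
  sine is bounded below on \<open>[0, pi]\<close> because the saddle is not an end point.
\<close>

lemma cos_gap_interior:
  assumes "0 < \<phi>0" "\<phi>0 < pi"
  shows "\<exists>\<kappa>>0. \<forall>\<phi>\<in>{0..pi}. \<kappa> * \<bar>\<phi> - \<phi>0\<bar> ^ 2 \<le> (\<phi> - \<phi>0) * (cos \<phi>0 - cos \<phi>)"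
proof -
  define \<mu> where "\<mu> = min (sin (\<phi>0 / 2)) (cos (\<phi>0 / 2))"
  have \<mu>: "\<mu> > 0" unfolding \<mu>_def using assms by (auto intro!: sin_gt_zero cos_gt_zero_pi)
  have sin_ge: "\<mu> \<le> sin ((\<phi>0 + \<phi>) / 2)" if \<phi>: "\<phi> \<in> {0..pi}" for \<phi>
  proof (cases "(\<phi>0 + \<phi>) / 2 \<le> pi / 2")
    case True
    have "sin (\<phi>0 / 2) \<le> sin ((\<phi>0 + \<phi>) / 2)"
      by (rule sin_monotone_2pi_le) (use True assms \<phi> in auto)
    then show ?thesis by (simp add: \<mu>_def)
  next
    case False
    have "sin (pi / 2 - \<phi>0 / 2) \<le> sin (pi - (\<phi>0 + \<phi>) / 2)"
      by (rule sin_monotone_2pi_le) (use False assms \<phi> in \<open>auto simp: field_simps\<close>)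
    then have "cos (\<phi>0 / 2) \<le> sin ((\<phi>0 + \<phi>) / 2)" by (simp add: sin_diff)
    then show ?thesis by (simp add: \<mu>_def)
  qed
  show ?thesis
  proof (intro exI conjI ballI)
    show "\<mu> / 2 > 0" using \<mu> by simp
    fix \<phi> assume \<phi>: "\<phi> \<in> {0..pi}"
    have d: "(\<phi> - \<phi>0)\<^sup>2 / 4 \<le> (\<phi> - \<phi>0) * sin ((\<phi> - \<phi>0) / 2)"
      by (rule mult_sin_half_ge) (use assms \<phi> in auto)
    have "\<mu> / 2 * \<bar>\<phi> - \<phi>0\<bar> ^ 2 = 2 * \<mu> * ((\<phi> - \<phi>0)\<^sup>2 / 4)" by simp
    also have "\<dots> \<le> 2 * sin ((\<phi>0 + \<phi>) / 2) * ((\<phi> - \<phi>0) * sin ((\<phi> - \<phi>0) / 2))"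
      using sin_ge[OF \<phi>] \<mu> d by (intro mult_mono) auto
    also have "\<dots> = (\<phi> - \<phi>0) * (cos \<phi>0 - cos \<phi>)"
      by (simp add: cos_diff_cos)
    finally show "\<mu> / 2 * \<bar>\<phi> - \<phi>0\<bar> ^ 2 \<le> (\<phi> - \<phi>0) * (cos \<phi>0 - cos \<phi>)" .
  qed
qed

lemma one_minus_cos_ge:
  assumes "\<bar>x\<bar> \<le> pi"
  shows "x\<^sup>2 / 8 \<le> 1 - cos x"
proof -
  have "\<bar>x\<bar> / 4 \<le> sin (\<bar>x\<bar> / 2)" using half_le_sin[of "\<bar>x\<bar> / 2"] assms by simp
  then have "(\<bar>x\<bar> / 4)\<^sup>2 \<le> (sin (\<bar>x\<bar> / 2))\<^sup>2" by (intro power_mono) auto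
  moreover have "cos (2 * (\<bar>x\<bar> / 2)) = 1 - 2 * (sin (\<bar>x\<bar> / 2))\<^sup>2" by (rule cos_double_sin)
  ultimately show ?thesis by (simp add: power_divide)
qed

text \<open>
  The cosine is stationary at \<open>0\<close> and \<open>pi\<close>, so the gap is of third order there
  instead of second. This is the analytic source of the exponent \<open>1/3\<close> at the two boundary values
  of \<open>a\<close>.
\<close>

lemma cos_gap_endpoint:
  assumes "\<phi>0 = 0 \<or> \<phi>0 = pi"
  shows "\<exists>\<kappa>>0. \<forall>\<phi>\<in>{0..pi}. \<kappa> * \<bar>\<phi> - \<phi>0\<bar> ^ 3 \<le> (\<phi> - \<phi>0) * (cos \<phi>0 - cos \<phi>)"
proof (intro exI conjI ballI)
  show "(1 / 8 :: real) > 0" by simp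
  fix \<phi> :: real assume \<phi>: "\<phi> \<in> {0..pi}"
  have "(\<phi> - \<phi>0)\<^sup>2 / 8 \<le> 1 - cos (\<phi> - \<phi>0)" by (rule one_minus_cos_ge) (use assms \<phi> in auto)
  then have "\<bar>\<phi> - \<phi>0\<bar> * ((\<phi> - \<phi>0)\<^sup>2 / 8) \<le> \<bar>\<phi> - \<phi>0\<bar> * (1 - cos (\<phi> - \<phi>0))" by (intro mult_left_mono) auto
  also have "\<bar>\<phi> - \<phi>0\<bar> * (1 - cos (\<phi> - \<phi>0)) = (\<phi> - \<phi>0) * (cos \<phi>0 - cos \<phi>)"
    using assms \<phi> by (auto simp: cos_diff algebra_simps)
  finally show "1 / 8 * \<bar>\<phi> - \<phi>0\<bar> ^ 3 \<le> (\<phi> - \<phi>0) * (cos \<phi>0 - cos \<phi>)"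
    by (simp add: numeral_3_eq_3 power2_eq_square)
qed

lemma kernel_real_bounds:
  fixes l \<phi> :: real
  assumes "0 < l" "l < 1"
  shows "(1 - l)\<^sup>2 \<le> 1 + l\<^sup>2 - 2 * l * cos \<phi>" "1 + l\<^sup>2 - 2 * l * cos \<phi> \<le> (1 + l)\<^sup>2"
    "0 < 1 + l\<^sup>2 - 2 * l * cos \<phi>"
proof -
  have 1: "l * cos \<phi> \<le> l * 1" "l * (- 1) \<le> l * cos \<phi>" using mult_left_mono[of "cos \<phi>" 1 l] mult_left_mono[of "- 1" "cos \<phi>" l] assms by simp_all
  show a: "(1 - l)\<^sup>2 \<le> 1 + l\<^sup>2 - 2 * l * cos \<phi>" and "1 + l\<^sup>2 - 2 * l * cos \<phi> \<le> (1 + l)\<^sup>2"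
    using 1 by (simp_all add: power2_diff power2_sum)
  have "0 < (1 - l)\<^sup>2" using assms by simp
  with a show "0 < 1 + l\<^sup>2 - 2 * l * cos \<phi>" by linarith
qed

text \<open>
  When \<open>slope a l \<phi>0 = 0\<close>, the slope at \<open>\<phi>\<close> is a positive and bounded
  multiple of \<open>cos \<phi>0 - cos \<phi>\<close>, which transfers the gap from the cosine to the
  slope.
\<close>

lemma slope_gap:
  assumes l: "0 < l" "l < 1" and s0: "slope a l \<phi>0 = 0"
    and gap: "\<exists>\<kappa>>0. \<forall>\<phi>\<in>{0..pi}. \<kappa> * \<bar>\<phi> - \<phi>0\<bar> ^ m \<le> (\<phi> - \<phi>0) * (cos \<phi>0 - cos \<phi>)"
  shows "\<exists>\<kappa>>0. \<forall>\<phi>\<in>{0..pi}. \<kappa> * \<bar>\<phi> - \<phi>0\<bar> ^ m \<le> (\<phi> - \<phi>0) * slope a l \<phi>"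
proof -
  obtain \<kappa> where \<kappa>: "\<kappa> > 0" "\<And>\<phi>. \<phi> \<in> {0..pi} \<Longrightarrow> \<kappa> * \<bar>\<phi> - \<phi>0\<bar> ^ m \<le> (\<phi> - \<phi>0) * (cos \<phi>0 - cos \<phi>)"
    using gap by blast
  define D where "D = (\<lambda>\<phi>. 1 + l\<^sup>2 - 2 * l * cos \<phi>)"
  have D: "D \<phi> > 0" "D \<phi> \<le> (1 + l)\<^sup>2" for \<phi> using kernel_real_bounds[OF l] by (auto simp: D_def)
  have l2: "1 - l\<^sup>2 > 0" using l by (simp add: abs_square_less_1)
  have slope: "slope a l \<phi> = (1 - l\<^sup>2) * (2 * l) / (D \<phi> * D \<phi>0) * (cos \<phi>0 - cos \<phi>)" for \<phi>
  proof -
    have "slope a l \<phi> = (1 - l\<^sup>2) / D \<phi>0 - (1 - l\<^sup>2) / D \<phi>"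
      using s0 by (simp add: slope_def D_def)
    also have "\<dots> = (1 - l\<^sup>2) * (D \<phi> - D \<phi>0) / (D \<phi> * D \<phi>0)"
      using D(1)[of \<phi>] D(1)[of \<phi>0] by (simp add: field_simps)
    also have "D \<phi> - D \<phi>0 = 2 * l * (cos \<phi>0 - cos \<phi>)" by (simp add: D_def algebra_simps)
    finally show ?thesis by simp
  qed
  define q where "q = (1 - l\<^sup>2) * (2 * l) / ((1 + l)\<^sup>2 * (1 + l)\<^sup>2)"
  have q: "q > 0" using l l2 by (simp add: q_def)
  have qle: "q \<le> (1 - l\<^sup>2) * (2 * l) / (D \<phi> * D \<phi>0)" for \<phi>
    unfolding q_def using D[of \<phi>] D[of \<phi>0] l l2 by (intro divide_left_mono mult_mono) auto
  show ?thesis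
  proof (intro exI conjI ballI)
    show "q * \<kappa> > 0" using q \<kappa> by simp
    fix \<phi> assume \<phi>: "\<phi> \<in> {0..pi}"
    have "0 \<le> \<kappa> * \<bar>\<phi> - \<phi>0\<bar> ^ m" using \<kappa> by simp
    then have n: "0 \<le> (\<phi> - \<phi>0) * (cos \<phi>0 - cos \<phi>)" using \<kappa>(2)[OF \<phi>] by linarith
    have "q * \<kappa> * \<bar>\<phi> - \<phi>0\<bar> ^ m \<le> q * ((\<phi> - \<phi>0) * (cos \<phi>0 - cos \<phi>))"
      using \<kappa>(2)[OF \<phi>] q by (simp add: mult.assoc)
    also have "\<dots> \<le> (1 - l\<^sup>2) * (2 * l) / (D \<phi> * D \<phi>0) * ((\<phi> - \<phi>0) * (cos \<phi>0 - cos \<phi>))"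
      using qle n by (rule mult_right_mono)
    also have "\<dots> = (\<phi> - \<phi>0) * slope a l \<phi>" unfolding slope by simp
    finally show "q * \<kappa> * \<bar>\<phi> - \<phi>0\<bar> ^ m \<le> (\<phi> - \<phi>0) * slope a l \<phi>" .
  qed
qed

text \<open>
  The descent contour is a straight line through the saddle with a small inclination
  \<open>\<epsilon>\<close>. The first order term \<open>- \<epsilon> (\<phi> - \<phi>0) slope\<close> is
  negative by the gap, and the error, cubic in \<open>\<epsilon> (\<phi> - \<phi>0)\<close>, is smaller by
  a factor \<open>\<epsilon>^2\<close> for \<open>m = 3\<close> as well as for \<open>m = 2\<close>. So a
  single line descends on both sides of the saddle all the way, and steepest descent paths are avoided.
\<close>

lemma tilted_line:
  assumes l: "0 < l" "l < 1" and \<phi>0: "0 \<le> \<phi>0" "\<phi>0 \<le> pi" and m: "m = 2 \<or> m = 3"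
    and gap: "\<exists>\<kappa>>0. \<forall>\<phi>\<in>{0..pi}. \<kappa> * \<bar>\<phi> - \<phi>0\<bar> ^ m \<le> (\<phi> - \<phi>0) * slope a l \<phi>"
  shows "\<exists>\<epsilon> \<delta>. 0 < \<epsilon> \<and> \<epsilon> \<le> 1 \<and> pi * \<epsilon> < - ln l \<and> 0 < \<delta> \<and>
     (\<forall>\<phi>\<in>{0..pi}. Re (phase a l (of_real \<phi> + \<i> * of_real (\<epsilon> * (\<phi> - \<phi>0)))) \<le> - \<delta> * \<bar>\<phi> - \<phi>0\<bar> ^ m)"
proof -
  obtain \<kappa> where \<kappa>: "\<kappa> > 0" "\<And>\<phi>. \<phi> \<in> {0..pi} \<Longrightarrow> \<kappa> * \<bar>\<phi> - \<phi>0\<bar> ^ m \<le> (\<phi> - \<phi>0) * slope a l \<phi>"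
    using gap by blast
  define L where "L = - ln l"
  have L: "L > 0" using l by (simp add: L_def)
  obtain M where M: "M \<ge> 0" "\<And>\<phi> \<eta>. \<lbrakk>0 \<le> \<phi>; \<phi> \<le> pi; \<bar>\<eta>\<bar> \<le> L / 2\<rbrakk> \<Longrightarrow>
     \<bar>Re (phase a l (of_real \<phi> + \<i> * of_real \<eta>)) + \<eta> * slope a l \<phi>\<bar> \<le> M * \<bar>\<eta>\<bar> ^ 3"
    using Re_phase_bound[OF l, of "L / 2" a] L unfolding L_def by auto
  \<comment> \<open>\<open>pi < 4\<close> gives \<open>pi \<epsilon> \<le> L / 2\<close>, so the line stays where the cubic estimate holds;
    the last bound lets the cubic error consume at most half of the gap\<close>
  define \<epsilon> where "\<epsilon> = min 1 (min (L / 8) (\<kappa> / (8 * (M + 1))))"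
  have \<epsilon>: "0 < \<epsilon>" "\<epsilon> \<le> 1" "\<epsilon> \<le> L / 8" "\<epsilon> \<le> \<kappa> / (8 * (M + 1))"
  proof -
    show "0 < \<epsilon>" using L \<kappa> M by (auto simp: \<epsilon>_def)
    show "\<epsilon> \<le> 1" unfolding \<epsilon>_def by (rule min.cobounded1)
    have "\<epsilon> \<le> min (L / 8) (\<kappa> / (8 * (M + 1)))" unfolding \<epsilon>_def by (rule min.cobounded2)
    then show "\<epsilon> \<le> L / 8" "\<epsilon> \<le> \<kappa> / (8 * (M + 1))"
      using min.cobounded1 min.cobounded2 order_trans by blast+
  qed
  have pi\<epsilon>: "pi * \<epsilon> \<le> L / 2"
    using mult_mono[of pi 4 \<epsilon> "L / 8"] \<epsilon> pi_less_4 L by simp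
  have M\<epsilon>: "4 * M * \<epsilon>\<^sup>2 \<le> \<kappa> / 2"
  proof -
    have "\<epsilon> * (8 * (M + 1)) \<le> \<kappa>" using \<epsilon>(4) M by (simp add: pos_le_divide_eq)
    then have "8 * (M * \<epsilon>) + 8 * \<epsilon> \<le> \<kappa>" by (simp add: algebra_simps)
    moreover have "M * \<epsilon>\<^sup>2 \<le> M * \<epsilon>"
      using \<epsilon> M by (intro mult_left_mono) (auto simp: power2_eq_square mult_left_le)
    ultimately show ?thesis using \<epsilon> by simp
  qed
  show ?thesis
  proof (intro exI conjI ballI)
    show "0 < \<epsilon>" "\<epsilon> \<le> 1" by fact+
    show "pi * \<epsilon> < - ln l" using pi\<epsilon> L by (simp add: L_def)
    show "0 < \<epsilon> * \<kappa> / 2" using \<epsilon> \<kappa> by simp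
    fix \<phi> assume \<phi>: "\<phi> \<in> {0..pi}"
    define d where "d = \<phi> - \<phi>0"
    have d: "\<bar>d\<bar> \<le> pi" using \<phi> \<phi>0 by (auto simp: d_def)
    have "\<bar>\<epsilon> * d\<bar> \<le> \<epsilon> * pi" using d \<epsilon> by (simp add: abs_mult)
    then have small: "\<bar>\<epsilon> * d\<bar> \<le> L / 2" using pi\<epsilon> by (simp add: mult.commute)
    have "\<bar>d\<bar> ^ 3 \<le> 4 * \<bar>d\<bar> ^ m"
    proof -
      have "\<bar>d\<bar> * \<bar>d\<bar>\<^sup>2 \<le> 4 * \<bar>d\<bar>\<^sup>2" using d pi_less_4 by (intro mult_right_mono) auto
      then have "\<bar>d\<bar> ^ 3 \<le> 4 * \<bar>d\<bar> ^ 2" by (simp only: numeral_3_eq_3 power2_eq_square power_Suc power_0 mult_1_right)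
      moreover have "\<bar>d\<bar> ^ 3 \<le> 4 * \<bar>d\<bar> ^ 3" using zero_le_power[of "\<bar>d\<bar>" 3] by linarith
      ultimately show ?thesis using m by blast
    qed
    have c: "M * \<bar>\<epsilon> * d\<bar> ^ 3 \<le> M * \<epsilon> ^ 3 * (4 * \<bar>d\<bar> ^ m)"
    proof -
      have "M * \<epsilon> ^ 3 * \<bar>d\<bar> ^ 3 \<le> M * \<epsilon> ^ 3 * (4 * \<bar>d\<bar> ^ m)"
        using \<open>\<bar>d\<bar> ^ 3 \<le> 4 * \<bar>d\<bar> ^ m\<close> M \<epsilon> by (intro mult_left_mono) auto
      then show ?thesis using \<epsilon> by (simp add: abs_mult power_mult_distrib mult.assoc)
    qed
    have "Re (phase a l (of_real \<phi> + \<i> * of_real (\<epsilon> * d))) \<le> - (\<epsilon> * (d * slope a l \<phi>)) + M * \<bar>\<epsilon> * d\<bar> ^ 3"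
      using M(2)[of \<phi> "\<epsilon> * d"] \<phi> small by (simp add: abs_le_iff)
    also have "\<dots> \<le> - (\<epsilon> * (\<kappa> * \<bar>d\<bar> ^ m)) + M * \<epsilon> ^ 3 * (4 * \<bar>d\<bar> ^ m)"
    proof -
      have "\<epsilon> * (\<kappa> * \<bar>d\<bar> ^ m) \<le> \<epsilon> * (d * slope a l \<phi>)"
        unfolding d_def using \<kappa>(2)[OF \<phi>] \<epsilon> by (intro mult_left_mono) auto
      then show ?thesis using c by linarith
    qed
    also have "\<dots> = - (\<epsilon> * \<bar>d\<bar> ^ m) * (\<kappa> - 4 * M * \<epsilon>\<^sup>2)"
      by (simp add: algebra_simps power2_eq_square numeral_3_eq_3)
    also have "\<dots> \<le> - (\<epsilon> * \<bar>d\<bar> ^ m) * (\<kappa> / 2)"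
      using M\<epsilon> \<epsilon> by (intro mult_left_mono_neg) auto
    finally show "Re (phase a l (of_real \<phi> + \<i> * of_real (\<epsilon> * (\<phi> - \<phi>0)))) \<le> - (\<epsilon> * \<kappa> / 2) * \<bar>\<phi> - \<phi>0\<bar> ^ m"
      by (simp add: d_def mult_ac)
  qed
qed

text \<open>
  Where the slope has no zero, a parallel of the unit circle on the side \<open>\<sigma>\<close> makes the
  integrand exponentially small everywhere.
\<close>

lemma shifted_line:
  assumes l: "0 < l" "l < 1" and \<sigma>: "\<bar>\<sigma>\<bar> = 1" and \<kappa>: "\<kappa> > 0"
    and gap: "\<And>\<phi>. \<phi> \<in> {0..pi} \<Longrightarrow> \<kappa> \<le> \<sigma> * slope a l \<phi>"
  shows "\<exists>\<epsilon> \<delta>. 0 < \<epsilon> \<and> \<epsilon> < - ln l \<and> 0 < \<delta> \<and>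
     (\<forall>\<phi>\<in>{0..pi}. Re (phase a l (of_real \<phi> + \<i> * of_real (\<sigma> * \<epsilon>))) \<le> - \<delta>)"
proof -
  define L where "L = - ln l"
  have L: "L > 0" using l by (simp add: L_def)
  obtain M where M: "M \<ge> 0" "\<And>\<phi> \<eta>. \<lbrakk>0 \<le> \<phi>; \<phi> \<le> pi; \<bar>\<eta>\<bar> \<le> L / 2\<rbrakk> \<Longrightarrow>
     \<bar>Re (phase a l (of_real \<phi> + \<i> * of_real \<eta>)) + \<eta> * slope a l \<phi>\<bar> \<le> M * \<bar>\<eta>\<bar> ^ 3"
    using Re_phase_bound[OF l, of "L / 2" a] L unfolding L_def by auto
  define \<epsilon> where "\<epsilon> = min 1 (min (L / 2) (\<kappa> / (2 * (M + 1))))"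
  have \<epsilon>: "0 < \<epsilon>" "\<epsilon> \<le> 1" "\<epsilon> \<le> L / 2" "\<epsilon> \<le> \<kappa> / (2 * (M + 1))"
  proof -
    show "0 < \<epsilon>" using L \<kappa> M by (auto simp: \<epsilon>_def)
    show "\<epsilon> \<le> 1" unfolding \<epsilon>_def by (rule min.cobounded1)
    have "\<epsilon> \<le> min (L / 2) (\<kappa> / (2 * (M + 1)))" unfolding \<epsilon>_def by (rule min.cobounded2)
    then show "\<epsilon> \<le> L / 2" "\<epsilon> \<le> \<kappa> / (2 * (M + 1))"
      using min.cobounded1 min.cobounded2 order_trans by blast+
  qed
  have M\<epsilon>: "M * \<epsilon>\<^sup>2 \<le> \<kappa> / 2"
  proof -
    have "\<epsilon> * (2 * (M + 1)) \<le> \<kappa>" using \<epsilon>(4) M by (simp add: pos_le_divide_eq)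
    then have "2 * (M * \<epsilon>) + 2 * \<epsilon> \<le> \<kappa>" by (simp add: algebra_simps)
    moreover have "M * \<epsilon>\<^sup>2 \<le> M * \<epsilon>"
      using \<epsilon> M by (intro mult_left_mono) (auto simp: power2_eq_square mult_left_le)
    ultimately show ?thesis using \<epsilon> by simp
  qed
  show ?thesis
  proof (intro exI conjI ballI)
    show "0 < \<epsilon>" by fact
    show "\<epsilon> < - ln l" using \<epsilon> L by (simp add: L_def)
    show "0 < \<epsilon> * \<kappa> / 2" using \<epsilon> \<kappa> by simp
    fix \<phi> assume \<phi>: "\<phi> \<in> {0..pi}"
    have a: "\<bar>\<sigma> * \<epsilon>\<bar> = \<epsilon>" using \<sigma> \<epsilon> by (simp add: abs_mult)
    have "Re (phase a l (of_real \<phi> + \<i> * of_real (\<sigma> * \<epsilon>))) \<le> - (\<epsilon> * (\<sigma> * slope a l \<phi>)) + M * \<epsilon> ^ 3"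
      using M(2)[of \<phi> "\<sigma> * \<epsilon>"] \<phi> \<epsilon> unfolding a by (simp add: abs_le_iff mult_ac)
    also have "\<dots> \<le> - (\<epsilon> * \<kappa>) + M * \<epsilon> ^ 3"
      using mult_left_mono[OF gap[OF \<phi>], of \<epsilon>] \<epsilon> by simp
    also have "\<dots> = - \<epsilon> * (\<kappa> - M * \<epsilon>\<^sup>2)" by (simp add: algebra_simps power2_eq_square numeral_3_eq_3)
    also have "\<dots> \<le> - \<epsilon> * (\<kappa> / 2)" using M\<epsilon> \<epsilon> by (intro mult_left_mono_neg) auto
    finally show "Re (phase a l (of_real \<phi> + \<i> * of_real (\<sigma> * \<epsilon>))) \<le> - (\<epsilon> * \<kappa> / 2)" by simp
  qed
qed

section \<open>The integral along the branch cut\<close>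

text \<open>
  The factor by which the cut density is multiplied when \<open>n\<close> grows by one; it is
  \<open>\<bar>exp phase\<bar>\<close> on the cut.
\<close>

definition cut_base :: "real \<Rightarrow> real \<Rightarrow> real \<Rightarrow> real" where
  "cut_base a l t = t powr (a + 1) * (1 + l * t) / (t + l)"

lemma cut_density_add:
  assumes "0 < l" "0 \<le> t"
  shows "cut_density a \<alpha> \<beta> l (N + k) t = cut_base a l t ^ k * cut_density a \<alpha> \<beta> l N t"
proof (cases "t = 0")
  case False
  then have t: "t > 0" and q: "1 + l * t > 0" using assms by (auto simp: add_pos_pos)
  have "(a + 1) * real (N + k) + \<alpha> = (a + 1) * real k + ((a + 1) * real N + \<alpha>)" by (simp add: algebra_simps)
  then have 1: "t powr ((a + 1) * real (N + k) + \<alpha>) = (t powr (a + 1)) ^ k * t powr ((a + 1) * real N + \<alpha>)"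
  proof -
    have "(t powr (a + 1)) ^ k = t powr ((a + 1) * real k)"
      by (subst powr_power) (use t in \<open>simp_all add: mult.commute\<close>)
    then show ?thesis unfolding \<open>(a + 1) * real (N + k) + \<alpha> = _\<close> powr_add by (simp only:)
  qed
  have "real (N + k) + \<beta> = real k + (real N + \<beta>)" by simp
  then have 2: "(1 + l * t) powr (real (N + k) + \<beta>) = (1 + l * t) ^ k * (1 + l * t) powr (real N + \<beta>)"
    by (simp only: \<open>real (N + k) + \<beta> = _\<close> powr_add powr_realpow[OF q])
  have 3: "(t + l) ^ (N + k + 1) = (t + l) ^ k * (t + l) ^ (N + 1)" by (simp add: add_ac flip: power_add)
  show ?thesis
    unfolding cut_density_def cut_base_def 1 2 3 power_mult_distrib power_divide by simp
qed (simp add: cut_density_def)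

lemma cut_density_eq_power:
  assumes "0 < l" "0 < t"
  shows "cut_density a \<alpha> \<beta> l n t = cut_base a l t ^ n * (t powr \<alpha> * (1 + l * t) powr \<beta> / (t + l))"
  using cut_density_add[of l t a \<alpha> \<beta> 0 n] assms by (simp add: cut_density_def)

lemma cut_density_nonneg:
  assumes "0 < l" "0 \<le> t"
  shows "0 \<le> cut_density a \<alpha> \<beta> l n t"
  using assms by (simp add: cut_density_def)

lemma cut_base_pos: "0 < l \<Longrightarrow> 0 < t \<Longrightarrow> 0 < cut_base a l t"
  by (simp add: cut_base_def add_pos_pos)

lemma continuous_on_cut_base:
  assumes "0 < l" "-1 < a"
  shows "continuous_on {0..r} (cut_base a l)"
proof -
  have "continuous_on {0..r} (\<lambda>t. t powr (a + 1))"
    by (rule continuous_on_powr') (use assms in \<open>auto intro: continuous_intros\<close>)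
  moreover have "\<forall>t\<in>{0..r}. t + l \<noteq> 0" using assms by auto
  ultimately show ?thesis
    unfolding cut_base_def[abs_def]
    by (intro continuous_on_divide continuous_on_mult continuous_on_add continuous_on_const continuous_on_id)
qed

lemma ln_cut_base_deriv:
  assumes "0 < l" "0 < t"
  shows "((\<lambda>t. ln (cut_base a l t)) has_field_derivative
     ((a + 1) * ((1 + l * t) * (t + l)) - (1 - l\<^sup>2) * t) / (t * ((1 + l * t) * (t + l)))) (at t)"
proof -
  have p: "0 < 1 + l * t" "0 < t + l" using assms by (auto simp: add_pos_pos)
  have "((\<lambda>t. (a + 1) * ln t + ln (1 + l * t) - ln (t + l)) has_field_derivative
     (a + 1) * (1 / t) + l / (1 + l * t) - 1 / (t + l)) (at t)"
    using assms p by (auto intro!: derivative_eq_intros simp: divide_simps)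
  moreover have "(a + 1) * (1 / t) + l / (1 + l * t) - 1 / (t + l) =
     ((a + 1) * ((1 + l * t) * (t + l)) - (1 - l\<^sup>2) * t) / (t * ((1 + l * t) * (t + l)))"
    using assms p by (simp add: divide_simps) (simp add: algebra_simps power2_eq_square)
  moreover have "ln (cut_base a l x) = (a + 1) * ln x + ln (1 + l * x) - ln (x + l)" if "x \<in> {0<..}" for x
  proof -
    have "0 < 1 + l * x" "0 < x + l" "0 < x" using assms that by (auto simp: add_pos_pos)
    then show ?thesis unfolding cut_base_def by (simp add: ln_div ln_mult ln_powr)
  qed
  ultimately show ?thesis
    using has_field_derivative_transform_within_open[of _ _ t "{0<..}" "\<lambda>t. ln (cut_base a l t)"] assms by simp
qed

text \<open>
  The base equals \<open>1\<close> at \<open>t = 1\<close>, and it increases on \<open>(0,1)\<close> as long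
  as \<open>a \<ge> - 2l/(1+l)\<close>: its logarithmic derivative has the sign of
  \<open>(a+1) (1 + l t) (t + l) - (1 - l^2) t\<close>, and
  \<open>(1 + l t) (t + l) = t (1 + l)^2 + l (1 - t)^2\<close>.
\<close>

lemma cut_base_less_one:
  assumes l: "0 < l" "l < 1" and a: "- (2 * l / (1 + l)) \<le> a" and t: "0 < t" "t < 1"
  shows "cut_base a l t < 1"
proof -
  have a1: "(1 - l) / (1 + l) \<le> a + 1" using a l by (simp add: field_simps)
  have "ln (cut_base a l t) < ln (cut_base a l 1)"
  proof (rule DERIV_pos_imp_increasing_open[OF t(2)])
    fix x assume x: "t < x" "x < 1"
    then have x0: "x > 0" using t by simp
    have p: "0 < 1 + l * x" "0 < x + l" using l x0 by (auto simp: add_pos_pos)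
    have "(1 - l\<^sup>2) * x < (a + 1) * ((1 + l * x) * (x + l))"
    proof -
      have "0 < l * (1 - x)\<^sup>2" using l x by simp
      then have "x * (1 + l)\<^sup>2 < (1 + l * x) * (x + l)"
        by (simp add: algebra_simps power2_eq_square)
      then have "(1 - l) / (1 + l) * (x * (1 + l)\<^sup>2) < (1 - l) / (1 + l) * ((1 + l * x) * (x + l))"
        using l by (intro mult_strict_left_mono) auto
      also have "\<dots> \<le> (a + 1) * ((1 + l * x) * (x + l))"
        using a1 p by (intro mult_right_mono) auto
      also have "(1 - l) / (1 + l) * (x * (1 + l)\<^sup>2) = (1 - l\<^sup>2) * x"
        using l by (simp add: field_simps power2_eq_square)
      finally show ?thesis .
    qed
    then have "0 < ((a + 1) * ((1 + l * x) * (x + l)) - (1 - l\<^sup>2) * x) / (x * ((1 + l * x) * (x + l)))"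
      using x0 p by (intro divide_pos_pos) auto
    then show "\<exists>y. ((\<lambda>t. ln (cut_base a l t)) has_real_derivative y) (at x) \<and> 0 < y"
      using ln_cut_base_deriv[OF l(1) x0] by blast
  next
    show "continuous_on {t..1} (\<lambda>t. ln (cut_base a l t))"
    proof (intro continuous_at_imp_continuous_on ballI)
      fix x assume "x \<in> {t..1}"
      then show "isCont (\<lambda>t. ln (cut_base a l t)) x"
        using t by (intro DERIV_isCont[OF ln_cut_base_deriv[OF l(1)]]) auto
    qed
  qed
  moreover have "cut_base a l 1 = 1" using l by (simp add: cut_base_def)
  ultimately show ?thesis using cut_base_pos[OF l(1) t(1), of a] by simp
qed

lemma eventually_exponent_pos:
  fixes a \<alpha> :: real
  assumes "-1 < a"
  shows "\<forall>\<^sub>F n in sequentially. (a + 1) * real n + \<alpha> > 0"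
proof -
  have "filterlim (\<lambda>n. \<alpha> + (a + 1) * real n) at_top sequentially"
    using assms by (intro filterlim_tendsto_add_at_top[OF tendsto_const] filterlim_tendsto_pos_mult_at_top[OF tendsto_const]
        filterlim_real_sequentially) auto
  then show ?thesis
    by (simp add: filterlim_at_top_dense add.commute)
qed

text \<open>
  The maximum of the base over \<open>[0, r]\<close> is a number below one. The density at a fixed index
  \<open>N\<close> supplies the bounded factor; index \<open>0\<close> would not do, as the density may be
  unbounded near \<open>t = 0\<close> for small \<open>n\<close>.
\<close>

lemma cut_integral_decay:
  assumes l: "0 < l" "l < 1" and a: "- 1 < a" "- (2 * l / (1 + l)) \<le> a" and r: "0 < r" "r < 1"
  shows "\<exists>C \<rho> N. 0 < \<rho> \<and> \<rho> < 1 \<and> (\<forall>n\<ge>N. \<bar>integral {0..r} (cut_density a \<alpha> \<beta> l n)\<bar> \<le> C * \<rho> ^ n)"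
proof -
  obtain N where Npos: "\<And>n. n \<ge> N \<Longrightarrow> (a + 1) * real n + \<alpha> > 0"
    using eventually_exponent_pos[OF a(1), of \<alpha>] by (auto simp: eventually_sequentially)
  have "\<exists>x\<in>{0..r}. \<forall>y\<in>{0..r}. cut_base a l y \<le> cut_base a l x"
    by (rule continuous_attains_sup[OF _ _ continuous_on_cut_base[OF l(1) a(1)]]) (use r in auto)
  then obtain x where x: "x \<in> {0..r}" "\<And>y. y \<in> {0..r} \<Longrightarrow> cut_base a l y \<le> cut_base a l x" by blast
  define \<rho> where "\<rho> = cut_base a l x"
  have "0 < cut_base a l r" by (rule cut_base_pos[OF l(1) r(1)])
  then have \<rho>0: "0 < \<rho>" using x(2)[of r] r unfolding \<rho>_def by force
  then have "x \<noteq> 0" by (auto simp: \<rho>_def cut_base_def)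
  then have \<rho>1: "\<rho> < 1" unfolding \<rho>_def using cut_base_less_one[OF l a(2)] x(1) r by auto
  have contN: "continuous_on {0..r} (cut_density a \<alpha> \<beta> l n)" if "n \<ge> N" for n
    by (rule cut_density_continuous_on[OF l(1) Npos[OF that]])
  have "compact (cut_density a \<alpha> \<beta> l N ` {0..r})"
    by (rule compact_continuous_image[OF contN]) auto
  then obtain B where B: "\<And>t. t \<in> {0..r} \<Longrightarrow> norm (cut_density a \<alpha> \<beta> l N t) \<le> B"
    by (metis bounded_iff compact_imp_bounded image_eqI)
  have "\<bar>integral {0..r} (cut_density a \<alpha> \<beta> l n)\<bar> \<le> (B * r / \<rho> ^ N) * \<rho> ^ n" if n: "n \<ge> N" for n
  proof -
    define k where "k = n - N"
    have k: "n = N + k" using n by (simp add: k_def)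
    have "norm (integral {0..r} (cut_density a \<alpha> \<beta> l n)) \<le> (\<rho> ^ k * B) * (r - 0)"
    proof (rule integral_bound)
      fix t assume t: "t \<in> {0..r}"
      have c0: "0 \<le> cut_base a l t" using t l by (simp add: cut_base_def)
      then have "cut_base a l t ^ k \<le> \<rho> ^ k" using x(2)[OF t] by (intro power_mono) (auto simp: \<rho>_def)
      then have "\<bar>cut_base a l t ^ k\<bar> * \<bar>cut_density a \<alpha> \<beta> l N t\<bar> \<le> \<rho> ^ k * B"
        using c0 \<rho>0 B[OF t] by (intro mult_mono) auto
      then show "norm (cut_density a \<alpha> \<beta> l n t) \<le> \<rho> ^ k * B"
        using cut_density_add[OF l(1), of t a \<alpha> \<beta> N k] t by (simp add: k abs_mult)
    qed (use r contN[OF n] in auto)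
    also have "\<dots> = (B * r / \<rho> ^ N) * \<rho> ^ n" using \<rho>0 by (simp add: k power_add)
    finally show ?thesis by simp
  qed
  then show ?thesis using \<rho>0 \<rho>1 by blast
qed

text \<open>
  For \<open>a < - 2l/(1+l)\<close> the base decreases at \<open>t = 1\<close>, where it equals one, so
  it exceeds one on an interval slightly to the left of \<open>1\<close>. The density being nonnegative, this
  interval alone forces growth.
\<close>

lemma cut_integral_growth:
  assumes l: "0 < l" "l < 1" and a: "- 1 < a" "a < - (2 * l / (1 + l))"
  shows "\<exists>c \<rho> N. c > 0 \<and> \<rho> > 1 \<and> (\<forall>n\<ge>N. \<forall>R\<ge>1. c * \<rho> ^ n \<le> integral {0..R} (cut_density a \<alpha> \<beta> l n))"
proof -
  obtain N where Npos: "\<And>n. n \<ge> N \<Longrightarrow> (a + 1) * real n + \<alpha> > 0"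
    using eventually_exponent_pos[OF a(1), of \<alpha>] by (auto simp: eventually_sequentially)
  have "(a + 1) * ((1 + l * 1) * (1 + l)) - (1 - l\<^sup>2) * 1 < 0"
  proof -
    have "a + 1 < (1 - l) / (1 + l)" using a l by (simp add: field_simps)
    then have "(a + 1) * ((1 + l) * (1 + l)) < (1 - l) / (1 + l) * ((1 + l) * (1 + l))"
      using l by (intro mult_strict_right_mono) auto
    also have "\<dots> = 1 - l\<^sup>2" using l by (simp add: field_simps power2_eq_square)
    finally show ?thesis by simp
  qed
  then have neg: "((a + 1) * ((1 + l * 1) * (1 + l)) - (1 - l\<^sup>2) * 1) / (1 * ((1 + l * 1) * (1 + l))) < 0"
    using l by (intro divide_neg_pos) auto
  have "\<exists>d>0. \<forall>h>0. h < d \<longrightarrow> ln (cut_base a l 1) < ln (cut_base a l (1 - h))"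
    by (rule DERIV_neg_dec_left[OF ln_cut_base_deriv[OF l(1)] neg]) simp
  then obtain d where d: "d > 0" "\<And>h. h > 0 \<Longrightarrow> h < d \<Longrightarrow> ln (cut_base a l 1) < ln (cut_base a l (1 - h))" by blast
  have one: "cut_base a l 1 = 1" using l by (simp add: cut_base_def)
  define h where "h = min d 1 / 2"
  have h: "0 < h" "h < d" "h < 1" using d by (auto simp: h_def)
  \<comment> \<open>a closed interval in \<open>(1 - d, 1)\<close>, on which the base has a minimum greater than one\<close>
  define r1 where "r1 = 1 - h"
  define r2 where "r2 = 1 - h / 2"
  have r: "0 < r1" "r1 < r2" "r2 < 1" using h by (auto simp: r1_def r2_def)
  have big: "1 < cut_base a l t" if "t \<in> {r1..r2}" for t
  proof -
    have "0 < ln (cut_base a l (1 - (1 - t)))" using d(2)[of "1 - t"] that h one by (simp add: r1_def r2_def)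
    then show ?thesis using cut_base_pos[OF l(1), of t a] that r by simp
  qed
  have "continuous_on {r1..r2} (cut_base a l)"
    by (rule continuous_on_subset[OF continuous_on_cut_base[OF l(1) a(1), of r2]]) (use r in auto)
  then have "\<exists>x\<in>{r1..r2}. \<forall>y\<in>{r1..r2}. cut_base a l x \<le> cut_base a l y"
    by (intro continuous_attains_inf) (use r in auto)
  then obtain x where x: "x \<in> {r1..r2}" "\<And>y. y \<in> {r1..r2} \<Longrightarrow> cut_base a l x \<le> cut_base a l y" by blast
  define \<rho> where "\<rho> = cut_base a l x"
  have \<rho>: "\<rho> > 1" using big[OF x(1)] by (simp add: \<rho>_def)
  define k where "k = (\<lambda>t. t powr \<alpha> * (1 + l * t) powr \<beta> / (t + l))"
  have kpos: "k t > 0" if "t \<in> {r1..r2}" for t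
  proof -
    have t: "0 < t" "0 < t + l" "0 < l * t" using that r l by auto
    then have "0 < 1 + l * t" by linarith
    then show ?thesis using t by (simp add: k_def)
  qed
  have "continuous_on {r1..r2} k"
    unfolding k_def
  proof (intro continuous_on_divide continuous_on_mult continuous_on_powr continuous_intros ballI)
    fix t assume t: "t \<in> {r1..r2}"
    show "t \<noteq> 0" "t + l \<noteq> 0" using t r l by auto
    have "0 < l * t" using t r l by simp
    then show "1 + l * t \<noteq> 0" by linarith
  qed
  then have "\<exists>x\<in>{r1..r2}. \<forall>y\<in>{r1..r2}. k x \<le> k y"
    by (intro continuous_attains_inf) (use r in auto)
  then obtain x' where x': "x' \<in> {r1..r2}" "\<And>y. y \<in> {r1..r2} \<Longrightarrow> k x' \<le> k y" by blast
  show ?thesis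
  proof (intro exI conjI allI impI)
    show "k x' * (r2 - r1) > 0" using kpos[OF x'(1)] r by simp
    show "\<rho> > 1" by fact
    fix n R assume n: "N \<le> n" and R: "(1::real) \<le> R"
    have int: "cut_density a \<alpha> \<beta> l n integrable_on {0..b}" for b
      by (rule integrable_continuous_real[OF cut_density_continuous_on[OF l(1) Npos[OF n]]])
    have int': "cut_density a \<alpha> \<beta> l n integrable_on {r1..r2}"
      by (rule integrable_subinterval_real[OF int[of r2]]) (use r in auto)
    have "k x' * (r2 - r1) * \<rho> ^ n = integral {r1..r2} (\<lambda>t. \<rho> ^ n * k x')"
      using r by simp
    also have "\<dots> \<le> integral {r1..r2} (cut_density a \<alpha> \<beta> l n)"
    proof (rule integral_le[OF _ int'])
      fix t assume t: "t \<in> {r1..r2}"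
      have "\<rho> ^ n * k x' \<le> cut_base a l t ^ n * k t"
        using x(2)[OF t] x'(2)[OF t] \<rho> kpos[OF x'(1)] big[OF t] by (intro mult_mono power_mono) (auto simp: \<rho>_def)
      also have "\<dots> = cut_density a \<alpha> \<beta> l n t"
        using cut_density_eq_power[OF l(1), of t a \<alpha> \<beta> n] t r by (simp add: k_def)
      finally show "\<rho> ^ n * k x' \<le> cut_density a \<alpha> \<beta> l n t" .
    qed auto
    also have "\<dots> \<le> integral {0..R} (cut_density a \<alpha> \<beta> l n)"
      by (rule integral_subset_le[OF _ int' int]) (use r R cut_density_nonneg[OF l(1)] in auto)
    finally show "k x' * (r2 - r1) * \<rho> ^ n \<le> integral {0..R} (cut_density a \<alpha> \<beta> l n)" .
  qed
qed

section \<open>Exponential decay and growth\<close>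

text \<open>
  If the slope keeps one sign, the contour can be shifted to a circle where \<open>exp phase\<close> is less
  than one in modulus, and up to an exponentially small error the Jacobi polynomial equals its branch cut
  contribution. The shift goes inwards (\<open>\<sigma> = 1\<close>, the cut ends at a radius below one) or
  outwards (\<open>\<sigma> = - 1\<close>, the cut is followed beyond radius one).
\<close>

lemma shifted_contour_estimate:
  assumes l: "0 < l" "l < 1" and \<sigma>: "\<bar>\<sigma>\<bar> = 1" and \<kappa>: "\<kappa> > 0"
    and gap: "\<And>\<phi>. \<phi> \<in> {0..pi} \<Longrightarrow> \<kappa> \<le> \<sigma> * slope a l \<phi>"
  shows "\<exists>\<epsilon> \<rho> C. 0 < \<epsilon> \<and> 0 < \<rho> \<and> \<rho> < 1 \<and> (\<forall>n. (a + 1) * real n + \<alpha> > 0 \<longrightarrow>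
     \<bar>pi * ((1 - l\<^sup>2) powr \<beta> * scaled_jacobi a \<alpha> \<beta> l n)
        + sin (pi * (a * real n + \<alpha>)) * integral {0..exp (- (\<sigma> * \<epsilon>))} (cut_density a \<alpha> \<beta> l n)\<bar> \<le> C * \<rho> ^ n)"
proof -
  obtain \<epsilon> \<delta> where \<epsilon>: "0 < \<epsilon>" "\<epsilon> < - ln l" "0 < \<delta>"
    and dec: "\<And>\<phi>. \<phi> \<in> {0..pi} \<Longrightarrow> Re (phase a l (of_real \<phi> + \<i> * of_real (\<sigma> * \<epsilon>))) \<le> - \<delta>"
    using shifted_line[OF l \<sigma> \<kappa> gap] by blast
  define w where "w = \<i> * complex_of_real (\<sigma> * \<epsilon>)"
  have abs: "\<bar>\<sigma> * \<epsilon>\<bar> < - ln l" using \<sigma> \<epsilon> by (simp add: abs_mult)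
  have strip: "w + of_real s * 1 \<in> strip l" for s using abs by (simp add: strip_def w_def)
  have cont: "continuous_on {0..pi} (\<lambda>s. f (w + of_real s * 1))" if "f holomorphic_on strip l" for f
    by (rule continuous_on_compose2[OF holomorphic_on_imp_continuous_on[OF that]]) (use strip in \<open>auto intro!: continuous_intros\<close>)
  have "compact ((\<lambda>s. amplitude \<alpha> \<beta> l (w + of_real s * 1)) ` {0..pi})"
    by (rule compact_continuous_image[OF cont[OF holomorphic_amplitude[OF l(1)]]]) simp
  then have "bounded ((\<lambda>s. amplitude \<alpha> \<beta> l (w + of_real s * 1)) ` {0..pi})"
    by (rule compact_imp_bounded)
  then obtain B where "\<forall>z\<in>(\<lambda>s. amplitude \<alpha> \<beta> l (w + of_real s * 1)) ` {0..pi}. norm z \<le> B"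
    by (auto simp only: bounded_iff)
  then have B: "norm (amplitude \<alpha> \<beta> l (w + of_real s * 1)) \<le> B" if "s \<in> {0..pi}" for s
    using that by blast
  have "\<bar>pi * ((1 - l\<^sup>2) powr \<beta> * scaled_jacobi a \<alpha> \<beta> l n)
        + sin (pi * (a * real n + \<alpha>)) * integral {0..exp (- (\<sigma> * \<epsilon>))} (cut_density a \<alpha> \<beta> l n)\<bar> \<le> (B * pi) * exp (- \<delta>) ^ n"
    if pos: "(a + 1) * real n + \<alpha> > 0" for n
  proof -
    obtain \<Psi> where \<Psi>: "\<And>w. w \<in> strip l \<Longrightarrow> (\<Psi> has_field_derivative integrand a \<alpha> \<beta> l n w) (at w)"
      and J: "\<And>y y'. \<bar>y\<bar> < - ln l \<Longrightarrow> \<bar>y'\<bar> < - ln l \<Longrightarrow>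
       Re (\<Psi> (of_real pi + \<i> * of_real y) - \<Psi> (\<i> * of_real y'))
        - sin (pi * (a * real n + \<alpha>)) * integral {0..exp (- y)} (cut_density a \<alpha> \<beta> l n)
       = pi * ((1 - l\<^sup>2) powr \<beta> * scaled_jacobi a \<alpha> \<beta> l n)"
      using jacobi_contour_formula[OF l pos] by blast
    have "((\<lambda>s. integrand a \<alpha> \<beta> l n (w + of_real s * 1) * 1) has_integral (\<Psi> (w + of_real pi * 1) - \<Psi> w)) {0..pi}"
      by (rule has_integral_primitive_on_ray[OF _ strip \<Psi>]) auto
    then have I: "\<Psi> (of_real pi + \<i> * of_real (\<sigma> * \<epsilon>)) - \<Psi> (\<i> * of_real (\<sigma> * \<epsilon>))
        = integral {0..pi} (\<lambda>s. integrand a \<alpha> \<beta> l n (w + of_real s * 1))"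
      by (simp add: integral_unique w_def add.commute)
    have "norm (integral {0..pi} (\<lambda>s. integrand a \<alpha> \<beta> l n (w + of_real s * 1))) \<le> (exp (- \<delta>) ^ n * B) * (pi - 0)"
    proof (rule integral_bound)
      fix s :: real assume s: "s \<in> {0..pi}"
      have "Re (phase a l (w + of_real s * 1)) \<le> - \<delta>" using dec[OF s] by (simp add: w_def add.commute)
      then have "real n * Re (phase a l (w + of_real s * 1)) \<le> real n * - \<delta>" by (intro mult_left_mono) auto
      then have "exp (real n * Re (phase a l (w + of_real s * 1))) \<le> exp (- \<delta>) ^ n"
        by (simp flip: exp_of_nat_mult)
      then show "norm (integrand a \<alpha> \<beta> l n (w + of_real s * 1)) \<le> exp (- \<delta>) ^ n * B"
        unfolding integrand_def norm_mult norm_exp_eq_Re using B[OF s] by (intro mult_mono) auto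
    qed (use cont[OF holomorphic_integrand[OF l(1)]] in simp_all)
    then have "norm (\<Psi> (of_real pi + \<i> * of_real (\<sigma> * \<epsilon>)) - \<Psi> (\<i> * of_real (\<sigma> * \<epsilon>))) \<le> (B * pi) * exp (- \<delta>) ^ n"
      unfolding I by (simp add: mult_ac)
    then have "\<bar>Re (\<Psi> (of_real pi + \<i> * of_real (\<sigma> * \<epsilon>)) - \<Psi> (\<i> * of_real (\<sigma> * \<epsilon>)))\<bar> \<le> (B * pi) * exp (- \<delta>) ^ n"
      using abs_Re_le_cmod order_trans by blast
    then show ?thesis using J[OF abs abs] by linarith
  qed
  moreover have "exp (- \<delta>) < 1" "0 < exp (- \<delta>)" using \<epsilon> by auto
  ultimately show ?thesis using \<epsilon>(1) by blast
qed

lemma exponential_bound_all_n: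
  fixes f :: "nat \<Rightarrow> real"
  assumes "0 < \<rho>" "\<rho> < 1" and "\<And>n. n \<ge> N \<Longrightarrow> P n \<Longrightarrow> \<bar>f n\<bar> \<le> C * \<rho> ^ n"
  shows "\<exists>C \<rho>. C > 0 \<and> 0 < \<rho> \<and> \<rho> < 1 \<and> (\<forall>n. P n \<longrightarrow> \<bar>f n\<bar> \<le> C * \<rho> ^ n)"
proof (intro exI conjI allI impI)
  \<comment> \<open>the finitely many exceptional indices are absorbed into the constant\<close>
  define S where "S = (\<Sum>k<N. \<bar>f k\<bar> / \<rho> ^ k)"
  have S: "S \<ge> 0" unfolding S_def using assms(1) by (intro sum_nonneg) auto
  show "\<bar>C\<bar> + S + 1 > 0" using S by simp
  fix n assume P: "P n"
  show "\<bar>f n\<bar> \<le> (\<bar>C\<bar> + S + 1) * \<rho> ^ n"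
  proof (cases "n \<ge> N")
    case True
    have "C * \<rho> ^ n \<le> (\<bar>C\<bar> + S + 1) * \<rho> ^ n" using S assms(1) by (intro mult_right_mono) auto
    then show ?thesis using assms(3)[OF True P] by linarith
  next
    case False
    have "\<bar>f n\<bar> / \<rho> ^ n \<le> S" unfolding S_def
      by (rule member_le_sum) (use False assms(1) in auto)
    then have "\<bar>f n\<bar> \<le> S * \<rho> ^ n" using assms(1) by (simp add: pos_divide_le_eq)
    also have "\<dots> \<le> (\<bar>C\<bar> + S + 1) * \<rho> ^ n" using assms(1) by (intro mult_right_mono) auto
    finally show ?thesis .
  qed
qed (use assms in auto)

lemma slope_lower:
  assumes "0 < l" "l < 1"
  shows "a - 2 * l / (1 - l) \<le> slope a l \<phi>"
proof -
  note b = kernel_real_bounds[OF assms, of \<phi>]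
  have l2: "1 - l\<^sup>2 > 0" using assms by (simp add: abs_square_less_1)
  have "(1 - l\<^sup>2) / (1 + l\<^sup>2 - 2 * l * cos \<phi>) \<le> (1 - l\<^sup>2) / (1 - l)\<^sup>2"
    using b l2 assms by (intro divide_left_mono mult_pos_pos) auto
  also have "\<dots> = 1 + 2 * l / (1 - l)"
    using assms by (simp add: divide_simps) (simp add: algebra_simps power2_eq_square)
  finally show ?thesis by (simp add: slope_def)
qed

lemma slope_upper:
  assumes "0 < l" "l < 1"
  shows "slope a l \<phi> \<le> a + 2 * l / (1 + l)"
proof -
  note b = kernel_real_bounds[OF assms, of \<phi>]
  have l2: "1 - l\<^sup>2 > 0" using assms by (simp add: abs_square_less_1)
  have "(1 - l\<^sup>2) / (1 + l)\<^sup>2 \<le> (1 - l\<^sup>2) / (1 + l\<^sup>2 - 2 * l * cos \<phi>)"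
    using b l2 assms by (intro divide_left_mono mult_pos_pos) auto
  moreover have "(1 - l\<^sup>2) / (1 + l)\<^sup>2 = 1 - 2 * l / (1 + l)"
    using assms by (simp add: divide_simps) (simp add: algebra_simps power2_eq_square)
  ultimately show ?thesis by (simp add: slope_def)
qed

text \<open>
  The slope is positive, the contour moves inwards, and the cut is followed only to a radius less than one,
  where its contribution decays as well.
\<close>

lemma decay_above:
  assumes l: "0 < l" "l < 1" and a: "2 * l / (1 - l) < a"
  shows "\<exists>C \<rho>. C > 0 \<and> 0 < \<rho> \<and> \<rho> < 1 \<and> (\<forall>n::nat. \<bar>scaled_jacobi a \<alpha> \<beta> l n\<bar> \<le> C * \<rho> ^ n)"
proof -
  have a0: "0 < a" using a l divide_pos_pos[of "2 * l" "1 - l"] by linarith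
  have "- (2 * l / (1 + l)) \<le> 0" using l by simp
  then have a': "- 1 < a" "- (2 * l / (1 + l)) \<le> a" using a0 by linarith+
  obtain \<epsilon> \<rho>1 C1 where e: "0 < \<epsilon>" "0 < \<rho>1" "\<rho>1 < 1" and E: "\<And>n. (a + 1) * real n + \<alpha> > 0 \<Longrightarrow>
     \<bar>pi * ((1 - l\<^sup>2) powr \<beta> * scaled_jacobi a \<alpha> \<beta> l n)
        + sin (pi * (a * real n + \<alpha>)) * integral {0..exp (- (1 * \<epsilon>))} (cut_density a \<alpha> \<beta> l n)\<bar> \<le> C1 * \<rho>1 ^ n"
    using shifted_contour_estimate[OF l, of 1 "a - 2 * l / (1 - l)" a \<alpha> \<beta>] slope_lower[OF l, of a] a by auto
  obtain C2 \<rho>2 N2 where c: "0 < \<rho>2" "\<rho>2 < 1" and C2: "\<And>n. n \<ge> N2 \<Longrightarrow> \<bar>integral {0..exp (- \<epsilon>)} (cut_density a \<alpha> \<beta> l n)\<bar> \<le> C2 * \<rho>2 ^ n"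
    using cut_integral_decay[OF l a', of "exp (- \<epsilon>)" \<alpha> \<beta>] e(1) by auto
  obtain N where N: "\<And>n. n \<ge> N \<Longrightarrow> (a + 1) * real n + \<alpha> > 0"
    using eventually_exponent_pos[OF a'(1), of \<alpha>] by (auto simp: eventually_sequentially)
  define \<rho> where "\<rho> = max \<rho>1 \<rho>2"
  define q where "q = pi * (1 - l\<^sup>2) powr \<beta>"
  have q: "q > 0" using l by (simp add: q_def abs_square_less_1 powr_gt_zero less_imp_neq)
  have bound: "\<bar>scaled_jacobi a \<alpha> \<beta> l n\<bar> \<le> ((\<bar>C1\<bar> + \<bar>C2\<bar>) / q) * \<rho> ^ n" if n: "n \<ge> max N N2" for n
  proof -
    let ?s = "sin (pi * (a * real n + \<alpha>))" and ?I = "integral {0..exp (- \<epsilon>)} (cut_density a \<alpha> \<beta> l n)"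
    have "\<bar>?s * ?I\<bar> \<le> 1 * \<bar>?I\<bar>" unfolding abs_mult by (intro mult_right_mono) auto
    moreover have "\<bar>q * scaled_jacobi a \<alpha> \<beta> l n + ?s * ?I\<bar> \<le> C1 * \<rho>1 ^ n"
      using E[OF N] n by (simp add: q_def mult.assoc)
    moreover have "\<bar>?I\<bar> \<le> C2 * \<rho>2 ^ n" using C2 n by simp
    ultimately have "\<bar>q * scaled_jacobi a \<alpha> \<beta> l n\<bar> \<le> C1 * \<rho>1 ^ n + C2 * \<rho>2 ^ n" by linarith
    also have "\<dots> \<le> \<bar>C1\<bar> * \<rho> ^ n + \<bar>C2\<bar> * \<rho> ^ n"
      using e c by (intro add_mono mult_mono power_mono) (auto simp: \<rho>_def)
    finally have "q * \<bar>scaled_jacobi a \<alpha> \<beta> l n\<bar> \<le> (\<bar>C1\<bar> + \<bar>C2\<bar>) * \<rho> ^ n"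
      using q by (simp add: abs_mult distrib_right)
    then show ?thesis using q by (simp add: field_simps)
  qed
  have "\<exists>C \<rho>. C > 0 \<and> 0 < \<rho> \<and> \<rho> < 1 \<and> (\<forall>n::nat. True \<longrightarrow> \<bar>scaled_jacobi a \<alpha> \<beta> l n\<bar> \<le> C * \<rho> ^ n)"
    by (rule exponential_bound_all_n[where \<rho> = \<rho> and N = "max N N2" and C = "(\<bar>C1\<bar> + \<bar>C2\<bar>) / q"])
      (use e c bound in \<open>auto simp: \<rho>_def\<close>)
  then show ?thesis by simp
qed

text \<open>
  Here the slope is negative and the contour moves outwards, so that the cut integral extends over
  \<open>[0, R]\<close> with \<open>R \<ge> 1\<close> and includes the region where its density grows.
\<close>

lemma below_estimate:
  assumes l: "0 < l" "l < 1" and a: "-1 < a" "a < - (2 * l / (1 + l))"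
  shows "\<exists>R \<rho> C N. R \<ge> 1 \<and> 0 < \<rho> \<and> \<rho> < 1 \<and> (\<forall>n\<ge>N.
     \<bar>pi * ((1 - l\<^sup>2) powr \<beta> * scaled_jacobi a \<alpha> \<beta> l n)
        + sin (pi * (a * real n + \<alpha>)) * integral {0..R} (cut_density a \<alpha> \<beta> l n)\<bar> \<le> C * \<rho> ^ n)"
proof -
  have gap: "- (a + 2 * l / (1 + l)) \<le> - 1 * slope a l \<phi>" for \<phi>
    using slope_upper[OF l, of a \<phi>] by simp
  obtain \<epsilon> \<rho> C where e: "0 < \<epsilon>" "0 < \<rho>" "\<rho> < 1" and E: "\<And>n. (a + 1) * real n + \<alpha> > 0 \<Longrightarrow>
     \<bar>pi * ((1 - l\<^sup>2) powr \<beta> * scaled_jacobi a \<alpha> \<beta> l n)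
        + sin (pi * (a * real n + \<alpha>)) * integral {0..exp (- (- 1 * \<epsilon>))} (cut_density a \<alpha> \<beta> l n)\<bar> \<le> C * \<rho> ^ n"
    using shifted_contour_estimate[OF l _ _ gap, of \<alpha> \<beta>] a by auto
  obtain N where N: "\<And>n. n \<ge> N \<Longrightarrow> (a + 1) * real n + \<alpha> > 0"
    using eventually_exponent_pos[OF a(1), of \<alpha>] by (auto simp: eventually_sequentially)
  have "exp (- (- 1 * \<epsilon>)) \<ge> 1" using e by simp
  then show ?thesis using e E N by blast
qed

text \<open>
  At integers \<open>a n + \<alpha>\<close> the sine in front of the growing cut integral vanishes.
\<close>

lemma decay_below:
  assumes l: "0 < l" "l < 1" and a: "-1 < a" "a < - (2 * l / (1 + l))"
  shows "\<exists>C \<rho>. C > 0 \<and> 0 < \<rho> \<and> \<rho> < 1 \<and> (\<forall>n::nat. a * real n + \<alpha> \<in> \<int> \<longrightarrow> \<bar>scaled_jacobi a \<alpha> \<beta> l n\<bar> \<le> C * \<rho> ^ n)"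
proof -
  obtain R \<rho> C N where e: "0 < \<rho>" "\<rho> < 1" and E: "\<And>n. n \<ge> N \<Longrightarrow>
     \<bar>pi * ((1 - l\<^sup>2) powr \<beta> * scaled_jacobi a \<alpha> \<beta> l n)
        + sin (pi * (a * real n + \<alpha>)) * integral {0..R} (cut_density a \<alpha> \<beta> l n)\<bar> \<le> C * \<rho> ^ n"
    using below_estimate[OF assms, of \<beta> \<alpha>] by blast
  define q where "q = pi * (1 - l\<^sup>2) powr \<beta>"
  have q: "q > 0" using l by (simp add: q_def abs_square_less_1 powr_gt_zero less_imp_neq)
  have "\<bar>scaled_jacobi a \<alpha> \<beta> l n\<bar> \<le> (C / q) * \<rho> ^ n" if n: "n \<ge> N" and z: "a * real n + \<alpha> \<in> \<int>" for n
  proof -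
    have "sin (pi * (a * real n + \<alpha>)) = 0"
      using z by (auto elim!: Ints_cases simp: sin_zero_iff_int2 mult.commute)
    then have "q * \<bar>scaled_jacobi a \<alpha> \<beta> l n\<bar> \<le> C * \<rho> ^ n"
      using E[OF n] q by (simp add: q_def abs_mult mult.assoc)
    then show ?thesis using q by (simp add: field_simps)
  qed
  then show ?thesis by (rule exponential_bound_all_n[OF e])
qed

text \<open>
  Separation from the integers bounds \<open>\<bar>sin (pi (a n + \<alpha>))\<bar>\<close> from below, so
  the growing cut integral dominates the exponentially small remainder.
\<close>

lemma growth_below:
  assumes l: "0 < l" "l < 1" and a: "-1 < a" "a < - (2 * l / (1 + l))"
    and sep: "(INF n\<in>{1::nat..}. infdist (a * real n + \<alpha>) \<int>) > 0"
  shows "\<exists>c \<rho> :: real. \<exists>N::nat. c > 0 \<and> \<rho> > 1 \<and> (\<forall>n\<ge>N. \<bar>scaled_jacobi a \<alpha> \<beta> l n\<bar> \<ge> c * \<rho> ^ n)"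
proof -
  define d where "d = (INF n\<in>{1::nat..}. infdist (a * real n + \<alpha>) \<int>)"
  have d: "d > 0" using sep by (simp add: d_def)
  have d_le: "d \<le> infdist (a * real n + \<alpha>) \<int>" if "n \<ge> 1" for n
    unfolding d_def by (rule cINF_lower) (use that in \<open>auto intro!: bdd_belowI[of _ 0] infdist_nonneg\<close>)
  \<comment> \<open>the minimum with \<open>1/2\<close> keeps the angle in the range where the sine increases\<close>
  define s where "s = sin (pi * min d (1/2))"
  have s: "s > 0" unfolding s_def by (rule sin_gt_zero) (use d pi_gt_zero in \<open>auto simp: min_def\<close>)
  have sin_ge: "s \<le> \<bar>sin (pi * (a * real n + \<alpha>))\<bar>" if n: "n \<ge> 1" for n
  proof -
    define x where "x = a * real n + \<alpha>"
    define k where "k = round x"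
    define t where "t = \<bar>x - of_int k\<bar>"
    have t2: "t \<le> 1 / 2" using of_int_round_abs_le[of x] by (simp add: t_def k_def abs_minus_commute)
    have "infdist x \<int> \<le> dist x (of_int k)" by (rule infdist_le) simp
    then have dt: "d \<le> t" using d_le[OF n] by (simp add: x_def t_def dist_real_def)
    have "sin (pi * x) = sin (pi * (x - of_int k) + of_int k * pi)" by (simp add: algebra_simps)
    also have "\<dots> = sin (pi * (x - of_int k)) * cos (of_int k * pi)"
      by (simp add: sin_add sin_zero_iff_int2)
    finally have "\<bar>sin (pi * x)\<bar> = \<bar>sin (pi * (x - of_int k))\<bar> * \<bar>cos (of_int k * pi)\<bar>"
      by (simp only: abs_mult)
    also have "\<bar>cos (of_int k * pi)\<bar> = 1"
    proof -
      have "sin (of_int k * pi) = 0" by (simp add: sin_zero_iff_int2)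
      then show ?thesis by (metis abs_one abs_square_eq_1 add_0 power_zero_numeral sin_cos_squared_add)
    qed
    also have "\<bar>sin (pi * (x - of_int k))\<bar> * 1 = \<bar>sin (pi * (x - of_int k))\<bar>" by simp
    also have "\<dots> = \<bar>sin (pi * t)\<bar>"
    proof -
      have "t = x - of_int k \<or> t = - (x - of_int k)" by (auto simp: t_def)
      then show ?thesis by (elim disjE) (simp_all only: mult_minus_right sin_minus abs_minus_cancel)
    qed
    finally have eq: "\<bar>sin (pi * x)\<bar> = \<bar>sin (pi * t)\<bar>" .
    have "s \<le> sin (pi * t)"
      unfolding s_def
    proof (rule sin_monotone_2pi_le)
      show "- (pi / 2) \<le> pi * min d (1 / 2)" 
      proof -
        have "0 \<le> pi * min d (1 / 2)" using d by simp
        then show ?thesis using pi_gt_zero by linarith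
      qed
      show "pi * min d (1 / 2) \<le> pi * t" using dt by (intro mult_left_mono) auto
      show "pi * t \<le> pi / 2" using mult_left_mono[OF t2, of pi] by simp
    qed
    then show ?thesis using eq by (simp add: x_def)
  qed
  obtain R \<rho>1 C1 N1 where e: "R \<ge> 1" "0 < \<rho>1" "\<rho>1 < 1" and E: "\<And>n. n \<ge> N1 \<Longrightarrow>
     \<bar>pi * ((1 - l\<^sup>2) powr \<beta> * scaled_jacobi a \<alpha> \<beta> l n)
        + sin (pi * (a * real n + \<alpha>)) * integral {0..R} (cut_density a \<alpha> \<beta> l n)\<bar> \<le> C1 * \<rho>1 ^ n"
    using below_estimate[OF l a, of \<beta> \<alpha>] by blast
  obtain c \<rho> N2 where c: "c > 0" "\<rho> > 1" and G: "\<And>n. n \<ge> N2 \<Longrightarrow> c * \<rho> ^ n \<le> integral {0..R} (cut_density a \<alpha> \<beta> l n)"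
    using cut_integral_growth[OF l a, of \<alpha> \<beta>] e(1) by blast
  define q where "q = pi * (1 - l\<^sup>2) powr \<beta>"
  have q: "q > 0" using l by (simp add: q_def abs_square_less_1 powr_gt_zero less_imp_neq)
  obtain N3 where N30: "2 * \<bar>C1\<bar> / (s * c) < \<rho> ^ N3" using real_arch_pow[OF c(2)] by blast
  have N3: "\<bar>C1\<bar> \<le> s * c / 2 * \<rho> ^ n" if "n \<ge> N3" for n
  proof -
    have "\<rho> ^ N3 \<le> \<rho> ^ n" using that c by (intro power_increasing) auto
    then have "2 * \<bar>C1\<bar> / (s * c) < \<rho> ^ n" using N30 by linarith
    then have "2 * \<bar>C1\<bar> < \<rho> ^ n * (s * c)" using s c by (simp add: pos_divide_less_eq)
    then show ?thesis by (simp add: mult_ac)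
  qed
  show ?thesis
  proof (intro exI conjI allI impI)
    show "s * c / 2 / q > 0" using s c q by simp
    show "\<rho> > 1" by fact
    fix n assume n: "max 1 (max N1 (max N2 N3)) \<le> n"
    let ?s = "sin (pi * (a * real n + \<alpha>))" and ?I = "integral {0..R} (cut_density a \<alpha> \<beta> l n)"
    have "s * (c * \<rho> ^ n) \<le> \<bar>?s\<bar> * \<bar>?I\<bar>"
      using sin_ge[of n] G[of n] n s c by (intro mult_mono) auto
    then have 1: "s * c * \<rho> ^ n \<le> \<bar>?s * ?I\<bar>" by (simp add: abs_mult)
    have "C1 * \<rho>1 ^ n \<le> \<bar>C1\<bar> * 1"
      using e by (intro mult_mono) (auto simp: power_le_one)
    then have 2: "C1 * \<rho>1 ^ n \<le> s * c / 2 * \<rho> ^ n" using N3[of n] n by linarith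
    have 3: "\<bar>q * scaled_jacobi a \<alpha> \<beta> l n + ?s * ?I\<bar> \<le> C1 * \<rho>1 ^ n"
      using E[of n] n by (simp add: q_def mult.assoc)
    have 4: "s * c * \<rho> ^ n = 2 * (s * c / 2 * \<rho> ^ n)" by simp
    have "s * c / 2 * \<rho> ^ n \<le> \<bar>q * scaled_jacobi a \<alpha> \<beta> l n\<bar>"
      using 1 2 3 unfolding 4 by linarith
    then show "s * c / 2 / q * \<rho> ^ n \<le> \<bar>scaled_jacobi a \<alpha> \<beta> l n\<bar>"
      using q by (simp add: abs_mult field_simps)
  qed
qed

section \<open>A simple saddle on the unit circle\<close>

lemma power_in_bigo_powr:
  fixes \<rho> :: real
  assumes "0 < \<rho>" "\<rho> < 1"
  shows "(\<lambda>n. \<rho> ^ n) \<in> O(\<lambda>n. real n powr p)"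
proof -
  define k where "k = - ln \<rho>"
  have k: "k > 0" using assms by (simp add: k_def)
  have "(\<lambda>n::nat. exp (- k * real n)) \<in> O(\<lambda>n. real n powr p)"
    using k by real_asymp
  moreover have "exp (- k * real n) = \<rho> ^ n" for n
  proof -
    have "\<rho> ^ n = exp (real n * ln \<rho>)" using assms by (simp add: exp_of_nat_mult)
    then show ?thesis by (simp add: k_def mult.commute)
  qed
  ultimately show ?thesis by simp
qed

lemma cut_integral_bigo:
  assumes l: "0 < l" "l < 1" and a: "- 1 < a" "- (2 * l / (1 + l)) \<le> a" and r: "0 < r" "r < 1"
  shows "(\<lambda>n. sin (pi * (a * real n + \<alpha>)) * integral {0..r} (cut_density a \<alpha> \<beta> l n)) \<in> O(\<lambda>n. real n powr p)"
proof -
  obtain C \<rho> N where \<rho>: "0 < \<rho>" "\<rho> < 1" and C: "\<And>n. n \<ge> N \<Longrightarrow> \<bar>integral {0..r} (cut_density a \<alpha> \<beta> l n)\<bar> \<le> C * \<rho> ^ n"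
    using cut_integral_decay[OF l a r, of \<alpha> \<beta>] by blast
  have "(\<lambda>n. sin (pi * (a * real n + \<alpha>)) * integral {0..r} (cut_density a \<alpha> \<beta> l n)) \<in> O(\<lambda>n. \<rho> ^ n)"
  proof (rule bigoI[of _ C])
    show "\<forall>\<^sub>F n in sequentially. norm (sin (pi * (a * real n + \<alpha>)) * integral {0..r} (cut_density a \<alpha> \<beta> l n)) \<le> C * norm (\<rho> ^ n)"
      using eventually_ge_at_top[of N]
    proof eventually_elim
      case (elim n)
      have "\<bar>sin (pi * (a * real n + \<alpha>))\<bar> * \<bar>integral {0..r} (cut_density a \<alpha> \<beta> l n)\<bar> \<le> 1 * (C * \<rho> ^ n)"
        using C[OF elim] by (intro mult_mono) auto
      then show ?case using \<rho> by (simp add: abs_mult)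
    qed
  qed
  then show ?thesis using landau_o.big_trans power_in_bigo_powr[OF \<rho>] by blast
qed

text \<open>
  The interface between contour estimates and asymptotics of the polynomial. A path that ends above the real
  line ends at a radius below one on the cut; then the cut integral is exponentially small and is absorbed by
  the error term, whatever its power of \<open>n\<close>.
\<close>

lemma jacobi_bigo_transfer:
  assumes l: "0 < l" "l < 1" and a: "- 1 < a" "- (2 * l / (1 + l)) \<le> a"
    and y: "0 < y" "y < - ln l" "\<bar>y'\<bar> < - ln l"
    and main: "\<And>n \<Psi>. n \<ge> 1 \<Longrightarrow> (\<And>w. w \<in> strip l \<Longrightarrow> (\<Psi> has_field_derivative integrand a \<alpha> \<beta> l n w) (at w)) \<Longrightarrow>
       \<bar>Re (\<Psi> (of_real pi + \<i> * of_real y) - \<Psi> (\<i> * of_real y')) - g n\<bar> \<le> C * real n powr p"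
  shows "(\<lambda>n. scaled_jacobi a \<alpha> \<beta> l n - (1 - l\<^sup>2) powr (- \<beta>) / pi * g n) \<in> O(\<lambda>n. real n powr p)"
proof -
  let ?t = "\<lambda>n. sin (pi * (a * real n + \<alpha>)) * integral {0..exp (- y)} (cut_density a \<alpha> \<beta> l n)"
  obtain N where N: "\<And>n. n \<ge> N \<Longrightarrow> (a + 1) * real n + \<alpha> > 0"
    using eventually_exponent_pos[OF a(1), of \<alpha>] by (auto simp: eventually_sequentially)
  have l2: "1 - l\<^sup>2 > 0" using l by (simp add: abs_square_less_1)
  have "(\<lambda>n. (pi * ((1 - l\<^sup>2) powr \<beta> * scaled_jacobi a \<alpha> \<beta> l n) + ?t n) - g n) \<in> O(\<lambda>n. real n powr p)"
  proof (rule bigoI[of _ C])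
    show "\<forall>\<^sub>F n in sequentially. norm ((pi * ((1 - l\<^sup>2) powr \<beta> * scaled_jacobi a \<alpha> \<beta> l n) + ?t n) - g n) \<le> C * norm (real n powr p)"
      using eventually_ge_at_top[of "max 1 N"]
    proof eventually_elim
      case (elim n)
      obtain \<Psi> where \<Psi>: "\<And>w. w \<in> strip l \<Longrightarrow> (\<Psi> has_field_derivative integrand a \<alpha> \<beta> l n w) (at w)"
        and J: "\<And>y y'. \<bar>y\<bar> < - ln l \<Longrightarrow> \<bar>y'\<bar> < - ln l \<Longrightarrow>
         Re (\<Psi> (of_real pi + \<i> * of_real y) - \<Psi> (\<i> * of_real y'))
          - sin (pi * (a * real n + \<alpha>)) * integral {0..exp (- y)} (cut_density a \<alpha> \<beta> l n)
         = pi * ((1 - l\<^sup>2) powr \<beta> * scaled_jacobi a \<alpha> \<beta> l n)"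
        using jacobi_contour_formula[OF l N, of n \<beta>] elim by auto
      have "\<bar>Re (\<Psi> (of_real pi + \<i> * of_real y) - \<Psi> (\<i> * of_real y')) - g n\<bar> \<le> C * real n powr p"
        by (rule main[OF _ \<Psi>]) (use elim in auto)
      moreover have "Re (\<Psi> (of_real pi + \<i> * of_real y) - \<Psi> (\<i> * of_real y')) = pi * ((1 - l\<^sup>2) powr \<beta> * scaled_jacobi a \<alpha> \<beta> l n) + ?t n"
        using J[of y y'] y by simp
      ultimately show ?case by simp
    qed
  qed
  moreover have "?t \<in> O(\<lambda>n. real n powr p)"
    by (rule cut_integral_bigo[OF l a]) (use y in auto)
  ultimately have "(\<lambda>n. ((pi * ((1 - l\<^sup>2) powr \<beta> * scaled_jacobi a \<alpha> \<beta> l n) + ?t n) - g n) - ?t n) \<in> O(\<lambda>n. real n powr p)"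
    by (rule sum_in_bigo(2))
  then have "(\<lambda>n. (1 - l\<^sup>2) powr (- \<beta>) / pi * (((pi * ((1 - l\<^sup>2) powr \<beta> * scaled_jacobi a \<alpha> \<beta> l n) + ?t n) - g n) - ?t n)) \<in> O(\<lambda>n. real n powr p)"
    by (rule landau_o.big.mult_in_1 [OF bigo_const, simplified] | simp)
  moreover have "(1 - l\<^sup>2) powr (- \<beta>) / pi * (((pi * ((1 - l\<^sup>2) powr \<beta> * s) + t) - g') - t)
      = s - (1 - l\<^sup>2) powr (- \<beta>) / pi * g'" for s t g' :: real
    using l2 by (simp add: powr_minus field_simps)
  ultimately show ?thesis by (simp only:)
qed

lemma two_sided_saddle_sum:
  fixes A B E T \<kappa> u :: complex
  assumes "norm (A - E * (T * x + \<kappa> * y)) \<le> C1 * z" "norm (B - E * (T * x + - \<kappa> * y)) \<le> C2 * z"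
  shows "norm (u * A + u * B - 2 * u * E * T * x) \<le> norm u * (C1 + C2) * z"
proof -
  have "u * A + u * B - 2 * u * E * T * x = u * ((A - E * (T * x + \<kappa> * y)) + (B - E * (T * x + - \<kappa> * y)))"
    by (simp add: algebra_simps)
  also have "norm \<dots> \<le> norm u * (C1 * z + C2 * z)"
    unfolding norm_mult by (intro mult_left_mono order_trans[OF norm_triangle_ineq] add_mono assms) auto
  finally show ?thesis by (simp add: algebra_simps)
qed

text \<open>
  The tilted line through the simple saddle \<open>\<phi>\<close> is split there into two rays. Their leading
  terms agree and add up, their corrections of relative order \<open>n^(-1/2)\<close> cancel. The line is
  higher at \<open>Re w = pi\<close> than at the saddle, hence its end lies inside the unit circle, as the
  transfer requires.
\<close>

lemma oscillatory_part_raw: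
  assumes l: "0 < l" "l < 1" and a: "- 1 < a" "- (2 * l / (1 + l)) \<le> a"
    and \<phi>: "0 < \<phi>" "\<phi> < pi" and s0: "slope a l \<phi> = 0"
  defines "H \<equiv> (1 - l\<^sup>2) * (2 * l * sin \<phi>) / (1 + l\<^sup>2 - 2 * l * cos \<phi>)\<^sup>2"
  shows "(\<lambda>n. scaled_jacobi a \<alpha> \<beta> l n - (1 - l\<^sup>2) powr (- \<beta>) / pi *
      (sqrt (2 * pi / H) * real n powr (- (1 / 2)) *
       Re (exp (of_nat n * phase a l (of_real \<phi>)) * amplitude \<alpha> \<beta> l (of_real \<phi>) * cis (pi / 4))))
     \<in> O(\<lambda>n. real n powr (- (3 / 2)))"
proof -
  have l2: "1 - l\<^sup>2 > 0" using l by (simp add: abs_square_less_1)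
  have H: "H > 0"
    unfolding H_def using l l2 sin_gt_zero[OF \<phi>] kernel_real_bounds(3)[OF l, of \<phi>] by simp
  obtain \<epsilon> \<delta> where \<epsilon>: "0 < \<epsilon>" "\<epsilon> \<le> 1" "pi * \<epsilon> < - ln l" "0 < \<delta>"
    and dec: "\<And>x. x \<in> {0..pi} \<Longrightarrow> Re (phase a l (of_real x + \<i> * of_real (\<epsilon> * (x - \<phi>)))) \<le> - \<delta> * \<bar>x - \<phi>\<bar> ^ 2"
    using tilted_line[OF l _ _ _ slope_gap[OF l s0 cos_gap_interior[OF \<phi>]]] \<phi> by auto
  define w where "w = complex_of_real \<phi>"
  define u where "u = 1 + \<i> * of_real \<epsilon>"
  define K where "K = H / 2"
  obtain r \<theta> where r: "r > 0" "\<bar>real 2 * \<theta>\<bar> < pi / 2"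
    "of_real r * cis \<theta> = of_real (root 2 K) * cis (- (pi / (2 * real 2))) * u"
    "(of_real r * cis \<theta>) ^ 2 = - \<i> * of_real K * u ^ 2"
    using admissible_direction[of 2 K \<epsilon>] H \<epsilon> unfolding K_def u_def by auto
  have Re_w: "Re (phase a l w) = 0" unfolding w_def by (rule Re_phase_real[OF l])
  have flat: "(deriv ^^ j) (phase a l) w = 0" if "0 < j" "j < 2" for j
  proof -
    have "j = 1" using that by simp
    then show ?thesis using deriv_phase_real[OF l, of a \<phi>] s0 by (simp add: w_def)
  qed
  have d2: "(deriv ^^ 2) (phase a l) w = \<i> * of_real H"
    unfolding w_def H_def by (rule deriv2_phase_real[OF l])
  have lead: "(deriv ^^ 2) (phase a l) w * u ^ 2 / fact 2 = - ((of_real r * cis \<theta>) ^ 2)"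
    "(deriv ^^ 2) (phase a l) w * (- u) ^ 2 / fact 2 = - ((of_real r * cis \<theta>) ^ 2)"
    unfolding r(4) d2 K_def by (simp_all add: fact_2)
  have ray: "w + of_real s * (c * u) = of_real (\<phi> + s * c') + \<i> * of_real (\<epsilon> * ((\<phi> + s * c') - \<phi>))"
    if "c = of_real c'" for s c c'
    unfolding w_def u_def that by (simp add: algebra_simps)
  have in_strip: "w + of_real s * (c * u) \<in> strip l" if "c = of_real c'" "\<bar>s * c'\<bar> \<le> pi" for s c c'
  proof -
    have "\<bar>\<epsilon> * (s * c')\<bar> \<le> \<epsilon> * pi" using that(2) \<epsilon> by (simp add: abs_mult)
    then show ?thesis unfolding ray[OF that(1)] strip_def using \<epsilon> by (simp add: mult.commute)
  qed
  have decay: "Re (phase a l (w + of_real s * (c * u)) - phase a l w) \<le> - \<delta> * s ^ 2"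
    if "c = of_real c'" "\<bar>c'\<bar> = 1" "\<phi> + s * c' \<in> {0..pi}" for s c c'
  proof -
    have "\<bar>\<phi> + s * c' - \<phi>\<bar> ^ 2 = s ^ 2" using that(2) by (simp add: power_mult_distrib abs_square_eq_1[THEN iffD2])
    then show ?thesis using dec[OF that(3)] Re_w unfolding ray[OF that(1)] by simp
  qed
  define X where "X = (\<lambda>v b n. integral {0..b} (\<lambda>s. integrand a \<alpha> \<beta> l n (w + of_real s * v)))"
  define E where "E = (\<lambda>n::nat. exp (of_nat n * phase a l w))"
  define T where "T = amplitude \<alpha> \<beta> l w * (of_real (Gamma (1 + 1 / real 2)) / (of_real r * cis \<theta>))"
  define \<kappa> where "\<kappa> = ray_correction a \<alpha> \<beta> l 2 ((of_real r * cis \<theta>) ^ 2) w u"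
  have E1: "norm (E n) = 1" for n using Re_w by (simp add: E_def)
  have "\<exists>C. \<forall>n\<ge>(1::nat). norm (X u (pi - \<phi>) n - E n * (T * of_real (real n powr (- (1 / real 2)))
      + \<kappa> * of_real (real n powr (- (2 / real 2))))) \<le> C * real n powr (- (3 / real 2)) * norm (E n)"
    unfolding X_def E_def T_def \<kappa>_def
  proof (rule saddle_ray[OF l _ _ _ flat _ r(1,2) \<epsilon>(4)])
    show "w + of_real s * u \<in> strip l" if "s \<in> {0..pi - \<phi>}" for s
      using in_strip[of 1 1 s] that \<phi> by simp
    show "Re (phase a l (w + of_real s * u) - phase a l w) \<le> - \<delta> * s ^ 2" if "s \<in> {0..pi - \<phi>}" for s
      using decay[of 1 1 s] that \<phi> by simp
  qed (use lead \<phi> in auto)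
  then obtain C1 where C1: "\<And>n. n \<ge> 1 \<Longrightarrow> norm (X u (pi - \<phi>) n - E n * (T * of_real (real n powr (- (1 / real 2)))
      + \<kappa> * of_real (real n powr (- (2 / real 2))))) \<le> C1 * real n powr (- (3 / real 2)) * norm (E n)"
    by blast
  have "\<exists>C. \<forall>n\<ge>(1::nat). norm (X (- u) \<phi> n - E n * (T * of_real (real n powr (- (1 / real 2)))
      + - \<kappa> * of_real (real n powr (- (2 / real 2))))) \<le> C * real n powr (- (3 / real 2)) * norm (E n)"
    unfolding X_def E_def T_def \<kappa>_def ray_correction_odd[OF even_numeral, symmetric]
  proof (rule saddle_ray[OF l _ _ _ flat _ r(1,2) \<epsilon>(4)])
    show "w + of_real s * (- u) \<in> strip l" if "s \<in> {0..\<phi>}" for s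
      using in_strip[of "- 1" "- 1" s] that \<phi> by simp
    show "Re (phase a l (w + of_real s * (- u)) - phase a l w) \<le> - \<delta> * s ^ 2" if "s \<in> {0..\<phi>}" for s
      using decay[of "- 1" "- 1" s] that \<phi> by simp
  qed (use lead \<phi> in auto)
  then obtain C2 where C2: "\<And>n. n \<ge> 1 \<Longrightarrow> norm (X (- u) \<phi> n - E n * (T * of_real (real n powr (- (1 / real 2)))
      + - \<kappa> * of_real (real n powr (- (2 / real 2))))) \<le> C2 * real n powr (- (3 / real 2)) * norm (E n)"
    by blast
  \<comment> \<open>the tilt \<open>u\<close> cancels: the leading term depends on the saddle only\<close>
  have lead_coeff: "2 * u * T = of_real (sqrt (2 * pi / H)) * amplitude \<alpha> \<beta> l w * cis (pi / 4)"
  proof -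
    have u0: "u \<noteq> 0" by (simp add: u_def complex_eq_iff)
    have rK: "root 2 K > 0" using H by (simp add: K_def)
    have G: "Gamma (1 + 1 / real 2) = sqrt pi / 2"
    proof -
      have "(1 / 2 :: real) \<notin> \<int>\<^sub>\<le>\<^sub>0" using nonpos_Ints_nonpos[of "1 / 2 :: real"] by auto
      from Gamma_plus1[OF this] show ?thesis using Gamma_one_half_real by (simp add: add.commute)
    qed
    have fr: "u / (of_real r * cis \<theta>) = cis (pi / 4) / of_real (root 2 K)"
    proof -
      have gen: "u / (R * C * u) = inverse C / R" if "C \<noteq> 0" "R \<noteq> 0" for R C :: complex
        using u0 that by (simp add: field_simps)
      show ?thesis unfolding r(3) using rK by (subst gen) (simp_all add: cis_inverse)
    qed
    have "2 * u * T = (2 * of_real (Gamma (1 + 1 / real 2)) * amplitude \<alpha> \<beta> l w) * (u / (of_real r * cis \<theta>))"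
      unfolding T_def by (simp only: mult_ac times_divide_eq_right times_divide_eq_left)
    also have "\<dots> = 2 * of_real (Gamma (1 + 1 / real 2)) / of_real (root 2 K) * amplitude \<alpha> \<beta> l w * cis (pi / 4)"
      unfolding fr by (simp only: mult_ac times_divide_eq_right times_divide_eq_left)
    also have "2 * of_real (Gamma (1 + 1 / real 2)) / of_real (root 2 K) = complex_of_real (sqrt (2 * pi / H))"
    proof -
      have "2 * (sqrt pi / 2) / root 2 K = sqrt (2 * pi / H)"
        using H by (simp add: K_def sqrt_def[symmetric] real_sqrt_divide real_sqrt_mult)
      then have "complex_of_real (2 * (sqrt pi / 2) / root 2 K) = complex_of_real (sqrt (2 * pi / H))" by (simp only:)
      then show ?thesis unfolding G by (simp only: of_real_mult of_real_divide of_real_numeral)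
    qed
    finally show ?thesis .
  qed
  show ?thesis
    unfolding w_def[symmetric]
  proof (rule jacobi_bigo_transfer[OF l a, where y = "\<epsilon> * (pi - \<phi>)" and y' = "- (\<epsilon> * \<phi>)" and C = "norm u * (C1 + C2)"])
    show "0 < \<epsilon> * (pi - \<phi>)" using \<epsilon> \<phi> by simp
    have "\<epsilon> * (pi - \<phi>) \<le> \<epsilon> * pi" "\<epsilon> * \<phi> \<le> \<epsilon> * pi" using \<epsilon> \<phi> by (intro mult_left_mono; simp)+
    moreover have "0 < \<epsilon> * \<phi>" using \<epsilon> \<phi> by simp
    ultimately show "\<epsilon> * (pi - \<phi>) < - ln l" "\<bar>- (\<epsilon> * \<phi>)\<bar> < - ln l" using \<epsilon>(3) by (simp_all add: mult.commute)
    fix n :: nat and \<Psi> assume n: "n \<ge> 1"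
      and \<Psi>: "\<And>w. w \<in> strip l \<Longrightarrow> (\<Psi> has_field_derivative integrand a \<alpha> \<beta> l n w) (at w)"
    have 1: "((\<lambda>s. integrand a \<alpha> \<beta> l n (w + of_real s * u) * u) has_integral
        \<Psi> (w + of_real (pi - \<phi>) * u) - \<Psi> w) {0..pi - \<phi>}"
      by (rule has_integral_primitive_on_ray[OF _ _ \<Psi>], simp add: \<phi> less_imp_le, rule in_strip[of 1 1, unfolded mult_1_left]) (use \<phi> in auto)
    have 2: "((\<lambda>s. integrand a \<alpha> \<beta> l n (w + of_real s * (- u)) * (- u)) has_integral
        \<Psi> (w + of_real \<phi> * (- u)) - \<Psi> w) {0..\<phi>}"
      by (rule has_integral_primitive_on_ray[OF _ _ \<Psi>], simp add: \<phi> less_imp_le, rule in_strip[of "- 1" "- 1", unfolded mult_minus1]) (use \<phi> in auto)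
    have e1: "\<Psi> (w + of_real (pi - \<phi>) * u) - \<Psi> w = u * X u (pi - \<phi>) n"
      using integral_unique[OF 1] by (simp add: X_def mult.commute)
    have e2: "\<Psi> (w + of_real \<phi> * (- u)) - \<Psi> w = - (u * X (- u) \<phi> n)"
      using integral_unique[OF 2] by (simp add: X_def mult.commute)
    have e3: "w + of_real (pi - \<phi>) * u = of_real pi + \<i> * of_real (\<epsilon> * (pi - \<phi>))"
      and e4: "w + of_real \<phi> * (- u) = \<i> * of_real (- (\<epsilon> * \<phi>))"
      by (simp_all add: w_def u_def algebra_simps)
    have "\<Psi> (w + of_real (pi - \<phi>) * u) - \<Psi> (w + of_real \<phi> * (- u))
        = (\<Psi> (w + of_real (pi - \<phi>) * u) - \<Psi> w) - (\<Psi> (w + of_real \<phi> * (- u)) - \<Psi> w)" by simp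
    also have "\<dots> = u * X u (pi - \<phi>) n + u * X (- u) \<phi> n" unfolding e1 e2 by simp
    finally have tot: "\<Psi> (of_real pi + \<i> * of_real (\<epsilon> * (pi - \<phi>))) - \<Psi> (\<i> * of_real (- (\<epsilon> * \<phi>)))
        = u * X u (pi - \<phi>) n + u * X (- u) \<phi> n"
      unfolding e3 e4 .
    let ?x = "complex_of_real (real n powr (- (1 / real 2)))"
    have "norm (u * X u (pi - \<phi>) n + u * X (- u) \<phi> n - 2 * u * E n * T * ?x) \<le> norm u * (C1 + C2) * real n powr (- (3 / real 2))"
      by (rule two_sided_saddle_sum[where \<kappa> = \<kappa>]) (use C1[OF n] C2[OF n] E1 in \<open>simp_all only: mult_1_right\<close>)
    then have "\<bar>Re (u * X u (pi - \<phi>) n + u * X (- u) \<phi> n - 2 * u * E n * T * ?x)\<bar> \<le> norm u * (C1 + C2) * real n powr (- (3 / real 2))"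
      using abs_Re_le_cmod order_trans by blast
    moreover have "Re (2 * u * E n * T * ?x) = sqrt (2 * pi / H) * real n powr (- (1 / 2)) * Re (E n * amplitude \<alpha> \<beta> l w * cis (pi / 4))"
    proof -
      have gen: "Re (complex_of_real c * z) = c * Re z" for c z by simp
      have "2 * u * E n * T * ?x = E n * (2 * u * T) * ?x" by (simp only: mult_ac)
      also have "\<dots> = of_real (sqrt (2 * pi / H) * real n powr (- (1 / real 2))) * (E n * amplitude \<alpha> \<beta> l w * cis (pi / 4))"
        unfolding lead_coeff of_real_mult by (simp only: mult_ac)
      finally show ?thesis by (simp only: gen of_nat_numeral)
    qed
    ultimately show "\<bar>Re (\<Psi> (of_real pi + \<i> * of_real (\<epsilon> * (pi - \<phi>))) - \<Psi> (\<i> * of_real (- (\<epsilon> * \<phi>))))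
      - sqrt (2 * pi / H) * real n powr (- (1 / 2)) * Re (exp (of_nat n * phase a l w) * amplitude \<alpha> \<beta> l w * cis (pi / 4))\<bar>
      \<le> norm u * (C1 + C2) * real n powr (- (3 / 2))"
      unfolding tot E_def minus_complex.sel(1)[of "u * X u (pi - \<phi>) n + u * X (- u) \<phi> n"] by (simp only: of_nat_numeral)
  qed
qed

section \<open>Phase and constant of the oscillating term\<close>

text \<open>
  After multiplication by the kernel, the equation \<open>slope a l \<phi> = 0\<close> is linear in
  \<open>cos \<phi>\<close>, with the solution \<open>re_plus a l\<close>; the kernel there has the value
  \<open>(1 - l^2)/(a + 1)\<close>, which is the square of the modulus of \<open>1 - l z\<close>.
\<close>

lemma saddle_point_facts:
  assumes l: "0 < l" "l < 1" and a: "- (2 * l / (1 + l)) < a" "a < 2 * l / (1 - l)"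
  defines "\<phi> \<equiv> phi_plus a l"
  shows "0 < \<phi>" "\<phi> < pi" "cos \<phi> = re_plus a l" "exp (\<i> * of_real \<phi>) = z_plus a l"
    "1 + l\<^sup>2 - 2 * l * cos \<phi> = (1 - l\<^sup>2) / (a + 1)" "slope a l \<phi> = 0"
proof -
  have P: "0 \<le> \<phi> \<and> \<phi> \<le> pi \<and> exp (\<i> * of_real \<phi>) = z_plus a l"
    unfolding \<phi>_def phi_plus_def by (rule theI'[OF phi_plus_ex1[OF l a]])
  then show e: "exp (\<i> * of_real \<phi>) = z_plus a l" by blast
  have "Re (exp (\<i> * of_real \<phi>)) = re_plus a l" unfolding e by (rule Re_Im_z_plus)
  then show c: "cos \<phi> = re_plus a l" by (simp add: Re_exp)
  note b = re_plus_bounds[OF l a]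
  have "\<phi> \<noteq> 0" "\<phi> \<noteq> pi" using c b(2) by auto
  with P show "0 < \<phi>" "\<phi> < pi" by auto
  show D: "1 + l\<^sup>2 - 2 * l * cos \<phi> = (1 - l\<^sup>2) / (a + 1)"
    unfolding c re_plus_def using b(1) l by (simp add: divide_simps) (simp add: algebra_simps)
  have "1 - l\<^sup>2 > 0" using l by (simp add: abs_square_less_1)
  then show "slope a l \<phi> = 0" unfolding slope_def D using b(1) by simp
qed

text \<open>
  At the saddle \<open>V = exp phase\<close> has modulus one and argument \<open>h\<close>, and
  \<open>X = 1 - l z\<close> has argument \<open>\<psi>\<close>. The factor
  \<open>1 / (1 - l / z)\<close> of the amplitude equals \<open>V z^(-a) / X\<close>; this accounts
  for the \<open>n + 1\<close> in front of \<open>h\<close>, for \<open>\<alpha> - a\<close> and for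
  \<open>\<beta> - 1\<close>.
\<close>

lemma oscillatory_phase_identity:
  assumes l: "0 < l" "l < 1" and a: "- (2 * l / (1 + l)) < a" "a < 2 * l / (1 - l)"
  defines "\<phi> \<equiv> phi_plus a l"
  shows "exp (of_nat n * phase a l (of_real \<phi>)) * amplitude \<alpha> \<beta> l (of_real \<phi>)
     = of_real (sqrt ((1 - l\<^sup>2) / (a + 1)) powr (\<beta> - 1))
       * cis ((real n + 1) * h_phase a l \<phi> + (\<alpha> - a) * \<phi> + (\<beta> - 1) * psi_plus a l)"
proof -
  note f = saddle_point_facts[OF l a, folded \<phi>_def]
  define z where "z = exp (\<i> * complex_of_real \<phi>)"
  define X where "X = 1 - of_real l * z"
  define Y where "Y = 1 - of_real l * exp (- (\<i> * complex_of_real \<phi>))"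
  define \<rho> where "\<rho> = sqrt ((1 - l\<^sup>2) / (a + 1))"
  define \<psi> where "\<psi> = psi_plus a l"
  define V where "V = exp (phase a l (of_real \<phi>))"
  have "1 - l\<^sup>2 > 0" using l by (simp add: abs_square_less_1)
  then have \<rho>: "\<rho> > 0" unfolding \<rho>_def using re_plus_bounds(1)[OF l a] by simp
  note nz = one_minus_not_nonpos(3,4)[OF l(1) real_in_strip[OF l], of \<phi>]
  have XY: "X \<noteq> 0" "Y \<noteq> 0" using nz by (simp_all only: X_def Y_def z_def not_False_eq_True)
  have \<psi>: "- pi < \<psi> \<and> \<psi> \<le> pi \<and> of_real \<rho> * exp (\<i> * of_real \<psi>) = X"
    unfolding \<psi>_def psi_plus_def \<rho>_def X_def z_def f(4) by (rule theI'[OF psi_plus_ex1[OF l a]])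
  have V: "V = exp (\<i> * of_real (a * \<phi>)) * X / Y"
    unfolding V_def phase_def exp_add exp_diff using XY by (simp add: X_def Y_def z_def mult.assoc)
  have z: "z \<noteq> 0" by (simp add: z_def)
  have "Ln z = \<i> * of_real \<phi>"
    unfolding z_def by (rule Ln_exp) (use f(1,2) pi_gt_zero in auto)
  then have zp: "z powr of_real (a + 1) = exp (\<i> * of_real (a * \<phi>)) * z"
  proof -
    have "of_real (a + 1) * (\<i> * of_real \<phi>) = \<i> * complex_of_real (a * \<phi>) + \<i> * of_real \<phi>" by (simp add: algebra_simps)
    then have "z powr of_real (a + 1) = exp (\<i> * complex_of_real (a * \<phi>) + \<i> * of_real \<phi>)"
      using z \<open>Ln z = _\<close> by (simp only: powr_def if_False)
    then show ?thesis unfolding exp_add z_def .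
  qed
  have "z - of_real l = z * Y"
    by (simp add: Y_def z_def algebra_simps flip: exp_add)
  then have "z powr of_real (a + 1) * (1 - of_real l * z) / (z - of_real l) = V"
    unfolding zp V X_def[symmetric] using z XY by simp
  then have h: "h_phase a l \<phi> = Arg V" by (simp add: h_phase_def Let_def z_def)
  have "norm V = 1" unfolding V_def norm_exp_eq_Re Re_phase_real[OF l] by simp
  then have Vc: "V = cis (h_phase a l \<phi>)"
    unfolding h using cis_Arg[of V] by (cases "V = 0") (auto simp: sgn_eq)
  have "Ln X = of_real (ln \<rho>) + \<i> * of_real \<psi>"
  proof -
    have "X = exp (of_real (ln \<rho>) + \<i> * of_real \<psi>)"
      using \<psi> \<rho> by (simp add: exp_add exp_of_real)
    then show ?thesis using \<psi> by (simp add: Ln_exp)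
  qed
  then have Xb: "X powr of_real \<beta> = of_real (\<rho> powr \<beta>) * cis (\<beta> * \<psi>)"
  proof -
    have e: "of_real \<beta> * (of_real (ln \<rho>) + \<i> * of_real \<psi>) = complex_of_real (\<beta> * ln \<rho>) + \<i> * of_real (\<beta> * \<psi>)"
      by (simp add: algebra_simps)
    have p: "\<rho> powr \<beta> = exp (\<beta> * ln \<rho>)" using \<rho> by (simp add: powr_def)
    have "X powr of_real \<beta> = exp (of_real \<beta> * (of_real (ln \<rho>) + \<i> * of_real \<psi>))"
      using XY(1) \<open>Ln X = _\<close> by (simp only: powr_def if_False)
    then show ?thesis unfolding e exp_add p cis_conv_exp exp_of_real .
  qed
  have invX: "1 / X = of_real (\<rho> powr (- 1)) * cis (- \<psi>)"
    using \<psi> \<rho> by (simp add: powr_minus cis_conv_exp exp_minus field_simps)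
  have "1 / Y = V * exp (- (\<i> * of_real (a * \<phi>))) * (1 / X)"
    unfolding V using XY by (simp add: field_simps flip: exp_add)
  then have invY: "1 / Y = cis (h_phase a l \<phi>) * cis (- (a * \<phi>)) * (of_real (\<rho> powr (- 1)) * cis (- \<psi>))"
    unfolding Vc invX by (simp add: cis_conv_exp)
  have amp: "amplitude \<alpha> \<beta> l (of_real \<phi>) = cis (\<alpha> * \<phi>) * X powr of_real \<beta> * (1 / Y)"
    unfolding amplitude_def by (simp add: X_def Y_def z_def cis_conv_exp mult.assoc)
  have "exp (of_nat n * phase a l (of_real \<phi>)) = V ^ n" by (simp add: V_def exp_of_nat_mult)
  then have En: "exp (of_nat n * phase a l (of_real \<phi>)) = cis (real n * h_phase a l \<phi>)"
    unfolding Vc by (simp add: Complex.DeMoivre)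
  have "exp (of_nat n * phase a l (of_real \<phi>)) * amplitude \<alpha> \<beta> l (of_real \<phi>)
     = of_real (\<rho> powr \<beta> * \<rho> powr (- 1)) * (cis (real n * h_phase a l \<phi>) * cis (\<alpha> * \<phi>) * cis (\<beta> * \<psi>)
        * cis (h_phase a l \<phi>) * cis (- (a * \<phi>)) * cis (- \<psi>))"
    unfolding En amp Xb invY of_real_mult by (simp only: mult_ac)
  also have "\<rho> powr \<beta> * \<rho> powr (- 1) = \<rho> powr (\<beta> - 1)"
    unfolding powr_add[symmetric] by simp
  also have "cis (real n * h_phase a l \<phi>) * cis (\<alpha> * \<phi>) * cis (\<beta> * \<psi>) * cis (h_phase a l \<phi>) * cis (- (a * \<phi>)) * cis (- \<psi>)
     = cis ((real n + 1) * h_phase a l \<phi> + (\<alpha> - a) * \<phi> + (\<beta> - 1) * \<psi>)"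
    unfolding cis_mult by (rule arg_cong[where f = cis]) (simp add: algebra_simps)
  finally show ?thesis by (simp add: \<rho>_def \<psi>_def)
qed

text \<open>
  With \<open>Q\<close> the product under the fourth root,
  \<open>sqrt Q = 2 l (a + 1) sin \<phi>\<close>, and the second derivative of the phase at the
  saddle is \<open>\<i> H\<close> with \<open>H = (a + 1) / (1 - l^2) * sqrt Q\<close>. What
  remains is collecting powers of \<open>1 - l^2\<close>, \<open>a + 1\<close> and \<open>Q\<close>.
\<close>

lemma oscillatory_constant:
  assumes l: "0 < l" "l < 1" and a: "- (2 * l / (1 + l)) < a" "a < 2 * l / (1 - l)" and n: "n \<ge> (1::nat)"
  defines "\<phi> \<equiv> phi_plus a l"
  defines "H \<equiv> (1 - l\<^sup>2) * (2 * l * sin \<phi>) / (1 + l\<^sup>2 - 2 * l * cos \<phi>)\<^sup>2"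
  shows "(1 - l\<^sup>2) powr (- \<beta>) / pi * (sqrt (2 * pi / H) * real n powr (- (1 / 2)) * sqrt ((1 - l\<^sup>2) / (a + 1)) powr (\<beta> - 1))
    = sqrt (2 / (real n * pi)) * (((1 - l\<^sup>2) * (a + 1)) powr (- \<beta> / 2)
                   / ((1 - l\<^sup>2) * ((a + 2) * l + a) * ((a + 2) * l - a)) powr (1 / 4))"
proof -
  note f = saddle_point_facts[OF l a, folded \<phi>_def]
  define x where "x = 1 - l\<^sup>2"
  define y where "y = a + 1"
  define Q where "Q = (1 - l\<^sup>2) * ((a + 2) * l + a) * ((a + 2) * l - a)"
  have x: "x > 0" using l by (simp add: x_def abs_square_less_1)
  have y: "y > 0" using re_plus_bounds(1)[OF l a] by (simp add: y_def)
  have sinpos: "sin \<phi> > 0" by (rule sin_gt_zero[OF f(1,2)])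
  have Qpos: "Q > 0"
  proof -
    have "- 2 * l < a * (1 + l)" "a * (1 - l) < 2 * l" using a l by (simp_all add: field_simps)
    then have "0 < (a + 2) * l + a" "0 < (a + 2) * l - a" by (simp_all add: algebra_simps)
    then show ?thesis unfolding Q_def using x by (simp add: x_def)
  qed
  have Qs: "Q = (2 * l * (a + 1) * sin \<phi>)\<^sup>2"
  proof -
    have s2: "(sin \<phi>)\<^sup>2 = 1 - (re_plus a l)\<^sup>2" using f(3) by (simp add: sin_squared_eq)
    have r: "2 * l * (a + 1) * re_plus a l = a + a * l\<^sup>2 + 2 * l\<^sup>2"
      using y l by (simp add: re_plus_def y_def)
    have "(2 * l * (a + 1) * sin \<phi>)\<^sup>2 = (2 * l * (a + 1))\<^sup>2 - (2 * l * (a + 1) * re_plus a l)\<^sup>2"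
      unfolding power_mult_distrib s2 by (simp add: algebra_simps)
    also have "\<dots> = Q" unfolding r Q_def by (simp add: algebra_simps power2_eq_square)
    finally show ?thesis by simp
  qed
  then have sQ: "sqrt Q = 2 * l * y * sin \<phi>" using sinpos l y by (simp add: y_def real_sqrt_abs)
  have H: "H = y / x * sqrt Q"
    unfolding H_def f(5) sQ x_def[symmetric] y_def[symmetric] using x y by (simp add: field_simps power2_eq_square)
  have sqQ: "sqrt Q = Q powr (1/2)" by (rule powr_half_sqrt[symmetric]) (use Qpos in simp)
  have H': "1 / H = x * y powr (- 1) * Q powr (- (1/2))"
  proof -
    have "y powr (- 1) = 1 / y" using y by (simp add: powr_minus_divide)
    moreover have "Q powr (- (1/2)) = 1 / Q powr (1/2)" by (rule powr_minus_divide)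
    ultimately show ?thesis unfolding H sqQ by simp
  qed
  have "sqrt (1 / H) = (x * y powr (- 1) * Q powr (- (1/2))) powr (1/2)"
    unfolding H' by (rule powr_half_sqrt[symmetric]) (use x in simp)
  also have "\<dots> = x powr (1/2) * (y powr (- 1)) powr (1/2) * (Q powr (- (1/2))) powr (1/2)"
    unfolding powr_mult ..
  also have "\<dots> = x powr (1/2) * y powr (- (1/2)) * Q powr (- (1/4))"
    unfolding powr_powr by simp
  finally have s1H: "sqrt (1 / H) = x powr (1/2) * y powr (- (1/2)) * Q powr (- (1/4))" .
  have 1: "sqrt (2 * pi / H) = sqrt 2 * sqrt pi * (x powr (1/2) * y powr (- (1/2)) * Q powr (- (1/4)))"
  proof -
    have "2 * pi / H = 2 * pi * (1 / H)" by simp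
    then show ?thesis by (simp only: real_sqrt_mult s1H)
  qed
  have 2: "sqrt (x / y) powr (\<beta> - 1) = x powr ((\<beta> - 1) / 2) * y powr (- ((\<beta> - 1) / 2))"
  proof -
    have "sqrt (x / y) = (x / y) powr (1/2)" by (rule powr_half_sqrt[symmetric]) (use x y in simp)
    then have "sqrt (x / y) powr (\<beta> - 1) = (x / y) powr (1/2 * (\<beta> - 1))" by (simp only: powr_powr)
    also have "1/2 * (\<beta> - 1) = (\<beta> - 1) / 2" by simp
    also have "(x / y) powr ((\<beta> - 1) / 2) = x powr ((\<beta> - 1) / 2) / y powr ((\<beta> - 1) / 2)"
      by (rule powr_divide)
    also have "\<dots> = x powr ((\<beta> - 1) / 2) * y powr (- ((\<beta> - 1) / 2))" by (simp only: powr_minus divide_inverse)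
    finally show ?thesis .
  qed
  have 3: "(x * y) powr (- \<beta> / 2) = x powr (- \<beta> / 2) * y powr (- \<beta> / 2)" using x y by (simp add: powr_mult)
  have 4: "sqrt (2 / (real n * pi)) = sqrt 2 * sqrt pi / pi * real n powr (- (1/2))"
  proof -
    have "sqrt (2 / (real n * pi)) = sqrt 2 / (sqrt (real n) * sqrt pi)" by (simp add: real_sqrt_divide real_sqrt_mult)
    also have "\<dots> = sqrt 2 * (1 / sqrt pi) * (1 / sqrt (real n))" by simp
    also have "1 / sqrt pi = sqrt pi / pi" by (subst frac_eq_eq) auto
    also have "1 / sqrt (real n) = real n powr (- (1/2))"
      using n by (simp only: powr_minus_divide powr_half_sqrt of_nat_0_le_iff)
    finally show ?thesis by simp
  qed
  have ex: "x powr (- \<beta>) * (x powr (1/2) * x powr ((\<beta> - 1) / 2)) = x powr (- \<beta> / 2)"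
    by (simp add: powr_add[symmetric] field_simps)
  have ey: "y powr (- (1/2)) * y powr (- ((\<beta> - 1) / 2)) = y powr (- \<beta> / 2)"
    by (simp add: powr_add[symmetric] field_simps)
  have "x powr (- \<beta>) / pi * (sqrt (2 * pi / H) * real n powr (- (1 / 2)) * sqrt (x / y) powr (\<beta> - 1))
     = (sqrt 2 * sqrt pi / pi * real n powr (- (1/2))) * ((x powr (- \<beta>) * (x powr (1/2) * x powr ((\<beta> - 1) / 2)))
        * (y powr (- (1/2)) * y powr (- ((\<beta> - 1) / 2))) * Q powr (- (1/4)))"
  proof -
    have gen: "A / p * (s2 * sp * (X * Y * q) * m * (X' * Y')) = (s2 * sp / p * m) * ((A * (X * X')) * (Y * Y') * q)"
      for A p s2 sp X Y q m X' Y' :: real by (simp only: divide_inverse mult_ac)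
    show ?thesis unfolding 1 2 by (rule gen)
  qed
  also have "\<dots> = sqrt (2 / (real n * pi)) * ((x * y) powr (- \<beta> / 2) / Q powr (1 / 4))"
    unfolding ex ey 3 4 powr_minus_divide[of Q "1/4"] by simp
  finally show ?thesis unfolding x_def y_def Q_def .
qed

lemma oscillatory_asymptotics:
  assumes l: "0 < l" "l < 1" and a: "- (2 * l / (1 + l)) < a" "a < 2 * l / (1 - l)"
  shows "(\<lambda>n. scaled_jacobi a \<alpha> \<beta> l n
              - sqrt (2 / (real n * pi))
                * (((1 - l\<^sup>2) * (a + 1)) powr (- \<beta> / 2)
                   / ((1 - l\<^sup>2) * ((a + 2) * l + a) * ((a + 2) * l - a)) powr (1 / 4))
                * cos ((real n + 1) * h_phase a l (phi_plus a l)
                       + (\<alpha> - a) * phi_plus a l + (\<beta> - 1) * psi_plus a l + pi / 4))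
          \<in> O(\<lambda>n. 1 / real n powr (3 / 2))"
proof -
  define \<phi> where "\<phi> = phi_plus a l"
  define H where "H = (1 - l\<^sup>2) * (2 * l * sin \<phi>) / (1 + l\<^sup>2 - 2 * l * cos \<phi>)\<^sup>2"
  note f = saddle_point_facts[OF l a, folded \<phi>_def]
  have a': "- 1 < a" "- (2 * l / (1 + l)) \<le> a" using re_plus_bounds(1)[OF l a] less_imp_le[OF a(1)] .
  let ?arg = "\<lambda>n. (real n + 1) * h_phase a l \<phi> + (\<alpha> - a) * \<phi> + (\<beta> - 1) * psi_plus a l"
  have main: "(\<lambda>n. scaled_jacobi a \<alpha> \<beta> l n - (1 - l\<^sup>2) powr (- \<beta>) / pi *
      (sqrt (2 * pi / H) * real n powr (- (1 / 2)) *
       Re (exp (of_nat n * phase a l (of_real \<phi>)) * amplitude \<alpha> \<beta> l (of_real \<phi>) * cis (pi / 4))))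
     \<in> O(\<lambda>n. real n powr (- (3 / 2)))"
    unfolding H_def by (rule oscillatory_part_raw[OF l a' f(1,2,6)])
  have Re: "Re (exp (of_nat n * phase a l (of_real \<phi>)) * amplitude \<alpha> \<beta> l (of_real \<phi>) * cis (pi / 4))
      = sqrt ((1 - l\<^sup>2) / (a + 1)) powr (\<beta> - 1) * cos (?arg n + pi / 4)" for n
    unfolding \<phi>_def oscillatory_phase_identity[OF l a] mult.assoc cis_mult by simp
  have ev: "\<forall>\<^sub>F n in sequentially. scaled_jacobi a \<alpha> \<beta> l n - (1 - l\<^sup>2) powr (- \<beta>) / pi *
      (sqrt (2 * pi / H) * real n powr (- (1 / 2)) *
       Re (exp (of_nat n * phase a l (of_real \<phi>)) * amplitude \<alpha> \<beta> l (of_real \<phi>) * cis (pi / 4)))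
     = scaled_jacobi a \<alpha> \<beta> l n
              - sqrt (2 / (real n * pi))
                * (((1 - l\<^sup>2) * (a + 1)) powr (- \<beta> / 2)
                   / ((1 - l\<^sup>2) * ((a + 2) * l + a) * ((a + 2) * l - a)) powr (1 / 4))
                * cos (?arg n + pi / 4)"
    using eventually_ge_at_top[of 1]
  proof eventually_elim
    case (elim n)
    have gen: "A * (S * m * (R * C)) = (A * (S * m * R)) * C" for A S m R C :: real by (simp only: mult_ac)
    show ?case
      unfolding Re gen oscillatory_constant[OF l a elim, of \<beta>, folded \<phi>_def, folded H_def] ..
  qed
  have pw: "real n powr (- (3 / 2)) = 1 / real n powr (3 / 2)" for n
    by (rule powr_minus_divide)
  have "(\<lambda>n. scaled_jacobi a \<alpha> \<beta> l n
              - sqrt (2 / (real n * pi))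
                * (((1 - l\<^sup>2) * (a + 1)) powr (- \<beta> / 2)
                   / ((1 - l\<^sup>2) * ((a + 2) * l + a) * ((a + 2) * l - a)) powr (1 / 4))
                * cos (?arg n + pi / 4)) \<in> O(\<lambda>n. real n powr (- (3 / 2)))"
    using main unfolding landau_o.big.in_cong[OF ev] .
  then show ?thesis unfolding pw \<phi>_def .
qed

section \<open>Cubic saddles at the end points\<close>

text \<open>
  At a cubic saddle the corrections do not cancel, so the expansion is used to first order only.
\<close>

lemma first_order_of_second_order:
  fixes A E T \<kappa> :: complex
  assumes n: "n \<ge> (1::nat)" and E: "norm E = 1"
    and A: "norm (A - E * (T * of_real (real n powr (- (1 / real 3))) + \<kappa> * of_real (real n powr (- (2 / real 3)))))
      \<le> C * real n powr (- (3 / real 3)) * norm E"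
  shows "norm (A - E * T * of_real (real n powr (- (1 / 3)))) \<le> (\<bar>C\<bar> + norm \<kappa>) * real n powr (- (2 / 3))"
proof -
  have n1: "real n powr (- 1) \<le> real n powr (- (2 / 3))" using n by (intro powr_mono) auto
  have "A - E * T * of_real (real n powr (- (1 / 3)))
      = (A - E * (T * of_real (real n powr (- (1 / real 3))) + \<kappa> * of_real (real n powr (- (2 / real 3))))) + E * (\<kappa> * of_real (real n powr (- (2 / 3))))"
    by (simp add: algebra_simps)
  also have "norm \<dots> \<le> C * real n powr (- (3 / real 3)) * norm E + norm (E * (\<kappa> * of_real (real n powr (- (2 / 3)))))"
    by (rule order_trans[OF norm_triangle_ineq add_mono[OF A order_refl]])
  also have "\<dots> = C * real n powr (- 1) + norm \<kappa> * real n powr (- (2 / 3))" using E by (simp add: norm_mult)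
  also have "\<dots> \<le> \<bar>C\<bar> * real n powr (- (2 / 3)) + norm \<kappa> * real n powr (- (2 / 3))"
    using n1 by (intro add_mono mult_mono) auto
  finally show ?thesis by (simp add: distrib_right)
qed

text \<open>
  At an end point of \<open>[0, pi]\<close> where the slope vanishes, the second derivative of the phase
  vanishes too, and the third derivative is the leading one.
\<close>

lemma cubic_ray:
  assumes l: "0 < l" "l < 1" and b: "b > 0"
    and s0: "slope a l \<phi> = 0" and sin0: "sin \<phi> = 0"
    and ray: "\<And>s. s \<in> {0..b} \<Longrightarrow> of_real \<phi> + of_real s * v \<in> strip l"
    and lead: "(deriv ^^ 3) (phase a l) (of_real \<phi>) * v ^ 3 / fact 3 = - ((of_real r * cis \<theta>) ^ 3)"
    and r: "r > 0" and \<theta>: "\<bar>real 3 * \<theta>\<bar> < pi / 2" and \<delta>: "\<delta> > 0"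
    and decay: "\<And>s. s \<in> {0..b} \<Longrightarrow> Re (phase a l (of_real \<phi> + of_real s * v)) \<le> - \<delta> * s ^ 3"
  shows "\<exists>C. \<forall>n\<ge>(1::nat). norm (v * integral {0..b} (\<lambda>s. integrand a \<alpha> \<beta> l n (of_real \<phi> + of_real s * v))
     - exp (of_nat n * phase a l (of_real \<phi>)) * amplitude \<alpha> \<beta> l (of_real \<phi>) * of_real (Gamma (4 / 3)) * (v / (of_real r * cis \<theta>))
        * of_real (real n powr (- (1 / 3)))) \<le> C * real n powr (- (2 / 3))"
proof -
  define w where "w = complex_of_real \<phi>"
  have Re_w: "Re (phase a l w) = 0" unfolding w_def by (rule Re_phase_real[OF l])
  have flat: "(deriv ^^ j) (phase a l) w = 0" if "0 < j" "j < 3" for j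
  proof -
    have "j = 1 \<or> j = 2" using that by auto
    then show ?thesis
      using deriv_phase_real[OF l, of a \<phi>] deriv2_phase_real[OF l, of a \<phi>] s0 sin0 by (auto simp: w_def)
  qed
  define T where "T = amplitude \<alpha> \<beta> l w * (of_real (Gamma (1 + 1 / real 3)) / (of_real r * cis \<theta>))"
  define \<kappa> where "\<kappa> = ray_correction a \<alpha> \<beta> l 3 ((of_real r * cis \<theta>) ^ 3) w v"
  define E where "E = (\<lambda>n::nat. exp (of_nat n * phase a l w))"
  define X where "X = (\<lambda>n. integral {0..b} (\<lambda>s. integrand a \<alpha> \<beta> l n (w + of_real s * v)))"
  have E1: "norm (E n) = 1" for n using Re_w by (simp add: E_def)
  have "\<exists>C. \<forall>n\<ge>(1::nat). norm (X n - E n * (T * of_real (real n powr (- (1 / real 3)))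
      + \<kappa> * of_real (real n powr (- (2 / real 3))))) \<le> C * real n powr (- (3 / real 3)) * norm (E n)"
    unfolding X_def E_def T_def \<kappa>_def
  proof (rule saddle_ray[OF l _ b _ flat _ r \<theta> \<delta>])
    show "Re (phase a l (w + of_real s * v) - phase a l w) \<le> - \<delta> * s ^ 3" if "s \<in> {0..b}" for s
      using decay[OF that] Re_w by (simp add: w_def)
  qed (use lead ray in \<open>auto simp: w_def\<close>)
  then obtain C where C: "\<And>n. n \<ge> (1::nat) \<Longrightarrow> norm (X n - E n * (T * of_real (real n powr (- (1 / real 3)))
      + \<kappa> * of_real (real n powr (- (2 / real 3))))) \<le> C * real n powr (- (3 / real 3)) * norm (E n)"
    by blast
  show ?thesis
    unfolding w_def[symmetric]
  proof (intro exI allI impI)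
    fix n :: nat assume n: "n \<ge> 1"
    have G: "1 + 1 / real 3 = 4 / 3" by simp
    have gen: "v * x - e * am * g * (v / c) * p = v * (x - e * (am * (g / c)) * p)" for x e am g c p :: complex
      by (simp add: algebra_simps)
    have "norm (X n - E n * T * of_real (real n powr (- (1 / 3)))) \<le> (\<bar>C\<bar> + norm \<kappa>) * real n powr (- (2 / 3))"
      by (rule first_order_of_second_order[OF n E1 C[OF n]])
    then have "norm v * norm (X n - E n * T * of_real (real n powr (- (1 / 3)))) \<le> norm v * ((\<bar>C\<bar> + norm \<kappa>) * real n powr (- (2 / 3)))"
      by (intro mult_left_mono) auto
    then show "norm (v * integral {0..b} (\<lambda>s. integrand a \<alpha> \<beta> l n (w + of_real s * v))
     - exp (of_nat n * phase a l w) * amplitude \<alpha> \<beta> l w * of_real (Gamma (4 / 3)) * (v / (of_real r * cis \<theta>))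
        * of_real (real n powr (- (1 / 3)))) \<le> norm v * (\<bar>C\<bar> + norm \<kappa>) * real n powr (- (2 / 3))"
      unfolding gen norm_mult T_def G X_def E_def mult.assoc[of "norm v"] .
  qed
qed

lemma cubic_direction_ratio:
  fixes K \<epsilon> :: real
  assumes K: "K > 0" and u: "u \<noteq> 0"
    and r: "of_real r * cis \<theta> = of_real (root 3 K) * cis (- (pi / (2 * real 3))) * u"
  shows "u / (of_real r * cis \<theta>) = cis (pi / 6) / of_real (root 3 K)"
proof -
  have gen: "u / (R * C * u) = inverse C / R" if "C \<noteq> 0" "R \<noteq> 0" for R C :: complex
    using u that by (simp add: field_simps)
  show ?thesis unfolding r using K by (subst gen) (simp_all add: cis_inverse)
qed

text \<open>
  The reflection formula \<open>Gamma (1/3) Gamma (2/3) = pi / sin (pi/3)\<close> turns the value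
  \<open>Gamma (4/3)\<close> of the model integral into the \<open>Gamma (2/3)\<close> known from the Airy
  function at \<open>0\<close>.
\<close>

lemma airy_constant:
  fixes x y l :: real
  assumes "0 < l" "0 < x" "0 < y" "K = l * y / (3 * x ^ 3)"
  shows "(x * y) powr (- \<beta>) / pi * (x powr (\<beta> - 1) * (Gamma (4 / 3) * (sqrt 3 / 2) / root 3 K))
    = y powr (- \<beta>) / (3 powr (2 / 3) * Gamma (2 / 3) * l powr (1 / 3) * y powr (1 / 3))"
proof -
  define p where "p = (3::real) powr (1 / 3)"
  define L where "L = l powr (1 / 3)"
  define Y where "Y = y powr (1 / 3)"
  have pos: "p > 0" "L > 0" "Y > 0" using assms by (simp_all add: p_def L_def Y_def)
  have K: "root 3 K = L * Y / (p * x)"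
  proof -
    have "(L * Y / (p * x)) ^ 3 = K"
      unfolding power_mult_distrib power_divide p_def L_def Y_def using assms
      by (simp add: powr_power)
    moreover have "L * Y / (p * x) > 0" using pos assms by simp
    ultimately show ?thesis by (metis odd_real_root_power_cancel odd_numeral)
  qed
  have G: "Gamma (4 / 3 :: real) * (sqrt 3 / 2) * (3 * Gamma (2 / 3)) = pi"
  proof -
    have "(1 / 3 :: real) \<notin> \<int>\<^sub>\<le>\<^sub>0" using nonpos_Ints_nonpos[of "1 / 3 :: real"] by auto
    from Gamma_plus1[OF this] have g: "Gamma (4 / 3 :: real) = Gamma (1 / 3) / 3" by simp
    have "Gamma (1 / 3 :: real) * Gamma (1 - 1 / 3) = pi / sin (pi * (1 / 3))"
    proof -
      have "complex_of_real (Gamma (1 / 3) * Gamma (1 - 1 / 3)) = of_real (pi / sin (pi * (1 / 3)))"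
        using Gamma_reflection_complex[of "of_real (1 / 3)"]
        by (simp only: of_real_mult of_real_divide[of pi] of_real_diff of_real_1 sin_of_real[symmetric] Gamma_complex_of_real[symmetric])
      then show ?thesis by (simp only: of_real_eq_iff)
    qed
    moreover have "sin (pi * (1 / 3)) = sqrt 3 / 2" using sin_60 by simp
    moreover have "1 - 1 / 3 = (2 / 3 :: real)" by simp
    ultimately have "Gamma (1 / 3 :: real) * Gamma (2 / 3) = pi / (sqrt 3 / 2)" by (simp only:)
    then show ?thesis unfolding g by (simp add: field_simps)
  qed
  have G23: "Gamma (2 / 3 :: real) > 0" by (rule Gamma_real_pos) simp
  have p2: "3 powr (2 / 3) = (3::real) / p"
  proof -
    have "3 powr (2 / 3) * p = (3::real) powr 1" unfolding p_def powr_add[symmetric] by simp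
    then show ?thesis using pos by (simp add: field_simps)
  qed
  have xx: "x powr (- \<beta>) * x powr (\<beta> - 1) * x = 1"
  proof -
    have "x powr (- \<beta>) * x powr (\<beta> - 1) * x powr 1 = x powr 0" unfolding powr_add[symmetric] by simp
    then show ?thesis using assms by simp
  qed
  define g where "g = Gamma (4 / 3 :: real) * (sqrt 3 / 2)"
  have g: "g = pi / (3 * Gamma (2 / 3))" using G G23 unfolding g_def by (subst nonzero_eq_divide_eq) auto
  have "(x * y) powr (- \<beta>) / pi * (x powr (\<beta> - 1) * (g / root 3 K))
      = (x powr (- \<beta>) * x powr (\<beta> - 1) * x) * (y powr (- \<beta>) * (p * g / (pi * (L * Y))))"
    unfolding K powr_mult using pos assms by (simp add: field_simps)
  also have "\<dots> = y powr (- \<beta>) / (3 powr (2 / 3) * Gamma (2 / 3) * L * Y)"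
    unfolding xx g p2 using pos G23 by (simp add: field_simps)
  finally show ?thesis unfolding g_def L_def Y_def .
qed

lemma phase_at_0: "phase a l (of_real 0) = 0" and amplitude_at_0:
  "0 < l \<Longrightarrow> l < 1 \<Longrightarrow> amplitude \<alpha> \<beta> l (of_real 0) = of_real ((1 - l) powr (\<beta> - 1))"
proof -
  show "phase a l (of_real 0) = 0" by (simp add: phase_def)
  assume l: "0 < l" "l < 1"
  have "amplitude \<alpha> \<beta> l (of_real 0) = of_real (1 - l) powr of_real \<beta> / of_real (1 - l)" by (simp add: amplitude_def)
  also have "of_real (1 - l) powr of_real \<beta> = complex_of_real ((1 - l) powr \<beta>)" by (rule powr_of_real) (use l in simp)
  also have "(1 - l) powr (\<beta> - 1) = (1 - l) powr \<beta> / (1 - l)" using l by (simp add: powr_diff)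
  ultimately show "amplitude \<alpha> \<beta> l (of_real 0) = of_real ((1 - l) powr (\<beta> - 1))" by simp
qed

lemma integrand_at_pi:
  assumes "0 < l"
  shows "exp (of_nat n * phase a l (of_real pi)) * amplitude \<alpha> \<beta> l (of_real pi)
    = cis (pi * (a * real n + \<alpha>)) * of_real ((1 + l) powr (\<beta> - 1))"
proof -
  have e: "exp (- (\<i> * complex_of_real pi)) = - 1" by (simp add: exp_minus)
  have ph: "phase a l (of_real pi) = \<i> * of_real a * of_real pi" by (simp add: phase_def e)
  have "amplitude \<alpha> \<beta> l (of_real pi) = exp (\<i> * of_real \<alpha> * of_real pi) * of_real (1 + l) powr of_real \<beta> / of_real (1 + l)"
    by (simp add: amplitude_def e)
  also have "of_real (1 + l) powr of_real \<beta> = complex_of_real ((1 + l) powr \<beta>)" by (rule powr_of_real) (use assms in simp)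
  also have "exp (\<i> * of_real \<alpha> * of_real pi) * complex_of_real ((1 + l) powr \<beta>) / of_real (1 + l)
     = exp (\<i> * of_real \<alpha> * of_real pi) * of_real ((1 + l) powr \<beta> / (1 + l))" by simp
  also have "(1 + l) powr \<beta> / (1 + l) = (1 + l) powr (\<beta> - 1)" using assms by (simp add: powr_diff)
  finally have am: "amplitude \<alpha> \<beta> l (of_real pi) = exp (\<i> * of_real \<alpha> * of_real pi) * of_real ((1 + l) powr (\<beta> - 1))" .
  have "exp (of_nat n * (\<i> * of_real a * of_real pi)) * exp (\<i> * of_real \<alpha> * of_real pi) = cis (pi * (a * real n + \<alpha>))"
    unfolding exp_add[symmetric] cis_conv_exp by (rule arg_cong[where f = exp]) (simp add: algebra_simps)
  then show ?thesis unfolding ph am by (simp only: mult.assoc[symmetric])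
qed

text \<open>
  For \<open>a = 2l/(1-l)\<close> the saddle lies at \<open>w = 0\<close>, that is \<open>z = 1\<close>,
  on the imaginary axis where the contour starts. A single ray from \<open>0\<close> gives the whole
  contribution.
\<close>

lemma upper_turning_raw:
  assumes l: "0 < l" "l < 1" and a: "a = 2 * l / (1 - l)"
  shows "(\<lambda>n. scaled_jacobi a \<alpha> \<beta> l n - (1 - l\<^sup>2) powr (- \<beta>) / pi *
     ((1 - l) powr (\<beta> - 1) * (Gamma (4 / 3) * (sqrt 3 / 2) / root 3 (l * (1 + l) / (3 * (1 - l) ^ 3))) * real n powr (- (1 / 3))))
     \<in> O(\<lambda>n. real n powr (- (2 / 3)))"
proof -
  define K where "K = l * (1 + l) / (3 * (1 - l) ^ 3)"
  have K: "K > 0" using l by (simp add: K_def)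
  have a0: "a > 0" using l a by simp
  have "- (2 * l / (1 + l)) \<le> 0" using l by simp
  then have a': "- 1 < a" "- (2 * l / (1 + l)) \<le> a" using a0 by linarith+
  have s0: "slope a l 0 = 0"
  proof -
    have "1 + l\<^sup>2 - 2 * l * cos 0 = (1 - l) * (1 - l)" by (simp add: power2_eq_square algebra_simps)
    moreover have "1 - l\<^sup>2 = (1 - l) * (1 + l)" by (simp add: power2_eq_square algebra_simps)
    moreover have "(1 - l) * (1 + l) / ((1 - l) * (1 - l)) = (1 + l) / (1 - l)" using l by simp
    moreover have "2 * l / (1 - l) + 1 = (1 + l) / (1 - l)" using l by (simp add: field_simps)
    ultimately show ?thesis unfolding slope_def a by (simp only: diff_self)
  qed
  obtain \<epsilon> \<delta> where \<epsilon>: "0 < \<epsilon>" "\<epsilon> \<le> 1" "pi * \<epsilon> < - ln l" "0 < \<delta>"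
    and dec: "\<And>x. x \<in> {0..pi} \<Longrightarrow> Re (phase a l (of_real x + \<i> * of_real (\<epsilon> * (x - 0)))) \<le> - \<delta> * \<bar>x - 0\<bar> ^ 3"
    using tilted_line[OF l _ _ _ slope_gap[OF l s0 cos_gap_endpoint]] by auto
  define u where "u = 1 + \<i> * of_real \<epsilon>"
  have u0: "u \<noteq> 0" by (simp add: u_def complex_eq_iff)
  obtain r \<theta> where r: "r > 0" "\<bar>real 3 * \<theta>\<bar> < pi / 2"
    "of_real r * cis \<theta> = of_real (root 3 K) * cis (- (pi / (2 * real 3))) * u"
    "(of_real r * cis \<theta>) ^ 3 = - \<i> * of_real K * u ^ 3"
    using admissible_direction[of 3 K \<epsilon>] K \<epsilon> unfolding u_def by auto
  have ray: "of_real 0 + of_real s * u = of_real s + \<i> * of_real (\<epsilon> * (s - 0))" for s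
    by (simp add: u_def algebra_simps)
  have in_strip: "of_real 0 + of_real s * u \<in> strip l" if "s \<in> {0..pi}" for s
  proof -
    have "\<epsilon> * s \<le> \<epsilon> * pi" using that \<epsilon> by (intro mult_left_mono) auto
    then have "\<epsilon> * s < - ln l" using \<epsilon>(3) mult.commute[of pi \<epsilon>] by linarith
    moreover have "0 \<le> \<epsilon> * s" using that \<epsilon> by simp
    ultimately show ?thesis unfolding ray strip_def by simp
  qed
  have d3: "(deriv ^^ 3) (phase a l) (of_real 0) * u ^ 3 / fact 3 = - ((of_real r * cis \<theta>) ^ 3)"
  proof -
    have "(1 - l\<^sup>2) * (2 * l * cos 0) / (1 + l\<^sup>2 - 2 * l * cos 0)\<^sup>2 = 6 * K"
    proof -
      have e1: "1 + l\<^sup>2 - 2 * l * cos 0 = (1 - l) * (1 - l)" by (simp add: power2_eq_square algebra_simps)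
      have e2: "1 - l\<^sup>2 = (1 - l) * (1 + l)" by (simp add: power2_eq_square algebra_simps)
      show ?thesis unfolding e1 unfolding e2 K_def using l by (simp add: power2_eq_square power3_eq_cube divide_simps)
    qed
    then have "(deriv ^^ 3) (phase a l) (of_real 0) = \<i> * of_real (6 * K)"
      using deriv3_phase_real[OF l, of 0 a] by simp
    then show ?thesis unfolding r(4) by (simp add: fact_numeral)
  qed
  have "\<exists>C. \<forall>n\<ge>(1::nat). norm (u * integral {0..pi} (\<lambda>s. integrand a \<alpha> \<beta> l n (of_real 0 + of_real s * u))
     - exp (of_nat n * phase a l (of_real 0)) * amplitude \<alpha> \<beta> l (of_real 0) * of_real (Gamma (4 / 3)) * (u / (of_real r * cis \<theta>))
        * of_real (real n powr (- (1 / 3)))) \<le> C * real n powr (- (2 / 3))"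
  proof (rule cubic_ray[OF l pi_gt_zero s0 sin_zero in_strip d3 r(1,2) \<epsilon>(4)])
    show "Re (phase a l (of_real 0 + of_real s * u)) \<le> - \<delta> * s ^ 3" if "s \<in> {0..pi}" for s
      unfolding ray using dec[OF that] that by simp
  qed
  then obtain C where C: "\<And>n. n \<ge> (1::nat) \<Longrightarrow> norm (u * integral {0..pi} (\<lambda>s. integrand a \<alpha> \<beta> l n (of_real 0 + of_real s * u))
     - exp (of_nat n * phase a l (of_real 0)) * amplitude \<alpha> \<beta> l (of_real 0) * of_real (Gamma (4 / 3)) * (u / (of_real r * cis \<theta>))
        * of_real (real n powr (- (1 / 3)))) \<le> C * real n powr (- (2 / 3))" by blast
  define c where "c = (1 - l) powr (\<beta> - 1) * (Gamma (4 / 3) * (sqrt 3 / 2) / root 3 K)"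
  have coef: "Re (exp (of_nat n * phase a l (of_real 0)) * amplitude \<alpha> \<beta> l (of_real 0) * of_real (Gamma (4 / 3)) * (u / (of_real r * cis \<theta>))
        * of_real (real n powr (- (1 / 3)))) = c * real n powr (- (1 / 3))" for n
  proof -
    show ?thesis
      unfolding phase_at_0 amplitude_at_0[OF l] cubic_direction_ratio[OF K u0 r(3)] c_def by (simp add: cos_30)
  qed
  show ?thesis
    unfolding K_def[symmetric] c_def[symmetric]
  proof (rule jacobi_bigo_transfer[OF l a', where y = "pi * \<epsilon>" and y' = 0 and C = C])
    show "0 < pi * \<epsilon>" "pi * \<epsilon> < - ln l" "\<bar>0\<bar> < - ln l" using \<epsilon> l by simp_all
    fix n :: nat and \<Psi> assume n: "n \<ge> 1"
      and \<Psi>: "\<And>w. w \<in> strip l \<Longrightarrow> (\<Psi> has_field_derivative integrand a \<alpha> \<beta> l n w) (at w)"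
    have H: "((\<lambda>s. integrand a \<alpha> \<beta> l n (of_real 0 + of_real s * u) * u) has_integral
        \<Psi> (of_real 0 + of_real pi * u) - \<Psi> (of_real 0)) {0..pi}"
      by (rule has_integral_primitive_on_ray[OF _ in_strip \<Psi>]) auto
    have e1: "\<Psi> (of_real 0 + of_real pi * u) - \<Psi> (of_real 0) = u * integral {0..pi} (\<lambda>s. integrand a \<alpha> \<beta> l n (of_real 0 + of_real s * u))"
      unfolding integral_unique[OF H, symmetric] by (subst mult.commute[of u]) (rule integral_mult_left)
    have e2: "of_real 0 + of_real pi * u = of_real pi + \<i> * of_real (pi * \<epsilon>)" by (simp add: u_def algebra_simps)
    have e3: "complex_of_real 0 = \<i> * of_real 0" by simp
    show "\<bar>Re (\<Psi> (of_real pi + \<i> * of_real (pi * \<epsilon>)) - \<Psi> (\<i> * of_real 0)) - c * real n powr (- (1 / 3))\<bar> \<le> C * real n powr (- (2 / 3))"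
      unfolding e2[symmetric] e3[symmetric] e1 coef[of n, symmetric] minus_complex.sel(1)[symmetric]
      by (rule order_trans[OF abs_Re_le_cmod C[OF n]])
  qed
qed

text \<open>
  For \<open>a = - 2l/(1+l)\<close> the saddle lies at \<open>w = pi\<close>, that is
  \<open>z = - 1\<close>, on the branch cut. The tilted line arrives there at radius one, where the cut
  integral is not yet exponentially small; the contour therefore continues vertically, along the cut, to a
  radius below one. This second ray is itself a descent direction of the cubic saddle. The two rays contribute
  the directions \<open>cis (pi/6)\<close> and \<open>\<i>\<close>, whose sum, turned by the phase
  \<open>cis (pi (a n + \<alpha>))\<close> of the integrand on the cut, has a real part proportional to
  the stated combination of cosine and sine.
\<close>

lemma lower_turning_raw:
  assumes l: "0 < l" "l < 1" and a: "a = - (2 * l / (1 + l))"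
  shows "(\<lambda>n. scaled_jacobi a \<alpha> \<beta> l n - (1 - l\<^sup>2) powr (- \<beta>) / pi *
     ((1 + l) powr (\<beta> - 1) * (Gamma (4 / 3) * (sqrt 3 / 2) / root 3 (l * (1 - l) / (3 * (1 + l) ^ 3)))
       * (cos (pi * (a * real n + \<alpha>)) - sqrt 3 * sin (pi * (a * real n + \<alpha>))) * real n powr (- (1 / 3))))
     \<in> O(\<lambda>n. real n powr (- (2 / 3)))"
proof -
  define K where "K = l * (1 - l) / (3 * (1 + l) ^ 3)"
  have K: "K > 0" using l by (simp add: K_def)
  have a': "- 1 < a" "- (2 * l / (1 + l)) \<le> a" unfolding a using l by (simp_all add: field_simps)
  have e1: "1 + l\<^sup>2 - 2 * l * cos pi = (1 + l) * (1 + l)" by (simp add: power2_eq_square algebra_simps)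
  have e2: "1 - l\<^sup>2 = (1 - l) * (1 + l)" by (simp add: power2_eq_square algebra_simps)
  have s0: "slope a l pi = 0"
  proof -
    have "(1 - l) * (1 + l) / ((1 + l) * (1 + l)) = (1 - l) / (1 + l)" using l by simp
    moreover have "- (2 * l / (1 + l)) + 1 = (1 - l) / (1 + l)" using l by (simp add: field_simps)
    ultimately show ?thesis unfolding slope_def a using e1 e2 by (simp only: diff_self)
  qed
  obtain \<epsilon> \<delta> where \<epsilon>: "0 < \<epsilon>" "\<epsilon> \<le> 1" "pi * \<epsilon> < - ln l" "0 < \<delta>"
    and dec: "\<And>x. x \<in> {0..pi} \<Longrightarrow> Re (phase a l (of_real x + \<i> * of_real (\<epsilon> * (x - pi)))) \<le> - \<delta> * \<bar>x - pi\<bar> ^ 3"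
    using tilted_line[OF l _ _ _ slope_gap[OF l s0 cos_gap_endpoint]] by auto
  define u where "u = 1 + \<i> * of_real \<epsilon>"
  have u0: "u \<noteq> 0" by (simp add: u_def complex_eq_iff)
  obtain r \<theta> where r: "r > 0" "\<bar>real 3 * \<theta>\<bar> < pi / 2"
    "of_real r * cis \<theta> = of_real (root 3 K) * cis (- (pi / (2 * real 3))) * u"
    "(of_real r * cis \<theta>) ^ 3 = - \<i> * of_real K * u ^ 3"
    using admissible_direction[of 3 K \<epsilon>] K \<epsilon> unfolding u_def by auto
  have ray: "of_real pi + of_real s * (- u) = of_real (pi - s) + \<i> * of_real (\<epsilon> * ((pi - s) - pi))" for s
    by (simp add: u_def algebra_simps)
  have in_strip: "of_real pi + of_real s * (- u) \<in> strip l" if "s \<in> {0..pi}" for s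
  proof -
    have "\<epsilon> * s \<le> \<epsilon> * pi" using that \<epsilon> by (intro mult_left_mono) auto
    then have "\<epsilon> * s < - ln l" using \<epsilon>(3) mult.commute[of pi \<epsilon>] by linarith
    moreover have "0 \<le> \<epsilon> * s" using that \<epsilon> by simp
    ultimately show ?thesis unfolding ray strip_def by simp
  qed
  have D3: "(deriv ^^ 3) (phase a l) (of_real pi) = - \<i> * of_real (6 * K)"
  proof -
    have "(1 - l\<^sup>2) * (2 * l * cos pi) / (1 + l\<^sup>2 - 2 * l * cos pi)\<^sup>2 = - (6 * K)"
      unfolding e1 unfolding e2 K_def using l by (simp add: power2_eq_square power3_eq_cube divide_simps)
    then show ?thesis using deriv3_phase_real[OF l, of pi a] by simp
  qed
  have d3: "(deriv ^^ 3) (phase a l) (of_real pi) * (- u) ^ 3 / fact 3 = - ((of_real r * cis \<theta>) ^ 3)"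
    unfolding r(4) D3 by (simp add: fact_numeral power3_eq_cube)
  have rK: "root 3 K > 0" "(root 3 K) ^ 3 = K" using K by simp_all
  have d3': "(deriv ^^ 3) (phase a l) (of_real pi) * \<i> ^ 3 / fact 3 = - ((of_real (root 3 K) * cis 0) ^ 3)"
  proof -
    have "(of_real (root 3 K) * cis 0) ^ 3 = complex_of_real K" using rK(2) by (simp flip: of_real_power)
    moreover have "\<i> ^ 3 = - \<i>" by (simp add: power3_eq_cube)
    ultimately show ?thesis unfolding D3 by (simp add: fact_numeral algebra_simps)
  qed
  have "\<exists>C. \<forall>n\<ge>(1::nat). norm ((- u) * integral {0..pi} (\<lambda>s. integrand a \<alpha> \<beta> l n (of_real pi + of_real s * (- u)))
     - exp (of_nat n * phase a l (of_real pi)) * amplitude \<alpha> \<beta> l (of_real pi) * of_real (Gamma (4 / 3)) * ((- u) / (of_real r * cis \<theta>))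
        * of_real (real n powr (- (1 / 3)))) \<le> C * real n powr (- (2 / 3))"
  proof (rule cubic_ray[OF l pi_gt_zero s0 sin_pi in_strip d3 r(1,2) \<epsilon>(4)])
    show "Re (phase a l (of_real pi + of_real s * (- u))) \<le> - \<delta> * s ^ 3" if "s \<in> {0..pi}" for s
      unfolding ray using dec[of "pi - s"] that by simp
  qed
  then obtain C1 where C1: "\<And>n. n \<ge> (1::nat) \<Longrightarrow> norm ((- u) * integral {0..pi} (\<lambda>s. integrand a \<alpha> \<beta> l n (of_real pi + of_real s * (- u)))
     - exp (of_nat n * phase a l (of_real pi)) * amplitude \<alpha> \<beta> l (of_real pi) * of_real (Gamma (4 / 3)) * ((- u) / (of_real r * cis \<theta>))
        * of_real (real n powr (- (1 / 3)))) \<le> C1 * real n powr (- (2 / 3))" by blast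
  \<comment> \<open>along the vertical ray the phase is real up to a constant and starts with \<open>- K s^3\<close>;
    on a short piece the fourth order error is at most half of that\<close>
  obtain b where b: "0 < b" "b < - ln l" "\<And>s. s \<in> {0..b} \<Longrightarrow> Re (phase a l (of_real pi + of_real s * \<i>)) \<le> - (K / 2) * s ^ 3"
  proof -
    define L where "L = - ln l"
    have L: "L > 0" using l by (simp add: L_def)
    define S where "S = closed_segment (of_real pi) (complex_of_real pi + of_real (L / 2) * \<i>)"
    have S_strip: "S \<subseteq> strip l"
      unfolding S_def using L by (intro closed_segment_subset convex_strip) (auto simp: strip_def L_def)
    obtain M where M: "M \<ge> 0" "\<And>z. z \<in> S \<Longrightarrow> norm (phase a l z - (\<Sum>i\<le>3. (deriv ^^ i) (phase a l) (of_real pi) * (z - of_real pi) ^ i / fact i)) \<le> M * norm (z - of_real pi) ^ Suc 3"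
      using Taylor_bound_compact[OF holomorphic_phase[OF l(1), of a] open_strip _ _ S_strip, of 3] unfolding S_def by auto
    define b where "b = min (L / 2) (K / (2 * (M + 1)))"
    have b: "0 < b" using L K M by (auto simp: b_def)
    have "b \<le> L / 2" unfolding b_def by (rule min.cobounded1)
    note b = b this
    have bK: "M * b \<le> K / 2"
    proof -
      have "b \<le> K / (2 * (M + 1))" unfolding b_def by (rule min.cobounded2)
      then have "b * (2 * (M + 1)) \<le> K" using M by (simp add: pos_le_divide_eq)
      then show ?thesis using b by (simp add: algebra_simps)
    qed
    have "Re (phase a l (of_real pi + of_real s * \<i>)) \<le> - (K / 2) * s ^ 3" if s: "s \<in> {0..b}" for s
    proof -
      let ?z = "complex_of_real pi + of_real s * \<i>"
      have z: "?z \<in> S" unfolding S_def closed_segment_def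
        using s b L by (intro CollectI exI[of _ "s / (L / 2)"]) (auto simp: scaleR_conv_of_real field_simps)
      have zp: "?z - of_real pi = \<i> * of_real s" by simp
      have sum: "(\<Sum>i\<le>3. (deriv ^^ i) (phase a l) (of_real pi) * (\<i> * of_real s) ^ i / fact i) = phase a l (of_real pi) - of_real (K * s ^ 3)"
        using deriv_phase_real[OF l, of a pi] deriv2_phase_real[OF l, of a pi] s0 D3
        by (simp add: numeral_3_eq_3 numeral_2_eq_2 algebra_simps)
      have "\<bar>Re (phase a l ?z - (phase a l (of_real pi) - of_real (K * s ^ 3)))\<bar> \<le> M * norm (\<i> * complex_of_real s) ^ Suc 3"
        using M(2)[OF z] unfolding zp sum by (rule order_trans[OF abs_Re_le_cmod])
      then have "Re (phase a l ?z) \<le> - K * s ^ 3 + M * s ^ 4"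
        using s Re_phase_real[OF l, of a pi] by (simp add: norm_mult abs_le_iff del: power_Suc)
      also have "M * s ^ 4 \<le> (K / 2) * s ^ 3"
      proof -
        have "M * s \<le> M * b" using s M by (intro mult_left_mono) auto
        then have "(M * s) * s ^ 3 \<le> (K / 2) * s ^ 3" using bK s by (intro mult_right_mono) auto
        then show ?thesis by (simp add: numeral_eq_Suc mult_ac)
      qed
      finally show ?thesis by simp
    qed
    then show ?thesis using that b L unfolding L_def by auto
  qed
  have in_strip': "of_real pi + of_real s * \<i> \<in> strip l" if "s \<in> {0..b}" for s
    using that b by (auto simp: strip_def)
  have "\<exists>C. \<forall>n\<ge>(1::nat). norm (\<i> * integral {0..b} (\<lambda>s. integrand a \<alpha> \<beta> l n (of_real pi + of_real s * \<i>))
     - exp (of_nat n * phase a l (of_real pi)) * amplitude \<alpha> \<beta> l (of_real pi) * of_real (Gamma (4 / 3)) * (\<i> / (of_real (root 3 K) * cis 0))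
        * of_real (real n powr (- (1 / 3)))) \<le> C * real n powr (- (2 / 3))"
    by (rule cubic_ray[OF l b(1) s0 sin_pi in_strip' d3' rK(1) _ _ b(3)]) (use K pi_gt_zero in auto)
  then obtain C2 where C2: "\<And>n. n \<ge> (1::nat) \<Longrightarrow> norm (\<i> * integral {0..b} (\<lambda>s. integrand a \<alpha> \<beta> l n (of_real pi + of_real s * \<i>))
     - exp (of_nat n * phase a l (of_real pi)) * amplitude \<alpha> \<beta> l (of_real pi) * of_real (Gamma (4 / 3)) * (\<i> / (of_real (root 3 K) * cis 0))
        * of_real (real n powr (- (1 / 3)))) \<le> C2 * real n powr (- (2 / 3))" by blast
  define c where "c = (1 + l) powr (\<beta> - 1) * (Gamma (4 / 3) * (sqrt 3 / 2) / root 3 K)"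
  let ?A = "\<lambda>n. pi * (a * real n + \<alpha>)"
  define P where "P = (\<lambda>n::nat. exp (of_nat n * phase a l (of_real pi)) * amplitude \<alpha> \<beta> l (of_real pi) * of_real (Gamma (4 / 3)))"
  have coef: "Re (P n * (\<i> / (of_real (root 3 K) * cis 0)) * of_real (real n powr (- (1 / 3)))
       - P n * ((- u) / (of_real r * cis \<theta>)) * of_real (real n powr (- (1 / 3))))
     = c * (cos (?A n) - sqrt 3 * sin (?A n)) * real n powr (- (1 / 3))" for n
  proof -
    define q where "q = (1 + l) powr (\<beta> - 1) * Gamma (4 / 3) / root 3 K * real n powr (- (1 / 3))"
    have "P n * (\<i> / (of_real (root 3 K) * cis 0)) * of_real (real n powr (- (1 / 3)))
       - P n * ((- u) / (of_real r * cis \<theta>)) * of_real (real n powr (- (1 / 3)))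
       = of_real q * (cis (?A n) * (\<i> + cis (pi / 6)))"
      unfolding P_def integrand_at_pi[OF l(1)] minus_divide_left[symmetric] cubic_direction_ratio[OF K u0 r(3)] q_def using rK
      by (simp add: field_simps)
    then have "Re (P n * (\<i> / (of_real (root 3 K) * cis 0)) * of_real (real n powr (- (1 / 3)))
       - P n * ((- u) / (of_real r * cis \<theta>)) * of_real (real n powr (- (1 / 3)))) = q * Re (cis (?A n) * (\<i> + cis (pi / 6)))" by simp
    also have "Re (cis (?A n) * (\<i> + cis (pi / 6))) = sqrt 3 / 2 * (cos (?A n) - sqrt 3 * sin (?A n))"
      by (simp add: cos_30 sin_30 algebra_simps)
    also have "q * (sqrt 3 / 2 * X) = c * X * real n powr (- (1 / 3))" for X
      unfolding c_def q_def by (simp only: divide_inverse mult_ac)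
    finally show ?thesis .
  qed
  show ?thesis
    unfolding K_def[symmetric] c_def[symmetric]
  proof (rule jacobi_bigo_transfer[OF l a', where y = b and y' = "- (pi * \<epsilon>)" and C = "C2 + C1"])
    show "0 < b" "b < - ln l" by fact+
    have "0 < pi * \<epsilon>" using \<epsilon> by simp
    then show "\<bar>- (pi * \<epsilon>)\<bar> < - ln l" using \<epsilon>(3) by simp
    fix n :: nat and \<Psi> assume n: "n \<ge> 1"
      and \<Psi>: "\<And>w. w \<in> strip l \<Longrightarrow> (\<Psi> has_field_derivative integrand a \<alpha> \<beta> l n w) (at w)"
    define I1 where "I1 = (- u) * integral {0..pi} (\<lambda>s. integrand a \<alpha> \<beta> l n (of_real pi + of_real s * (- u)))"
    define I2 where "I2 = \<i> * integral {0..b} (\<lambda>s. integrand a \<alpha> \<beta> l n (of_real pi + of_real s * \<i>))"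
    have H1: "((\<lambda>s. integrand a \<alpha> \<beta> l n (of_real pi + of_real s * (- u)) * (- u)) has_integral
        \<Psi> (of_real pi + of_real pi * (- u)) - \<Psi> (of_real pi)) {0..pi}"
      by (rule has_integral_primitive_on_ray[OF _ in_strip \<Psi>]) auto
    have i1: "\<Psi> (of_real pi + of_real pi * (- u)) - \<Psi> (of_real pi) = I1"
      unfolding I1_def integral_unique[OF H1, symmetric] by (subst mult.commute[of "- u"]) (rule integral_mult_left)
    have H2: "((\<lambda>s. integrand a \<alpha> \<beta> l n (of_real pi + of_real s * \<i>) * \<i>) has_integral
        \<Psi> (of_real pi + of_real b * \<i>) - \<Psi> (of_real pi)) {0..b}"
      by (rule has_integral_primitive_on_ray[OF _ in_strip' \<Psi>]) (use b in auto)
    have i2: "\<Psi> (of_real pi + of_real b * \<i>) - \<Psi> (of_real pi) = I2"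
      unfolding I2_def integral_unique[OF H2, symmetric] by (subst mult.commute[of "\<i>"]) (rule integral_mult_left)
    have p1: "of_real pi + of_real pi * (- u) = \<i> * of_real (- (pi * \<epsilon>))" by (simp add: u_def algebra_simps)
    have p2: "of_real pi + of_real b * \<i> = of_real pi + \<i> * complex_of_real b" by simp
    have tot: "\<Psi> (of_real pi + \<i> * of_real b) - \<Psi> (\<i> * of_real (- (pi * \<epsilon>))) = I2 - I1"
      unfolding i1[symmetric] i2[symmetric] p1 p2 by simp
    define Z1 where "Z1 = P n * ((- u) / (of_real r * cis \<theta>)) * of_real (real n powr (- (1 / 3)))"
    define Z2 where "Z2 = P n * (\<i> / (of_real (root 3 K) * cis 0)) * of_real (real n powr (- (1 / 3)))"
    have b1: "norm (I1 - Z1) \<le> C1 * real n powr (- (2 / 3))" using C1[OF n] unfolding I1_def Z1_def P_def .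
    have b2: "norm (I2 - Z2) \<le> C2 * real n powr (- (2 / 3))" using C2[OF n] unfolding I2_def Z2_def P_def .
    have "norm ((I2 - I1) - (Z2 - Z1)) \<le> norm (I2 - Z2) + norm (I1 - Z1)"
      using norm_triangle_ineq4[of "I2 - Z2" "I1 - Z1"] by (simp add: algebra_simps)
    also have "\<dots> \<le> (C2 + C1) * real n powr (- (2 / 3))" using b1 b2 by (simp add: distrib_right)
    finally have "\<bar>Re ((I2 - I1) - (Z2 - Z1))\<bar> \<le> (C2 + C1) * real n powr (- (2 / 3))"
      by (rule order_trans[OF abs_Re_le_cmod])
    then show "\<bar>Re (\<Psi> (of_real pi + \<i> * of_real b) - \<Psi> (\<i> * of_real (- (pi * \<epsilon>)))) - c * (cos (?A n) - sqrt 3 * sin (?A n)) * real n powr (- (1 / 3))\<bar>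
       \<le> (C2 + C1) * real n powr (- (2 / 3))"
      unfolding tot coef[symmetric] Z1_def[symmetric] Z2_def[symmetric] minus_complex.sel(1)[of "I2 - I1" "Z2 - Z1"] .
  qed
qed

text \<open>
  The main term does not vanish, so the additive error may be written as a relative one.
\<close>

lemma upper_turning_asymptotics:
  fixes \<alpha> \<beta> a l :: real
  assumes l: "0 < l" "l < 1" and a: "a = 2 * l / (1 - l)"
  shows "\<exists>E :: nat \<Rightarrow> real. E \<in> O(\<lambda>n. 1 / real n powr (1 / 3)) \<and>
          (\<forall>n\<ge>1. scaled_jacobi a \<alpha> \<beta> l n =
             (1 + l) powr (- \<beta>)
             / (3 powr (2 / 3) * Gamma (2 / 3) * real n powr (1 / 3) * l powr (1 / 3)
                * (1 + l) powr (1 / 3))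
             * (1 + E n))"
proof -
  define c where "c = (1 + l) powr (- \<beta>) / (3 powr (2/3) * Gamma (2/3) * l powr (1/3) * (1 + l) powr (1/3))"
  have "Gamma (2/3 :: real) > 0"
    by (rule Gamma_real_pos) simp
  then have c: "c > 0"
    using l by (simp add: c_def)
  define R where "R n = scaled_jacobi a \<alpha> \<beta> l n - c * real n powr (-(1/3))" for n
  have fac: "1 - l\<^sup>2 = (1 - l) * (1 + l)"
    by (simp add: power2_eq_square algebra_simps)
  have main: "(1 - l\<^sup>2) powr (-\<beta>) / pi * ((1 - l) powr (\<beta> - 1) *
      (Gamma (4/3) * (sqrt 3 / 2) / root 3 (l * (1 + l) / (3 * (1 - l)^3)))) = c"
    unfolding fac c_def using l by (intro airy_constant[where K = "l * (1 + l) / (3 * (1 - l)^3)"]) auto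
  have R: "R \<in> O(\<lambda>n. real n powr (-(2/3)))"
    using upper_turning_raw[OF l a, of \<alpha> \<beta>] unfolding R_def main[symmetric]
    by (simp only: mult.assoc)
  define E where "E n = R n * (real n powr (1/3) / c)" for n
  have E: "E \<in> O(\<lambda>n. 1 / real n powr (1/3))"
  proof -
    have "E \<in> O(\<lambda>n. real n powr (-(2/3)) * (real n powr (1/3) / c))"
      unfolding E_def by (intro landau_o.big.mult R landau_o.big_refl)
    also have "(\<lambda>n. real n powr (-(2/3)) * (real n powr (1/3) / c)) \<in> O(\<lambda>n. 1 / real n powr (1/3))"
      using c by real_asymp
    finally show ?thesis .
  qed
  have "scaled_jacobi a \<alpha> \<beta> l n = (1 + l) powr (- \<beta>)
      / (3 powr (2 / 3) * Gamma (2 / 3) * real n powr (1 / 3) * l powr (1 / 3) * (1 + l) powr (1 / 3))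
      * (1 + E n)" if "n \<ge> 1" for n
  proof -
    define p where "p = real n powr (1/3)"
    have p: "p > 0"
      using that by (simp add: p_def)
    have "scaled_jacobi a \<alpha> \<beta> l n = c * real n powr (-(1/3)) + R n"
      by (simp add: R_def)
    also have "real n powr (-(1/3)) = 1 / p"
      by (simp only: p_def powr_minus_divide)
    also have "c * (1 / p) + R n = c / p * (1 + R n * (p / c))"
      using c p by (simp add: field_simps)
    also have "c / p = (1 + l) powr (- \<beta>)
        / (3 powr (2 / 3) * Gamma (2 / 3) * p * l powr (1 / 3) * (1 + l) powr (1 / 3))"
      unfolding c_def by (simp add: mult_ac)
    finally show ?thesis
      unfolding E_def p_def .
  qed
  with E show ?thesis
    by blast
qed

lemma lower_turning_asymptotics:
  fixes \<alpha> \<beta> a l :: real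
  assumes l: "0 < l" "l < 1" and a: "a = - (2 * l / (1 + l))"
  shows "(\<lambda>n. scaled_jacobi a \<alpha> \<beta> l n
              - (1 - l) powr (- \<beta>)
                / (3 powr (2 / 3) * Gamma (2 / 3) * real n powr (1 / 3) * l powr (1 / 3)
                   * (1 - l) powr (1 / 3))
                * (cos ((a * real n + \<alpha>) * pi) - sqrt 3 * sin ((a * real n + \<alpha>) * pi)))
          \<in> O(\<lambda>n. 1 / real n powr (2 / 3))"
proof -
  define c where "c = (1 - l) powr (- \<beta>) / (3 powr (2/3) * Gamma (2/3) * l powr (1/3) * (1 - l) powr (1/3))"
  have fac: "1 - l\<^sup>2 = (1 + l) * (1 - l)"
    by (simp add: power2_eq_square algebra_simps)
  have main: "(1 - l\<^sup>2) powr (-\<beta>) / pi * ((1 + l) powr (\<beta> - 1) *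
      (Gamma (4/3) * (sqrt 3 / 2) / root 3 (l * (1 - l) / (3 * (1 + l)^3)))) = c"
    unfolding fac c_def using l by (intro airy_constant[where K = "l * (1 - l) / (3 * (1 + l)^3)"]) auto
  have "(\<lambda>n. scaled_jacobi a \<alpha> \<beta> l n - c * real n powr (-(1/3)) *
      (cos (pi * (a * real n + \<alpha>)) - sqrt 3 * sin (pi * (a * real n + \<alpha>))))
      \<in> O(\<lambda>n. real n powr (-(2/3)))"
    using lower_turning_raw[OF l a, of \<alpha> \<beta>] unfolding main[symmetric]
    by (simp only: mult_ac)
  moreover have "c * real n powr (-(1/3)) = (1 - l) powr (- \<beta>)
      / (3 powr (2 / 3) * Gamma (2 / 3) * real n powr (1 / 3) * l powr (1 / 3) * (1 - l) powr (1 / 3))" for n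
    unfolding c_def powr_minus_divide by (simp add: mult_ac)
  ultimately show ?thesis
    by (simp only: powr_minus_divide mult.commute[of pi])
qed

section \<open>Asymptotics in all regimes\<close>

theorem theorem1:
  fixes \<alpha> \<beta> a l :: real
  assumes "\<alpha> > -1" and "\<beta> > -1" and "a > -1" and "0 < l" and "l < 1"
  shows
    "(a \<in> {- (2 * l / (1 + l)) <..< 2 * l / (1 - l)} \<longrightarrow>
        (\<lambda>n. scaled_jacobi a \<alpha> \<beta> l n
              - sqrt (2 / (real n * pi))
                * (((1 - l\<^sup>2) * (a + 1)) powr (- \<beta> / 2)
                   / ((1 - l\<^sup>2) * ((a + 2) * l + a) * ((a + 2) * l - a)) powr (1 / 4))
                * cos ((real n + 1) * h_phase a l (phi_plus a l)
                       + (\<alpha> - a) * phi_plus a l + (\<beta> - 1) * psi_plus a l + pi / 4))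
          \<in> O(\<lambda>n. 1 / real n powr (3 / 2)))
     \<and> (a = 2 * l / (1 - l) \<longrightarrow>
        (\<exists>E :: nat \<Rightarrow> real. E \<in> O(\<lambda>n. 1 / real n powr (1 / 3)) \<and>
          (\<forall>n\<ge>1. scaled_jacobi a \<alpha> \<beta> l n =
             (1 + l) powr (- \<beta>)
             / (3 powr (2 / 3) * Gamma (2 / 3) * real n powr (1 / 3) * l powr (1 / 3)
                * (1 + l) powr (1 / 3))
             * (1 + E n))))
     \<and> (a = - (2 * l / (1 + l)) \<longrightarrow>
        (\<lambda>n. scaled_jacobi a \<alpha> \<beta> l n
              - (1 - l) powr (- \<beta>)
                / (3 powr (2 / 3) * Gamma (2 / 3) * real n powr (1 / 3) * l powr (1 / 3)
                   * (1 - l) powr (1 / 3))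
                * (cos ((a * real n + \<alpha>) * pi) - sqrt 3 * sin ((a * real n + \<alpha>) * pi)))
          \<in> O(\<lambda>n. 1 / real n powr (2 / 3)))
     \<and> (a \<in> {-1 <..< - (2 * l / (1 + l))} \<union> {2 * l / (1 - l) <..} \<longrightarrow>
        (\<exists>C \<rho> :: real. C > 0 \<and> 0 < \<rho> \<and> \<rho> < 1 \<and>
          (\<forall>n::nat. n \<ge> 1 \<and> a * real n + \<alpha> \<in> \<int> \<longrightarrow> \<bar>scaled_jacobi a \<alpha> \<beta> l n\<bar> \<le> C * \<rho> ^ n)))
     \<and> (a \<in> {-1 <..< - (2 * l / (1 + l))} \<and>
        (INF n\<in>{1::nat..}. infdist (a * real n + \<alpha>) \<int>) > 0 \<longrightarrow>
        (\<exists>c \<rho> :: real. \<exists>N::nat. c > 0 \<and> \<rho> > 1 \<and>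
          (\<forall>n\<ge>N. \<bar>scaled_jacobi a \<alpha> \<beta> l n\<bar> \<ge> c * \<rho> ^ n)))
     \<and> (a \<in> {2 * l / (1 - l) <..} \<longrightarrow>
        (\<exists>C \<rho> :: real. C > 0 \<and> 0 < \<rho> \<and> \<rho> < 1 \<and>
          (\<forall>n::nat. n \<ge> 1 \<and> a * real n + \<alpha> \<notin> \<int> \<longrightarrow> \<bar>scaled_jacobi a \<alpha> \<beta> l n\<bar> \<le> C * \<rho> ^ n)))"
proof (intro conjI impI)
  show "(\<lambda>n. scaled_jacobi a \<alpha> \<beta> l n
              - sqrt (2 / (real n * pi))
                * (((1 - l\<^sup>2) * (a + 1)) powr (- \<beta> / 2)
                   / ((1 - l\<^sup>2) * ((a + 2) * l + a) * ((a + 2) * l - a)) powr (1 / 4))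
                * cos ((real n + 1) * h_phase a l (phi_plus a l)
                       + (\<alpha> - a) * phi_plus a l + (\<beta> - 1) * psi_plus a l + pi / 4))
          \<in> O(\<lambda>n. 1 / real n powr (3 / 2))"
    if "a \<in> {- (2 * l / (1 + l)) <..< 2 * l / (1 - l)}"
    using oscillatory_asymptotics[OF assms(4,5), of a \<alpha> \<beta>] that by simp
next
  assume "a = 2 * l / (1 - l)"
  from upper_turning_asymptotics[OF assms(4,5) this]
  show "\<exists>E :: nat \<Rightarrow> real. E \<in> O(\<lambda>n. 1 / real n powr (1 / 3)) \<and>
          (\<forall>n\<ge>1. scaled_jacobi a \<alpha> \<beta> l n =
             (1 + l) powr (- \<beta>)
             / (3 powr (2 / 3) * Gamma (2 / 3) * real n powr (1 / 3) * l powr (1 / 3)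
                * (1 + l) powr (1 / 3))
             * (1 + E n))" .
next
  assume "a = - (2 * l / (1 + l))"
  from lower_turning_asymptotics[OF assms(4,5) this]
  show "(\<lambda>n. scaled_jacobi a \<alpha> \<beta> l n
              - (1 - l) powr (- \<beta>)
                / (3 powr (2 / 3) * Gamma (2 / 3) * real n powr (1 / 3) * l powr (1 / 3)
                   * (1 - l) powr (1 / 3))
                * (cos ((a * real n + \<alpha>) * pi) - sqrt 3 * sin ((a * real n + \<alpha>) * pi)))
          \<in> O(\<lambda>n. 1 / real n powr (2 / 3))" .
next
  assume "a \<in> {-1 <..< - (2 * l / (1 + l))} \<union> {2 * l / (1 - l) <..}"
  then show "\<exists>C \<rho> :: real. C > 0 \<and> 0 < \<rho> \<and> \<rho> < 1 \<and>
      (\<forall>n::nat. n \<ge> 1 \<and> a * real n + \<alpha> \<in> \<int> \<longrightarrow> \<bar>scaled_jacobi a \<alpha> \<beta> l n\<bar> \<le> C * \<rho> ^ n)"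
  proof
    assume "a \<in> {-1 <..< - (2 * l / (1 + l))}"
    then have "-1 < a" "a < - (2 * l / (1 + l))"
      by simp_all
    from decay_below[OF assms(4,5) this, of \<alpha> \<beta>] show ?thesis
      by blast
  next
    assume "a \<in> {2 * l / (1 - l) <..}"
    then have "2 * l / (1 - l) < a"
      by simp
    from decay_above[OF assms(4,5) this, of \<alpha> \<beta>] show ?thesis
      by blast
  qed
next
  assume "a \<in> {-1 <..< - (2 * l / (1 + l))} \<and>
      (INF n\<in>{1::nat..}. infdist (a * real n + \<alpha>) \<int>) > 0"
  then have "-1 < a" "a < - (2 * l / (1 + l))"
      "(INF n\<in>{1::nat..}. infdist (a * real n + \<alpha>) \<int>) > 0"
    by simp_all
  from growth_below[OF assms(4,5) this]
  show "\<exists>c \<rho> :: real. \<exists>N::nat. c > 0 \<and> \<rho> > 1 \<and>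
      (\<forall>n\<ge>N. \<bar>scaled_jacobi a \<alpha> \<beta> l n\<bar> \<ge> c * \<rho> ^ n)"
    by blast
next
  assume "a \<in> {2 * l / (1 - l) <..}"
  then have "2 * l / (1 - l) < a"
    by simp
  from decay_above[OF assms(4,5) this, of \<alpha> \<beta>]
  show "\<exists>C \<rho> :: real. C > 0 \<and> 0 < \<rho> \<and> \<rho> < 1 \<and>
      (\<forall>n::nat. n \<ge> 1 \<and> a * real n + \<alpha> \<notin> \<int> \<longrightarrow> \<bar>scaled_jacobi a \<alpha> \<beta> l n\<bar> \<le> C * \<rho> ^ n)"
    by blast
qed

end
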